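(* Let $\alpha$ be a $\Sigma_1$-admissible ordinal. If there exists a maximal $\alpha$-recursively enumerable subset of $\alpha$, then $\alpha$ is countable.
   Context: An ordinal $\alpha$ is $\Sigma_1$-admissible if it is a limit ordinal and $L_\alpha$ (the $\alpha$-th level of Gödel's constructible hierarchy) satisfies the replacement axiom for $\Sigma_1$ formulas with parameters in $L_\alpha$. A set $K\subseteq\alpha$ is $\alpha$-finite if $K\in L_\alpha$. A set $A\subseteq\alpha$ is $\alpha$-recursively enumerable ($\alpha$-RE) if it is $\Sigma_1$-definable over $L_\alpha$ with parameters (equivalently, the domain of a partial function whose graph is $\Sigma_1(L_\alpha)$). An $\alpha$-RE set $M\subseteq\alpha$ is maximal if its complement $\bar M=\alpha\setminus M$ is unbounded in $\alpha$ and there is no $\alpha$-RE set $W$ such that both $\bar M\cap W$ and $\bar M\setminus W$ are not $\alpha$-finite. *)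

theory Defs
  imports "HOL-Library.Countable_Set"
begin

text \<open>
  Sets are well-founded trees whose children are indexed by (part of) the type \<^typ>\<open>'a\<close>,
  taken up to extensional equality. For infinite \<^typ>\<open>'a\<close> the resulting type consists of
  all sets hereditarily of cardinality at most that of \<^typ>\<open>'a\<close>; its ordinals are
  exactly the ordinals of cardinality at most that of \<^typ>\<open>'a\<close>
  (cf. \<open>ex_elts_iff\<close> and \<open>ex_Ord_iso\<close> below). Hence a statement about all ordinals of
  \<open>'a hset\<close>, with \<^typ>\<open>'a\<close> a type variable, is a statement about arbitrary ordinals.
\<close>

datatype 'a tree = Node "'a \<Rightarrow> 'a tree option"

primrec children :: "'a tree \<Rightarrow> 'a tree set" where
  "children (Node f) = {t. Some t \<in> range f}"

inductive tree_eq :: "'a tree \<Rightarrow> 'a tree \<Rightarrow> bool" where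
  "(\<And>u. u \<in> children s \<Longrightarrow> \<exists>v\<in>children t. tree_eq u v) \<Longrightarrow>
   (\<And>v. v \<in> children t \<Longrightarrow> \<exists>u\<in>children s. tree_eq u v) \<Longrightarrow> tree_eq s t"

lemma tree_children_induct:
  assumes "\<And>t. (\<And>s. s \<in> children t \<Longrightarrow> P s) \<Longrightarrow> P t"
  shows "P t"
proof (induction t)
  case (Node f)
  show ?case
    by (rule assms) (use Node in \<open>force simp: image_iff\<close>)
qed

lemma tree_eq_refl: "tree_eq t t"
  by (induction t rule: tree_children_induct) (metis tree_eq.intros)

lemma tree_eq_sym: "tree_eq s t \<Longrightarrow> tree_eq t s"
proof (induction rule: tree_eq.induct)
  case (1 s t)
  then show ?case by (intro tree_eq.intros) blast+
qed

lemma tree_eq_trans: "tree_eq s t \<Longrightarrow> tree_eq t u \<Longrightarrow> tree_eq s u"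
proof (induction arbitrary: u rule: tree_eq.induct)
  case (1 s t)
  from 1(3) show ?case
    by (cases rule: tree_eq.cases) (rule tree_eq.intros; meson 1(1,2))
qed

quotient_type 'a hset = "'a tree" / tree_eq
  by (rule equivpI; rule reflpI sympI transpI; fact tree_eq_refl tree_eq_sym tree_eq_trans)

definition elts :: "'a hset \<Rightarrow> 'a hset set" where
  "elts x = abs_hset ` children (rep_hset x)"

lemma elts_abs_hset: "elts (abs_hset t) = abs_hset ` children t"
proof -
  have "tree_eq (rep_hset (abs_hset t)) t"
    using Quotient3_hset by (metis Quotient3_rep_abs tree_eq_refl)
  then show ?thesis
    unfolding elts_def
    by (cases rule: tree_eq.cases) (auto simp: image_iff hset.abs_eq_iff, (meson tree_eq_sym)+)
qed

lemma hset_eqI: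
  assumes "elts x = elts y"
  shows "x = y"
proof -
  have "tree_eq (rep_hset x) (rep_hset y)"
  proof (rule tree_eq.intros)
    fix u assume "u \<in> children (rep_hset x)"
    then have "abs_hset u \<in> elts y" using assms by (auto simp: elts_def)
    then show "\<exists>v\<in>children (rep_hset y). tree_eq u v"
      by (auto simp: elts_def hset.abs_eq_iff)
  next
    fix v assume "v \<in> children (rep_hset y)"
    then have "abs_hset v \<in> elts x" using assms by (auto simp: elts_def)
    then show "\<exists>u\<in>children (rep_hset x). tree_eq u v"
      by (auto simp: elts_def hset.abs_eq_iff) (meson tree_eq_sym)
  qed
  then show ?thesis
    by (metis Quotient3_hset Quotient3_rel_rep)
qed

lemma hset_induct:
  assumes "\<And>x. (\<And>y. y \<in> elts x \<Longrightarrow> P y) \<Longrightarrow> P x"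
  shows "P x"
proof -
  have "P (abs_hset t)" for t
    by (induction t rule: tree_children_induct) (rule assms, auto simp: elts_abs_hset)
  then show ?thesis by (metis Quotient3_hset Quotient3_abs_rep)
qed

lemma wf_elts: "wf {(x, y). x \<in> elts y}"
proof (rule wfUNIVI)
  fix P :: "'a hset \<Rightarrow> bool" and x :: "'a hset"
  assume step: "\<forall>x. (\<forall>y. (y, x) \<in> {(x, y). x \<in> elts y} \<longrightarrow> P y) \<longrightarrow> P x"
  show "P x"
    by (induction x rule: hset_induct) (use step in simp)
qed

lemma ex_elts_iff: "(\<exists>x :: 'a hset. elts x = S) \<longleftrightarrow> (\<exists>f :: 'a \<Rightarrow> 'a hset. S \<subseteq> range f)"
proof
  assume "\<exists>x :: 'a hset. elts x = S"
  then obtain x :: "'a hset" where x: "elts x = S" by blast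
  obtain g where g: "rep_hset x = Node g" by (cases "rep_hset x")
  have "S \<subseteq> range (\<lambda>i. abs_hset (the (g i)))"
  proof
    fix y assume "y \<in> S"
    then obtain i t where "Some t = g i" "y = abs_hset t"
      unfolding x [symmetric] elts_def g by auto
    then have "y = abs_hset (the (g i))" by (metis option.sel)
    then show "y \<in> range (\<lambda>i. abs_hset (the (g i)))" by blast
  qed
  then show "\<exists>f :: 'a \<Rightarrow> 'a hset. S \<subseteq> range f" by blast
next
  assume "\<exists>f :: 'a \<Rightarrow> 'a hset. S \<subseteq> range f"
  then obtain f :: "'a \<Rightarrow> 'a hset" where f: "S \<subseteq> range f" by blast
  let ?t = "Node (\<lambda>i. if f i \<in> S then Some (rep_hset (f i)) else None)"
  have abs_rep: "abs_hset (rep_hset x) = x" for x :: "'a hset"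
    by (metis Quotient3_hset Quotient3_abs_rep)
  have "children ?t = rep_hset ` S"
    using f by (auto simp: image_iff split: if_splits)
  then have "elts (abs_hset ?t) = S"
    by (simp add: elts_abs_hset image_image abs_rep)
  then show "\<exists>x :: 'a hset. elts x = S" by blast
qed


definition Transset :: "'a hset \<Rightarrow> bool" where
  "Transset x \<longleftrightarrow> (\<forall>y\<in>elts x. elts y \<subseteq> elts x)"

definition Ord :: "'a hset \<Rightarrow> bool" where
  "Ord \<alpha> \<longleftrightarrow> Transset \<alpha> \<and> (\<forall>\<beta>\<in>elts \<alpha>. Transset \<beta>)"

definition Limit :: "'a hset \<Rightarrow> bool" where
  "Limit \<alpha> \<longleftrightarrow> Ord \<alpha> \<and> elts \<alpha> \<noteq> {} \<and> (\<forall>\<beta>\<in>elts \<alpha>. \<exists>\<gamma>\<in>elts \<alpha>. \<beta> \<in> elts \<gamma>)"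

lemma ex_Ord_iso:
  fixes r :: "'a rel"
  assumes "Well_order r"
  shows "\<exists>(\<alpha> :: 'a hset) f. Ord \<alpha> \<and> bij_betw f (Field r) (elts \<alpha>) \<and>
    (\<forall>i\<in>Field r. \<forall>j\<in>Field r. (i, j) \<in> r - Id \<longleftrightarrow> f i \<in> elts (f j))"
proof -
  let ?r = "r - Id"
  have wf: "wf ?r" using assms by (simp add: well_order_on_def)
  have trans: "trans r" and antisym: "antisym r" and tot: "total_on (Field r) r"
    using assms by (auto simp: order_on_defs)
  define mk :: "'a hset set \<Rightarrow> 'a hset" where "mk S = (SOME x. elts x = S)" for S
  have mk: "elts (mk (f ` A)) = f ` A" for f :: "'a \<Rightarrow> 'a hset" and A
    unfolding mk_def by (rule someI_ex) (auto simp: ex_elts_iff)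
  define f :: "'a \<Rightarrow> 'a hset" where "f = wfrec ?r (\<lambda>g j. mk (g ` {i. (i, j) \<in> ?r}))"
  have "f j = mk (f ` {i. (i, j) \<in> ?r})" for j
    unfolding f_def by (subst wfrec [OF wf]) (auto simp: cut_def intro!: arg_cong [of _ _ mk])
  then have elts_f: "elts (f j) = f ` {i. (i, j) \<in> ?r}" for j
    by (metis mk)
  define \<alpha> where "\<alpha> = mk (f ` Field r)"
  have elts_\<alpha>: "elts \<alpha> = f ` Field r" by (simp add: \<alpha>_def mk)
  have less_trans: "(i, k) \<in> ?r" if "(i, j) \<in> ?r" "(j, k) \<in> ?r" for i j k
    using that trans antisym by (auto dest: transD antisymD)
  have Trans: "Transset (f j)" for j
    unfolding Transset_def
  proof
    fix y assume "y \<in> elts (f j)"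
    then obtain i where "(i, j) \<in> ?r" "y = f i" unfolding elts_f by blast
    then show "elts y \<subseteq> elts (f j)" using less_trans by (simp only: elts_f) blast
  qed
  have Ord: "Ord \<alpha>"
    unfolding Ord_def Transset_def [of \<alpha>] using Trans
    by (auto simp: elts_\<alpha> elts_f FieldI1)
  have irrefl: "x \<notin> elts x" for x :: "'a hset"
    by (induction x rule: hset_induct) blast
  have fwd: "f i \<in> elts (f j)" if "(i, j) \<in> ?r" for i j
    using that by (auto simp: elts_f)
  have inj: "inj_on f (Field r)"
  proof (rule inj_onI, rule ccontr)
    fix i j assume "i \<in> Field r" "j \<in> Field r" "f i = f j" "i \<noteq> j"
    then have "(i, j) \<in> ?r \<or> (j, i) \<in> ?r" using tot by (auto simp: total_on_def)
    then show False using fwd irrefl \<open>f i = f j\<close> by metis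
  qed
  have "(i, j) \<in> ?r \<longleftrightarrow> f i \<in> elts (f j)" if "i \<in> Field r" "j \<in> Field r" for i j
    using that inj by (auto simp: elts_f inj_on_eq_iff FieldI1)
  with Ord inj show ?thesis
    unfolding bij_betw_def by (intro exI [of _ \<alpha>] exI [of _ f]) (auto simp: elts_\<alpha>)
qed


datatype fm = Mem nat nat | Eq nat nat | Neg fm | And fm fm | Ex nat fm

primrec fv :: "fm \<Rightarrow> nat set" where
  "fv (Mem i j) = {i, j}"
| "fv (Eq i j) = {i, j}"
| "fv (Neg \<phi>) = fv \<phi>"
| "fv (And \<phi> \<psi>) = fv \<phi> \<union> fv \<psi>"
| "fv (Ex i \<phi>) = fv \<phi> - {i}"

primrec sat :: "'a hset set \<Rightarrow> fm \<Rightarrow> (nat \<Rightarrow> 'a hset) \<Rightarrow> bool" where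
  "sat X (Mem i j) e \<longleftrightarrow> e i \<in> elts (e j)"
| "sat X (Eq i j) e \<longleftrightarrow> e i = e j"
| "sat X (Neg \<phi>) e \<longleftrightarrow> \<not> sat X \<phi> e"
| "sat X (And \<phi> \<psi>) e \<longleftrightarrow> sat X \<phi> e \<and> sat X \<psi> e"
| "sat X (Ex i \<phi>) e \<longleftrightarrow> (\<exists>x\<in>X. sat X \<phi> (e(i := x)))"

inductive Delta0 :: "fm \<Rightarrow> bool" where
  "Delta0 (Mem i j)"
| "Delta0 (Eq i j)"
| "Delta0 \<phi> \<Longrightarrow> Delta0 (Neg \<phi>)"
| "Delta0 \<phi> \<Longrightarrow> Delta0 \<psi> \<Longrightarrow> Delta0 (And \<phi> \<psi>)"
| "Delta0 \<phi> \<Longrightarrow> i \<noteq> j \<Longrightarrow> Delta0 (Ex i (And (Mem i j) \<phi>))"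

text \<open>Any finite block of existential quantifiers, possibly empty, in front of a \<open>\<Delta>\<^sub>0\<close> formula.\<close>

inductive Sigma1 :: "fm \<Rightarrow> bool" where
  "Delta0 \<phi> \<Longrightarrow> Sigma1 \<phi>"
| "Sigma1 \<phi> \<Longrightarrow> Sigma1 (Ex i \<phi>)"

text \<open>
  Variable 0 is the argument; the remaining free variables are parameters from \<open>X\<close>.
  Only the free ones are constrained, so that the empty set is definable over the
  empty structure.
\<close>

definition definable :: "(fm \<Rightarrow> bool) \<Rightarrow> 'a hset set \<Rightarrow> 'a hset set \<Rightarrow> bool" where
  "definable \<Gamma> X S \<longleftrightarrow> (\<exists>\<phi> e. \<Gamma> \<phi> \<and> (\<forall>i\<in>fv \<phi> - {0}. e i \<in> X) \<and>
     S = {x \<in> X. sat X \<phi> (e(0 := x))})"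

text \<open>
  \<open>L \<alpha>\<close> is the union of the definable power sets of \<open>L \<beta>\<close>, \<open>\<beta> < \<alpha>\<close>, which for
  ordinals \<open>\<alpha>\<close> is equivalent to the usual three-clause recursion. No definable set is
  lost by restricting to members of the type: if \<^typ>\<open>'a\<close> is infinite, then \<open>L \<beta>\<close>
  has cardinality at most that of \<^typ>\<open>'a\<close> for every ordinal \<open>\<beta>\<close> of the type; and
  if \<^typ>\<open>'a\<close> is finite, the type has no limit ordinals.
\<close>

function L :: "'a hset \<Rightarrow> 'a hset set" where
  "L \<alpha> = {x. \<exists>\<beta>\<in>elts \<alpha>. definable (\<lambda>_. True) (L \<beta>) (elts x)}"
  by auto
termination
  by (relation "{(x, y). x \<in> elts y}") (auto simp: wf_elts)

declare L.simps [simp del]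

text \<open>
  Replacement is for functions that are total on the set \<open>a\<close>; with partial functions it
  would imply separation for \<open>\<Sigma>\<^sub>1\<close> formulas. Variables 0 and 1 are the argument and the value.
\<close>

definition Sigma1_replacement :: "'a hset set \<Rightarrow> bool" where
  "Sigma1_replacement X \<longleftrightarrow> (\<forall>\<phi> e. \<forall>a\<in>X. Sigma1 \<phi> \<longrightarrow> (\<forall>i\<in>fv \<phi> - {0, 1}. e i \<in> X) \<longrightarrow>
     (\<forall>x\<in>elts a \<inter> X. \<exists>!y. y \<in> X \<and> sat X \<phi> (e(0 := x, 1 := y))) \<longrightarrow>
     (\<exists>b\<in>X. \<forall>y\<in>X. y \<in> elts b \<longleftrightarrow> (\<exists>x\<in>elts a \<inter> X. sat X \<phi> (e(0 := x, 1 := y)))))"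

definition Sigma1_admissible :: "'a hset \<Rightarrow> bool" where
  "Sigma1_admissible \<alpha> \<longleftrightarrow> Limit \<alpha> \<and> Sigma1_replacement (L \<alpha>)"

definition alpha_finite :: "'a hset \<Rightarrow> 'a hset set \<Rightarrow> bool" where
  "alpha_finite \<alpha> K \<longleftrightarrow> K \<subseteq> elts \<alpha> \<and> (\<exists>k\<in>L \<alpha>. elts k = K)"

definition alpha_RE :: "'a hset \<Rightarrow> 'a hset set \<Rightarrow> bool" where
  "alpha_RE \<alpha> A \<longleftrightarrow> A \<subseteq> elts \<alpha> \<and> definable Sigma1 (L \<alpha>) A"

definition unbounded_in :: "'a hset \<Rightarrow> 'a hset set \<Rightarrow> bool" where
  "unbounded_in \<alpha> A \<longleftrightarrow> (\<forall>\<beta>\<in>elts \<alpha>. \<exists>\<gamma>\<in>A. \<beta> = \<gamma> \<or> \<beta> \<in> elts \<gamma>)"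

definition maximal_alpha_RE :: "'a hset \<Rightarrow> 'a hset set \<Rightarrow> bool" where
  "maximal_alpha_RE \<alpha> M \<longleftrightarrow> alpha_RE \<alpha> M \<and> unbounded_in \<alpha> (elts \<alpha> - M) \<and>
     \<not> (\<exists>W. alpha_RE \<alpha> W \<and> \<not> alpha_finite \<alpha> ((elts \<alpha> - M) \<inter> W) \<and>
          \<not> alpha_finite \<alpha> ((elts \<alpha> - M) - W))"

end

theory Submission
  imports Defs
begin

text \<open>
  Let \<open>C\<close> be the complement of a maximal set and suppose \<open>\<alpha>\<close> is uncountable. Maximality makes
  \<open>C\<close> cohesive: it is contained, up to a bounded set, in every \<open>\<alpha>\<close>-RE set that meets it
  unboundedly. Hence every \<open>C \<inter> \<beta>\<close> is \<open>\<alpha>\<close>-finite and, by collection, decided at some stage.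
  The order type of \<open>C \<inter> [\<beta>, \<gamma>)\<close> as approximated at stage \<open>\<sigma>\<close> decreases in \<open>\<beta>\<close> and \<open>\<sigma>\<close>, so
  that for fixed \<open>\<gamma>\<close> it takes only finitely many values.

  If every tail of \<open>C\<close> is uncountable, then for each of the uncountably many countable \<open>\<nu> < \<alpha>\<close>,
  almost all \<open>\<gamma> \<in> C\<close> have \<open>\<nu>\<close> among these values. By the pigeonhole principle, infinitely many
  \<open>\<nu>\<close> share a bound from which on this holds, and a \<open>\<gamma>\<close> above it contradicts finiteness.

  Otherwise fix a tail \<open>T\<close> that is countable. For \<open>\<gamma> \<in> T\<close> let \<open>\<kappa> \<gamma>\<close> be the number of values
  that the approximated position of \<open>\<gamma>\<close> takes. By condensation, definable sets
  of positions in \<open>T\<close> are elements of \<open>L \<alpha>\<close>: \<open>\<alpha>\<close> is uncountable, so a countable transitive set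
  included in \<open>L \<alpha>\<close> has all its subsets that are definable over \<open>L \<alpha>\<close> in \<open>L \<alpha>\<close>. Let \<open>E\<close> be
  the set of positions after which \<open>\<kappa>\<close> never gets smaller, and \<open>A\<close> an alternating subset of \<open>E\<close>.
  The \<open>\<gamma>\<close> which are at some stage at a position \<open>j \<in> A\<close>, having taken by then at least as many
  values as the final owner of \<open>j\<close> does in total, form an \<open>\<alpha>\<close>-RE set that splits \<open>C\<close>.
\<close>

section \<open>Sets and ordinals\<close>

text \<open>A set that splits C must be Sigma_1, but membership in C and final positions come
  without Sigma_1 definitions. At a given stage the visible position of \<gamma> is only an upper
  bound of the final one, so that on its way down \<gamma> may pass through positions in A although
  it ends outside A. The set of all \<gamma> ever seen at a position in A may therefore fail to
  split C.

  The remedy is to count values. As long as \<gamma> is above its final position, it has taken fewer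
  than \<kappa> \<gamma> values. If that final position is in E, then \<kappa> \<gamma> is at most
  \<kappa> of the owner of any later position j, so \<gamma> cannot show at j the number of values
  that the owner of j takes in total.

  The set A and the function \<kappa> on final positions are not computed by the Sigma_1 formula but
  enter it as parameters. Hence they have to be elements of L \<alpha>, which is where the
  countability of the tail and the uncountability of \<alpha> meet.\<close>

instance fm :: countable
  by countable_datatype

definition mk :: "'a hset set \<Rightarrow> 'a hset" where
  "mk S = (SOME x. elts x = S)"

text \<open>Not every set of hsets is the extension of an hset: by \<open>ex_elts_iff\<close> its
  members must be indexed by \<open>'a\<close>. Since \<open>mk\<close> is meaningful on small sets
  only, set-forming operations come with a proof of smallness.\<close>

definition small :: "'a hset set \<Rightarrow> bool" where
  "small S \<longleftrightarrow> (\<exists>x. elts x = S)"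

lemma elts_mk: "small S \<Longrightarrow> elts (mk S) = S"
  unfolding small_def mk_def by (rule someI_ex)

lemma mk_elts [simp]: "mk (elts x) = x"
  by (rule hset_eqI, rule elts_mk) (auto simp: small_def)

lemma small_elts [simp]: "small (elts x)"
  by (auto simp: small_def)

lemma small_subset: "small S \<Longrightarrow> T \<subseteq> S \<Longrightarrow> small T"
  unfolding small_def ex_elts_iff by blast

lemma small_image:
  fixes f :: "'a hset \<Rightarrow> 'a hset"
  assumes "small S" shows "small (f ` S)"
proof -
  obtain g :: "'a \<Rightarrow> 'a hset" where "S \<subseteq> range g"
    using assms unfolding small_def ex_elts_iff by blast
  then have "f ` S \<subseteq> range (\<lambda>i. f (g i))" by blast
  then show ?thesis unfolding small_def ex_elts_iff by (rule exI [of _ "\<lambda>i. f (g i)"])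
qed

lemma elts_inject: "elts x = elts y \<longleftrightarrow> x = y"
  using hset_eqI by blast

lemma mem_irrefl [simp]: "x \<notin> elts x"
  by (induction x rule: hset_induct) blast

lemma mem_asym: "x \<in> elts y \<Longrightarrow> y \<notin> elts x"
  by (induction x arbitrary: y rule: hset_induct) blast

lemma Ord_mem: "Ord \<alpha> \<Longrightarrow> \<beta> \<in> elts \<alpha> \<Longrightarrow> Ord \<beta>"
  unfolding Ord_def Transset_def by blast

lemma Ord_trans: "Ord \<gamma> \<Longrightarrow> \<alpha> \<in> elts \<beta> \<Longrightarrow> \<beta> \<in> elts \<gamma> \<Longrightarrow> \<alpha> \<in> elts \<gamma>"
  unfolding Ord_def Transset_def by blast

lemma Ord_elts_subset: "Ord \<gamma> \<Longrightarrow> \<beta> \<in> elts \<gamma> \<Longrightarrow> elts \<beta> \<subseteq> elts \<gamma>"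
  unfolding Ord_def Transset_def by blast

lemma OrdI: "(\<And>\<beta>. \<beta> \<in> elts \<alpha> \<Longrightarrow> Ord \<beta>) \<Longrightarrow> (\<And>\<beta>. \<beta> \<in> elts \<alpha> \<Longrightarrow> elts \<beta> \<subseteq> elts \<alpha>) \<Longrightarrow> Ord \<alpha>"
  unfolding Ord_def Transset_def by blast

text \<open>Nested induction: if a and b are incomparable, the outer hypothesis puts every element
  of a into b and the inner one every element of b into a, so that a = b by extensionality.\<close>

lemma Ord_linear: "Ord a \<Longrightarrow> Ord b \<Longrightarrow> a \<in> elts b \<or> a = b \<or> b \<in> elts a"
proof (induction a arbitrary: b rule: hset_induct)
  case (1 a)
  note IHa = "1.IH" and Oa = \<open>Ord a\<close>
  show ?case using \<open>Ord b\<close>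
  proof (induction b rule: hset_induct)
    case (1 b)
    show ?case
    proof (rule ccontr)
      assume n: "\<not> ?thesis"
      have "x \<in> elts b" if "x \<in> elts a" for x
        using IHa [OF that Ord_mem [OF Oa that] \<open>Ord b\<close>] n Ord_trans [OF Oa _ that] that by blast
      moreover have "x \<in> elts a" if "x \<in> elts b" for x
        using "1.IH" [OF that Ord_mem [OF \<open>Ord b\<close> that]] n Ord_trans [OF \<open>Ord b\<close> _ that] that by blast
      ultimately have "a = b" by (intro hset_eqI) blast
      then show False using n by blast
    qed
  qed
qed

lemma Ord_subset_iff:
  assumes "Ord a" "Ord b"
  shows "elts a \<subseteq> elts b \<longleftrightarrow> a \<in> elts b \<or> a = b"
  using Ord_linear [OF assms] Ord_elts_subset [OF assms(2)] mem_irrefl by blast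

lemma Ord_not_mem_iff:
  assumes "Ord a" "Ord b"
  shows "a \<notin> elts b \<longleftrightarrow> elts b \<subseteq> elts a"
  using Ord_linear [OF assms] Ord_subset_iff [OF assms(2,1)] mem_irrefl mem_asym by blast

lemma Ord_least:
  assumes "P a" "Ord a"
  obtains b where "P b" "Ord b" "\<And>c. c \<in> elts b \<Longrightarrow> \<not> P c" "\<And>c. P c \<Longrightarrow> Ord c \<Longrightarrow> elts b \<subseteq> elts c"
proof -
  obtain b where b: "b \<in> {x. P x \<and> Ord x}" "\<And>y. y \<in> elts b \<Longrightarrow> y \<notin> {x. P x \<and> Ord x}"
    using wfE_min [OF wf_elts, of a "{x. P x \<and> Ord x}"] assms by auto
  show ?thesis
  proof (rule that [of b])
    show "\<not> P c" if "c \<in> elts b" for c using b that Ord_mem by blast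
    show "elts b \<subseteq> elts c" if "P c" "Ord c" for c
      using b that Ord_not_mem_iff [of c b] by blast
  qed (use b in auto)
qed

text \<open>
  The transitive collapse of the restriction of membership to the class \<open>K\<close>. If \<open>K\<close> consists
  of ordinals, this maps \<open>\<gamma>\<close> to the order type of \<open>K \<inter> \<gamma>\<close>.
\<close>

definition clps :: "'a hset set \<Rightarrow> 'a hset \<Rightarrow> 'a hset" where
  "clps K = wfrec {(x, y). x \<in> elts y} (\<lambda>F x. mk (F ` (K \<inter> elts x)))"

lemma elts_clps: "elts (clps K x) = clps K ` (K \<inter> elts x)"
proof -
  have "clps K x = mk (clps K ` (K \<inter> elts x))"
    unfolding clps_def by (subst wfrec [OF wf_elts]) (auto simp: cut_def intro!: arg_cong [of _ _ mk])
  moreover have "small (clps K ` (K \<inter> elts x))"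
    by (intro small_image small_subset [OF small_elts]) auto
  ultimately show ?thesis by (simp add: elts_mk)
qed

lemma clps_cong: "K \<inter> elts x = K' \<inter> elts x \<Longrightarrow> Ord x \<Longrightarrow> clps K x = clps K' x"
proof (induction x rule: hset_induct)
  case (1 x)
  have "clps K y = clps K' y" if "y \<in> elts x" for y
  proof (rule 1(1) [OF that _ Ord_mem [OF 1(3) that]])
    show "K \<inter> elts y = K' \<inter> elts y" using 1(2) Ord_elts_subset [OF 1(3) that] by blast
  qed
  then have "clps K ` (K \<inter> elts x) = clps K' ` (K' \<inter> elts x)"
    using 1(2) by (metis IntE image_cong)
  then have "elts (clps K x) = elts (clps K' x)" unfolding elts_clps .
  then show ?case by (rule hset_eqI)
qed

lemma Ord_clps: "Ord x \<Longrightarrow> Ord (clps K x)"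
proof (induction x rule: hset_induct)
  case (1 x)
  show ?case
  proof (rule OrdI)
    fix b assume "b \<in> elts (clps K x)"
    then obtain y where y: "y \<in> K" "y \<in> elts x" "b = clps K y" unfolding elts_clps by blast
    show "Ord b" using 1 y Ord_mem by blast
    have "K \<inter> elts y \<subseteq> K \<inter> elts x" using Ord_elts_subset [OF 1(2) y(2)] by blast
    then show "elts b \<subseteq> elts (clps K x)" unfolding elts_clps y(3) by (rule image_mono)
  qed
qed

lemma clps_mono_mem: "y \<in> K \<Longrightarrow> y \<in> elts x \<Longrightarrow> clps K y \<in> elts (clps K x)"
  unfolding elts_clps by blast

text \<open>Counting more elements can only raise a position. A later stage or a later start shrinks
  the class that is counted, which is why approximated positions descend.\<close>

lemma clps_anti:
  assumes "K \<subseteq> K'" "Ord x"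
  shows "elts (clps K x) \<subseteq> elts (clps K' x)"
  using assms(2)
proof (induction x rule: hset_induct)
  case (1 x)
  show ?case
  proof
    fix z assume "z \<in> elts (clps K x)"
    then obtain y where y: "y \<in> K" "y \<in> elts x" "z = clps K y" unfolding elts_clps by blast
    have oy: "Ord y" using 1(2) y Ord_mem by blast
    have "z \<in> elts (clps K' y) \<or> z = clps K' y"
      using 1(1) [OF y(2) oy] iffD1 [OF Ord_subset_iff [OF Ord_clps [OF oy] Ord_clps [OF oy]]] unfolding y(3) by blast
    moreover have "clps K' y \<in> elts (clps K' x)"
      using y assms(1) by (intro clps_mono_mem) auto
    ultimately show "z \<in> elts (clps K' x)"
      using Ord_trans [OF Ord_clps [OF 1(2)]] by blast
  qed
qed

text \<open>On a transitive part \<open>S\<close> of \<open>K\<close> nothing is skipped, hence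
  nothing moves. Condensation uses this to recover the original set after the collapse.\<close>

lemma clps_fix:
  assumes "\<And>x. x \<in> S \<Longrightarrow> elts x \<subseteq> S" "S \<subseteq> K" "x \<in> S"
  shows "clps K x = x"
  using assms(3)
proof (induction x rule: hset_induct)
  case (1 x)
  have "K \<inter> elts x = elts x" using assms 1(2) by blast
  moreover have "clps K y = y" if "y \<in> elts x" for y using 1 that assms by blast
  ultimately show ?case by (intro hset_eqI) (auto simp: elts_clps)
qed

text \<open>Every tail of a sequence of ordinals attains its minimum, and the minima of successive
  tails increase weakly.\<close>

lemma ordinal_mono_subseq:
  fixes s :: "nat \<Rightarrow> 'a hset"
  assumes "\<And>n. Ord (s n)"
  shows "\<exists>r :: nat \<Rightarrow> nat. strict_mono r \<and> (\<forall>m n. m \<le> n \<longrightarrow> elts (s (r m)) \<subseteq> elts (s (r n)))"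
proof -
  have ex: "\<exists>n\<ge>k. \<forall>l\<ge>k. elts (s n) \<subseteq> elts (s l)" for k
  proof -
    obtain b where b: "\<exists>n\<ge>k. b = s n" "\<And>c. \<exists>n\<ge>k. c = s n \<Longrightarrow> Ord c \<Longrightarrow> elts b \<subseteq> elts c"
      by (rule Ord_least [of "\<lambda>x. \<exists>n\<ge>k. x = s n" "s k"]) (use assms in auto)
    then show ?thesis using assms by metis
  qed
  define m where "m k = (SOME n. n \<ge> k \<and> (\<forall>l\<ge>k. elts (s n) \<subseteq> elts (s l)))" for k
  have m: "m k \<ge> k \<and> (\<forall>l\<ge>k. elts (s (m k)) \<subseteq> elts (s l))" for k
    unfolding m_def by (rule someI_ex) (use ex in blast)
  define r where "r = rec_nat (m 0) (\<lambda>_ k. m (Suc k))"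
  have r0: "r 0 = m 0" and rS: "r (Suc n) = m (Suc (r n))" for n by (auto simp: r_def)
  have sm: "strict_mono r"
    unfolding strict_mono_Suc_iff using m rS by (metis Suc_le_lessD)
  have step: "elts (s (r n)) \<subseteq> elts (s (r (Suc n)))" for n
  proof -
    have "\<exists>k. r n = m k \<and> k \<le> r n" using m r0 rS by (cases n) auto
    moreover have "r n \<le> r (Suc n)" using sm by (simp add: strict_mono_less_eq)
    ultimately show ?thesis using m by (metis order_trans)
  qed
  show ?thesis
    using sm lift_Suc_mono_le [of "\<lambda>n. elts (s (r n))", OF step] by blast
qed

text \<open>Infinitely many values would give a sequence of distinct values
  \<open>f (a n) (b n)\<close>. Three successive refinements make the values, the \<open>a n\<close>
  and the \<open>b n\<close> weakly increasing; antitonicity then makes the values weakly decreasing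
  as well, so that two of them coincide.\<close>

lemma finite_antitone_range:
  fixes f :: "'a hset \<Rightarrow> 'a hset \<Rightarrow> 'a hset"
  assumes f: "\<And>a b c d. a \<in> A \<Longrightarrow> b \<in> B \<Longrightarrow> c \<in> A \<Longrightarrow> d \<in> B \<Longrightarrow> elts a \<subseteq> elts c \<Longrightarrow> elts b \<subseteq> elts d \<Longrightarrow>
      elts (f c d) \<subseteq> elts (f a b)"
    and A: "\<And>a. a \<in> A \<Longrightarrow> Ord a" and B: "\<And>b. b \<in> B \<Longrightarrow> Ord b"
    and F: "\<And>a b. a \<in> A \<Longrightarrow> b \<in> B \<Longrightarrow> Ord (f a b)"
  shows "finite {f a b | a b. a \<in> A \<and> b \<in> B}" (is "finite ?R")
proof (rule ccontr)
  assume "infinite ?R"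
  then obtain v :: "nat \<Rightarrow> 'a hset" where v: "inj v" "range v \<subseteq> ?R"
    using infinite_countable_subset by blast
  then have "\<forall>n. \<exists>a b. v n = f a b \<and> a \<in> A \<and> b \<in> B" by blast
  then obtain a b where ab: "\<And>n. v n = f (a n) (b n)" "\<And>n. a n \<in> A" "\<And>n. b n \<in> B" by metis
  have O: "\<And>n. Ord (v n)" "\<And>n. Ord (a n)" "\<And>n. Ord (b n)" using ab A B F by auto
  obtain r :: "nat \<Rightarrow> nat" where r: "strict_mono r" "\<forall>m n. m \<le> n \<longrightarrow> elts (v (r m)) \<subseteq> elts (v (r n))"
    using ordinal_mono_subseq [of v, OF O(1)] by (elim exE conjE)
  obtain r' :: "nat \<Rightarrow> nat" where r': "strict_mono r'" "\<forall>m n. m \<le> n \<longrightarrow> elts (a (r (r' m))) \<subseteq> elts (a (r (r' n)))"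
    using ordinal_mono_subseq [of "\<lambda>n. a (r n)", OF O(2)] by (elim exE conjE)
  obtain r'' :: "nat \<Rightarrow> nat" where r'': "strict_mono r''"
      "\<forall>m n. m \<le> n \<longrightarrow> elts (b (r (r' (r'' m)))) \<subseteq> elts (b (r (r' (r'' n))))"
    using ordinal_mono_subseq [of "\<lambda>n. b (r (r' n))", OF O(3)] by (elim exE conjE)
  let ?k = "\<lambda>n. r (r' (r'' n))"
  have lt: "?k 0 < ?k 1" "r'' 0 \<le> r'' 1" "r' (r'' 0) \<le> r' (r'' 1)"
    using r(1) r'(1) r''(1) by (simp_all add: strict_mono_less strict_mono_less_eq)
  have "elts (v (?k 1)) \<subseteq> elts (v (?k 0))"
    unfolding ab(1) using r'(2) lt(2) r''(2) by (intro f ab) auto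
  moreover have "elts (v (?k 0)) \<subseteq> elts (v (?k 1))" using r(2) lt(3) by blast
  ultimately have "v (?k 0) = v (?k 1)" by (intro hset_eqI) blast
  then show False using v(1) lt by (auto dest: injD)
qed

section \<open>Formulas\<close>

text \<open>Bound variables are included and \<open>ren\<close> renames them as well, so that
  injectivity on \<open>vars \<phi>\<close> rules out capture.\<close>

fun vars :: "fm \<Rightarrow> nat set" where
  "vars (Mem i j) = {i, j}"
| "vars (Eq i j) = {i, j}"
| "vars (Neg \<phi>) = vars \<phi>"
| "vars (And \<phi> \<psi>) = vars \<phi> \<union> vars \<psi>"
| "vars (Ex i \<phi>) = insert i (vars \<phi>)"

fun ren :: "(nat \<Rightarrow> nat) \<Rightarrow> fm \<Rightarrow> fm" where
  "ren f (Mem i j) = Mem (f i) (f j)"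
| "ren f (Eq i j) = Eq (f i) (f j)"
| "ren f (Neg \<phi>) = Neg (ren f \<phi>)"
| "ren f (And \<phi> \<psi>) = And (ren f \<phi>) (ren f \<psi>)"
| "ren f (Ex i \<phi>) = Ex (f i) (ren f \<phi>)"

lemma finite_vars: "finite (vars \<phi>)"
  by (induction \<phi>) auto

lemma fv_vars: "fv \<phi> \<subseteq> vars \<phi>"
  by (induction \<phi>) auto

lemma finite_fv: "finite (fv \<phi>)"
  using finite_subset [OF fv_vars finite_vars] .

lemma sat_cong: "(\<And>i. i \<in> fv \<phi> \<Longrightarrow> e i = e' i) \<Longrightarrow> sat X \<phi> e = sat X \<phi> e'"
proof (induction \<phi> arbitrary: e e')
  case (Ex i \<phi>)
  have "sat X \<phi> (e(i := x)) = sat X \<phi> (e'(i := x))" for x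
    by (rule Ex.IH) (use Ex.prems in auto)
  then show ?case by simp
next
  case (And \<phi> \<psi>)
  then show ?case by (metis UnI1 UnI2 fv.simps(4) sat.simps(4))
next
  case (Neg \<phi>)
  then show ?case by (metis fv.simps(3) sat.simps(3))
qed auto

lemma sat_ren: "inj_on f (vars \<phi>) \<Longrightarrow> sat X (ren f \<phi>) e = sat X \<phi> (e \<circ> f)"
proof (induction \<phi> arbitrary: e)
  case (Ex i \<phi>)
  have "sat X (ren f \<phi>) (e(f i := x)) = sat X \<phi> ((e \<circ> f)(i := x))" for x
  proof -
    have "sat X (ren f \<phi>) (e(f i := x)) = sat X \<phi> (e(f i := x) \<circ> f)"
      by (rule Ex.IH) (use Ex.prems in auto)
    also have "\<dots> = sat X \<phi> ((e \<circ> f)(i := x))"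
      by (rule sat_cong) (use Ex.prems fv_vars in \<open>auto simp: inj_on_def\<close>)
    finally show ?thesis .
  qed
  then show ?case by (simp add: o_def)
next
  case (And \<phi> \<psi>)
  have "inj_on f (vars \<phi>)" "inj_on f (vars \<psi>)" using And.prems by (auto simp: inj_on_def)
  then show ?case using And.IH by simp
qed auto

lemma Delta0_ren: "Delta0 \<phi> \<Longrightarrow> inj_on f (vars \<phi>) \<Longrightarrow> Delta0 (ren f \<phi>)"
proof (induction rule: Delta0.induct)
  case (5 \<phi> i j)
  have "inj_on f (vars \<phi>)" "f i \<noteq> f j" using 5 by (auto simp: inj_on_def)
  then show ?case using 5 by (auto intro: Delta0.intros)
qed (auto intro: Delta0.intros simp: inj_on_Un)

text \<open>A bounded quantifier only reaches elements of a member of \<open>X\<close>, and these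
  are in \<open>X\<close> by transitivity. Separation uses this to pass from
  \<open>L \<alpha>\<close> to a single level.\<close>

lemma sat_Delta0_absolute:
  assumes "Delta0 \<phi>" "X \<subseteq> Y" "\<And>x. x \<in> X \<Longrightarrow> elts x \<subseteq> X" "\<forall>i\<in>fv \<phi>. e i \<in> X"
  shows "sat X \<phi> e = sat Y \<phi> e"
  using assms(1,4)
proof (induction arbitrary: e rule: Delta0.induct)
  case (5 \<phi> i j)
  have "sat X \<phi> (e(i := x)) = sat Y \<phi> (e(i := x))" if "x \<in> elts (e j)" for x
    by (rule 5(3)) (use 5 assms(3) that in auto)
  moreover have "elts (e j) \<subseteq> X" using 5 assms(3) by auto
  ultimately show ?case using 5(2) assms(2) by auto
qed auto

section \<open>Definability by predicates on environments\<close>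

definition envs :: "'a hset set \<Rightarrow> (nat \<Rightarrow> 'a hset) set" where
  "envs X = {e. \<forall>n. e n \<in> X}"

lemma envsD: "e \<in> envs X \<Longrightarrow> e n \<in> X"
  by (simp add: envs_def)

lemma envs_cons [simp]: "x \<in> X \<Longrightarrow> e \<in> envs X \<Longrightarrow> case_nat x e \<in> envs X"
  by (simp add: envs_def split: nat.split)

lemma envs_comp [simp]: "e \<in> envs X \<Longrightarrow> (\<lambda>n. e (f n)) \<in> envs X"
  by (simp add: envs_def)

definition lay :: "nat \<Rightarrow> (nat \<Rightarrow> 'b) \<Rightarrow> (nat \<Rightarrow> 'b) \<Rightarrow> nat \<Rightarrow> 'b" where
  "lay k p e n = (if n < k then p n else e (n - k))"

text \<open>
  A predicate on environments is in \<open>Dfn \<Gamma> X\<close> if some formula in \<open>\<Gamma>\<close> defines it over \<open>X\<close>, where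
  the first few variables are reserved for parameters. Quantifiers are handled by de Bruijn
  shifting of the environment, so that definability of a concrete predicate follows by applying
  introduction rules.
\<close>

definition Dfn :: "(fm \<Rightarrow> bool) \<Rightarrow> 'a hset set \<Rightarrow> ((nat \<Rightarrow> 'a hset) \<Rightarrow> bool) \<Rightarrow> bool" where
  "Dfn \<Gamma> X P \<longleftrightarrow> (\<exists>\<phi> k p. \<Gamma> \<phi> \<and> p \<in> envs X \<and> (\<forall>e\<in>envs X. P e = sat X \<phi> (lay k p e)))"

text \<open>The two classes that are closed under negation, for which all connectives and bounded
  quantifiers are available. Sigma_1 predicates have rules of their own under the names
  \<open>Sig\<close> and \<open>USig\<close>.\<close>

definition dc :: "(fm \<Rightarrow> bool) \<Rightarrow> bool" where
  "dc \<Gamma> \<longleftrightarrow> \<Gamma> = Delta0 \<or> \<Gamma> = (\<lambda>_. True)"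

lemma dc_simps [simp, intro]: "dc Delta0" "dc (\<lambda>_. True)"
  by (auto simp: dc_def)

lemma dcD:
  assumes "dc \<Gamma>"
  shows "\<Gamma> (Mem i j)" "\<Gamma> (Eq i j)" "\<Gamma> \<phi> \<Longrightarrow> \<Gamma> (Neg \<phi>)" "\<Gamma> \<phi> \<Longrightarrow> \<Gamma> \<psi> \<Longrightarrow> \<Gamma> (And \<phi> \<psi>)"
    "\<Gamma> \<phi> \<Longrightarrow> i \<noteq> j \<Longrightarrow> \<Gamma> (Ex i (And (Mem i j) \<phi>))" "\<Gamma> \<phi> \<Longrightarrow> inj f \<Longrightarrow> \<Gamma> (ren f \<phi>)"
  using assms by (auto simp: dc_def intro: Delta0.intros Delta0_ren inj_on_subset)

lemma DfnE:
  assumes "Dfn \<Gamma> X P"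
  obtains \<phi> k p where "\<Gamma> \<phi>" "p \<in> envs X" "\<And>e. e \<in> envs X \<Longrightarrow> P e = sat X \<phi> (lay k p e)"
  using assms unfolding Dfn_def by blast

lemma Del_imp_Fm: "Dfn Delta0 X P \<Longrightarrow> Dfn (\<lambda>_. True) X P"
  unfolding Dfn_def by blast

lemma Dfn_cong:
  assumes "Dfn \<Gamma> X P" "\<And>e. e \<in> envs X \<Longrightarrow> P e = Q e"
  shows "Dfn \<Gamma> X Q"
  using assms unfolding Dfn_def by auto

lemma Dfn_mem: "dc \<Gamma> \<Longrightarrow> e\<^sub>0 \<in> envs X \<Longrightarrow> Dfn \<Gamma> X (\<lambda>e. e i \<in> elts (e j))"
  unfolding Dfn_def
  by (rule exI [of _ "Mem i j"], rule exI [of _ 0], rule exI [of _ e\<^sub>0]) (simp add: dcD lay_def)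

lemma Dfn_eq: "dc \<Gamma> \<Longrightarrow> e\<^sub>0 \<in> envs X \<Longrightarrow> Dfn \<Gamma> X (\<lambda>e. e i = e j)"
  unfolding Dfn_def
  by (rule exI [of _ "Eq i j"], rule exI [of _ 0], rule exI [of _ e\<^sub>0]) (simp add: dcD lay_def)

lemma Dfn_neg:
  assumes "dc \<Gamma>" "Dfn \<Gamma> X P" shows "Dfn \<Gamma> X (\<lambda>e. \<not> P e)"
  using assms(2)
proof (rule DfnE)
  fix \<phi> k p assume "\<Gamma> \<phi>" "p \<in> envs X" "\<And>e. e \<in> envs X \<Longrightarrow> P e = sat X \<phi> (lay k p e)"
  then show ?thesis
    unfolding Dfn_def
    by (intro exI [of _ "Neg \<phi>"] exI [of _ k] exI [of _ p]) (simp add: dcD [OF assms(1)])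
qed

lemma Dfn_and:
  assumes "dc \<Gamma>" "Dfn \<Gamma> X P" "Dfn \<Gamma> X Q" shows "Dfn \<Gamma> X (\<lambda>e. P e \<and> Q e)"
  using assms(2)
proof (rule DfnE)
  fix \<phi> k p assume \<phi>: "\<Gamma> \<phi>" "p \<in> envs X" "\<And>e. e \<in> envs X \<Longrightarrow> P e = sat X \<phi> (lay k p e)"
  show ?thesis using assms(3)
  proof (rule DfnE)
    fix \<psi> l q assume \<psi>: "\<Gamma> \<psi>" "q \<in> envs X" "\<And>e. e \<in> envs X \<Longrightarrow> Q e = sat X \<psi> (lay l q e)"
    \<comment> \<open>Both blocks of parameters are placed in front of the common environment:
      \<open>f\<close> keeps the \<open>k\<close> parameters of \<phi> and jumps over the
      \<open>l\<close> parameters of \<psi>, and \<open>g\<close> moves \<psi> behind the first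
      block.\<close>
    define f where "f n = (if n < k then n else n + l)" for n
    define g where "g n = n + k" for n
    have inj: "inj f" "inj g" by (auto simp: inj_def f_def g_def)
    have f: "lay (k + l) (lay k p q) e \<circ> f = lay k p e" for e
      by (auto simp: lay_def f_def fun_eq_iff)
    have g: "lay (k + l) (lay k p q) e \<circ> g = lay l q e" for e
      by (auto simp: lay_def g_def fun_eq_iff)
    show ?thesis
      unfolding Dfn_def
    proof (intro exI conjI ballI)
      show "\<Gamma> (And (ren f \<phi>) (ren g \<psi>))" using \<phi> \<psi> inj dcD [OF assms(1)] by simp
      show "lay k p q \<in> envs X" using \<phi> \<psi> by (simp add: envs_def lay_def)
      show "(P e \<and> Q e) = sat X (And (ren f \<phi>) (ren g \<psi>)) (lay (k + l) (lay k p q) e)"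
        if "e \<in> envs X" for e
        using \<phi>(3) \<psi>(3) that by (simp add: sat_ren inj_on_subset [OF inj(1)] inj_on_subset [OF inj(2)] f g)
    qed
  qed
qed

lemma Dfn_or:
  assumes "dc \<Gamma>" "Dfn \<Gamma> X P" "Dfn \<Gamma> X Q" shows "Dfn \<Gamma> X (\<lambda>e. P e \<or> Q e)"
proof -
  have "Dfn \<Gamma> X (\<lambda>e. \<not> (\<not> P e \<and> \<not> Q e))" by (intro Dfn_neg Dfn_and assms)
  then show ?thesis by (rule Dfn_cong) blast
qed

lemma Dfn_imp:
  assumes "dc \<Gamma>" "Dfn \<Gamma> X P" "Dfn \<Gamma> X Q" shows "Dfn \<Gamma> X (\<lambda>e. P e \<longrightarrow> Q e)"
proof -
  have "Dfn \<Gamma> X (\<lambda>e. \<not> P e \<or> Q e)" by (intro Dfn_neg Dfn_or assms)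
  then show ?thesis by (rule Dfn_cong) blast
qed

lemma Dfn_iff:
  assumes "dc \<Gamma>" "Dfn \<Gamma> X P" "Dfn \<Gamma> X Q" shows "Dfn \<Gamma> X (\<lambda>e. P e \<longleftrightarrow> Q e)"
proof -
  have "Dfn \<Gamma> X (\<lambda>e. (P e \<longrightarrow> Q e) \<and> (Q e \<longrightarrow> P e))" by (intro Dfn_imp Dfn_and assms)
  then show ?thesis by (rule Dfn_cong) blast
qed

lemma Dfn_ren:
  assumes "dc \<Gamma>" "Dfn \<Gamma> X P" "inj f" shows "Dfn \<Gamma> X (\<lambda>e. P (\<lambda>n. e (f n)))"
  using assms(2)
proof (rule DfnE)
  fix \<phi> k p assume \<phi>: "\<Gamma> \<phi>" "p \<in> envs X" "\<And>e. e \<in> envs X \<Longrightarrow> P e = sat X \<phi> (lay k p e)"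
  define g where "g n = (if n < k then n else k + f (n - k))" for n
  have inj: "inj g"
  proof (rule injI)
    fix m n assume "g m = g n"
    then consider "m = n" | "m \<ge> k" "n \<ge> k" "f (m - k) = f (n - k)"
      by (auto simp: g_def split: if_splits)
    then show "m = n" by cases (auto dest: injD [OF assms(3)])
  qed
  have g: "lay k p e \<circ> g = lay k p (\<lambda>n. e (f n))" for e
    by (auto simp: lay_def g_def fun_eq_iff)
  show ?thesis
    unfolding Dfn_def
  proof (intro exI conjI ballI)
    show "\<Gamma> (ren g \<phi>)" using \<phi> inj dcD [OF assms(1)] by simp
    show "p \<in> envs X" by fact
    show "P (\<lambda>n. e (f n)) = sat X (ren g \<phi>) (lay k p e)" if "e \<in> envs X" for e
      using \<phi>(3) that by (simp add: sat_ren inj_on_subset [OF inj] g)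
  qed
qed

lemma lay_Suc: "lay (Suc k) (p(k := c)) e = lay k p (case_nat c e)"
proof
  fix n
  consider "n < k" | "n = k" | m where "n = k + Suc m" by (metis less_iff_Suc_add linorder_cases add_Suc_right)
  then show "lay (Suc k) (p(k := c)) e n = lay k p (case_nat c e) n"
    by cases (auto simp: lay_def)
qed

lemma lay_upd: "(lay (Suc k) p e)(k := x) = lay k p (case_nat x e)"
proof
  fix n
  consider "n < k" | "n = k" | m where "n = k + Suc m" by (metis less_iff_Suc_add linorder_cases add_Suc_right)
  then show "((lay (Suc k) p e)(k := x)) n = lay k p (case_nat x e) n"
    by cases (auto simp: lay_def)
qed

lemma Dfn_const:
  assumes "Dfn \<Gamma> X (\<lambda>e. P (e 0) (\<lambda>n. e (Suc n)))" "c \<in> X"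
  shows "Dfn \<Gamma> X (P c)"
  using assms(1)
proof (rule DfnE)
  fix \<phi> k p assume \<phi>: "\<Gamma> \<phi>" "p \<in> envs X"
    "\<And>e. e \<in> envs X \<Longrightarrow> P (e 0) (\<lambda>n. e (Suc n)) = sat X \<phi> (lay k p e)"
  show ?thesis
    unfolding Dfn_def
  proof (intro exI conjI ballI)
    show "\<Gamma> \<phi>" by fact
    show "p(k := c) \<in> envs X" using \<phi>(2) assms(2) by (simp add: envs_def)
    show "P c e = sat X \<phi> (lay (Suc k) (p(k := c)) e)" if "e \<in> envs X" for e
      using \<phi>(3) [of "case_nat c e"] that assms(2) by (simp add: lay_Suc)
  qed
qed

text \<open>Slot \<open>k\<close>, just behind the parameters, becomes the bound variable, and the
  environment moves up by one. The value of \<open>p\<close> at \<open>k\<close> is overwritten by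
  the quantifier.\<close>

lemma Fm_ex:
  assumes "Dfn (\<lambda>_. True) X (\<lambda>e. P (e 0) (\<lambda>n. e (Suc n)))"
  shows "Dfn (\<lambda>_. True) X (\<lambda>e. \<exists>x\<in>X. P x e)"
  using assms(1)
proof (rule DfnE)
  fix \<phi> k p assume \<phi>: "p \<in> envs X"
    "\<And>e. e \<in> envs X \<Longrightarrow> P (e 0) (\<lambda>n. e (Suc n)) = sat X \<phi> (lay k p e)"
  show ?thesis
    unfolding Dfn_def
  proof (intro exI conjI ballI)
    show "p \<in> envs X" by fact
    show "(\<exists>x\<in>X. P x e) = sat X (Ex k \<phi>) (lay (Suc k) p e)" if "e \<in> envs X" for e
      using \<phi>(2) [of "case_nat _ e"] that by (simp add: lay_upd del: fun_upd_apply)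
  qed auto
qed

lemma Dfn_bex:
  assumes "dc \<Gamma>" "\<And>x. x \<in> X \<Longrightarrow> elts x \<subseteq> X" "Dfn \<Gamma> X (\<lambda>e. P (e 0) (\<lambda>n. e (Suc n)))"
  shows "Dfn \<Gamma> X (\<lambda>e. \<exists>x\<in>elts (e i). P x e)"
  using assms(3)
proof (rule DfnE)
  fix \<phi> k p assume \<phi>: "\<Gamma> \<phi>" "p \<in> envs X"
    "\<And>e. e \<in> envs X \<Longrightarrow> P (e 0) (\<lambda>n. e (Suc n)) = sat X \<phi> (lay k p e)"
  show ?thesis
    unfolding Dfn_def
  proof (intro exI conjI ballI)
    show "\<Gamma> (Ex k (And (Mem k (Suc k + i)) \<phi>))" using \<phi> by (intro dcD(5) [OF assms(1)]) auto
    show "p \<in> envs X" by fact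
    show "(\<exists>x\<in>elts (e i). P x e) = sat X (Ex k (And (Mem k (Suc k + i)) \<phi>)) (lay (Suc k) p e)"
      if "e \<in> envs X" for e
    proof -
      have "x \<in> X" if "x \<in> elts (e i)" for x
        using assms(2) [OF envsD [OF \<open>e \<in> envs X\<close>]] that by blast
      moreover have "lay k p (case_nat x e) (Suc (k + i)) = e i" "lay k p (case_nat x e) k = x" for x
        by (simp_all add: lay_def Suc_diff_le)
      ultimately show ?thesis
        using \<phi>(3) [of "case_nat _ e"] that by (auto simp: lay_upd simp del: fun_upd_apply)
    qed
  qed
qed

definition rc :: "(fm \<Rightarrow> bool) \<Rightarrow> bool" where
  "rc \<Gamma> \<longleftrightarrow> (\<forall>\<phi> f. \<Gamma> \<phi> \<longrightarrow> inj f \<longrightarrow> \<Gamma> (ren f \<phi>))"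

lemma rc_dc: "dc \<Gamma> \<Longrightarrow> rc \<Gamma>"
  by (simp add: rc_def dcD)

lemma Sigma1_ren: "Sigma1 \<phi> \<Longrightarrow> inj f \<Longrightarrow> Sigma1 (ren f \<phi>)"
  by (induction rule: Sigma1.induct) (auto intro: Sigma1.intros Delta0_ren inj_on_subset)

lemma rc_Sigma1: "rc Sigma1"
  by (simp add: rc_def Sigma1_ren)

text \<open>\<open>definable\<close> expects its argument in variable 0, whereas \<open>Dfn\<close>
  puts it behind the \<open>k\<close> parameters. The renaming rotates the first
  \<open>k + 1\<close> variables.\<close>

lemma Dfn_definable:
  assumes "rc \<Gamma>" "Dfn \<Gamma> X P" "e \<in> envs X"
  obtains \<phi> e' where "\<Gamma> \<phi>" "e' \<in> envs X" "\<And>x. x \<in> X \<Longrightarrow> P (case_nat x e) = sat X \<phi> (e'(0 := x))"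
  using assms(2)
proof (rule DfnE)
  fix \<phi> k p assume \<phi>: "\<Gamma> \<phi>" "p \<in> envs X" "\<And>e. e \<in> envs X \<Longrightarrow> P e = sat X \<phi> (lay k p e)"
  define f where "f n = (if n < k then n + 1 else if n = k then 0 else n)" for n
  define e' where "e' n = (if n = 0 then e 0 else if n \<le> k then p (n - 1) else e (n - k - 1))" for n
  have inj: "inj f" by (auto simp: inj_def f_def)
  have "(e'(0 := x)) (f n) = lay k p (case_nat x e) n" for x n
  proof -
    consider "n < k" | "n = k" | m where "n = k + Suc m" by (metis less_iff_Suc_add linorder_cases add_Suc_right)
    then show ?thesis by cases (auto simp: lay_def f_def e'_def)
  qed
  then have f: "e'(0 := x) \<circ> f = lay k p (case_nat x e)" for x by (simp add: fun_eq_iff)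
  show ?thesis
  proof (rule that)
    show "\<Gamma> (ren f \<phi>)" using \<phi> inj assms(1) by (simp add: rc_def)
    show "e' \<in> envs X" using \<phi> assms(3) by (simp add: envs_def e'_def)
    show "P (case_nat x e) = sat X (ren f \<phi>) (e'(0 := x))" if "x \<in> X" for x
      using \<phi>(3) [of "case_nat x e"] that assms(3)
      by (simp add: sat_ren inj_on_subset [OF inj] f del: fun_upd_apply)
  qed
qed

lemma Dfn_definable2:
  assumes "rc \<Gamma>" "Dfn \<Gamma> X P" "e \<in> envs X"
  obtains \<phi> e' where "\<Gamma> \<phi>" "e' \<in> envs X"
    "\<And>x y. x \<in> X \<Longrightarrow> y \<in> X \<Longrightarrow> P (case_nat x (case_nat y e)) = sat X \<phi> (e'(0 := x, 1 := y))"
  using assms(2)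
proof (rule DfnE)
  fix \<phi> k p assume \<phi>: "\<Gamma> \<phi>" "p \<in> envs X" "\<And>e. e \<in> envs X \<Longrightarrow> P e = sat X \<phi> (lay k p e)"
  define f where "f n = (if n < k then n + 2 else if n = k then 0 else if n = Suc k then 1 else n)" for n
  define e' where "e' n = (if n < 2 then e 0 else if n < k + 2 then p (n - 2) else e (n - k - 2))" for n
  have inj: "inj f" by (auto simp: inj_def f_def)
  have "(e'(0 := x, 1 := y)) (f n) = lay k p (case_nat x (case_nat y e)) n" for x y n
  proof -
    have "\<exists>m. n = k + Suc (Suc m)" if "n > Suc k" using that by presburger
    then consider "n < k" | "n = k" | "n = Suc k" | m where "n = k + Suc (Suc m)"
      by (metis linorder_neqE_nat not_less_less_Suc_eq)
    then show ?thesis by cases (auto simp: lay_def f_def e'_def)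
  qed
  then have f: "e'(0 := x, 1 := y) \<circ> f = lay k p (case_nat x (case_nat y e))" for x y
    by (simp add: fun_eq_iff)
  show ?thesis
  proof (rule that)
    show "\<Gamma> (ren f \<phi>)" using \<phi> inj assms(1) by (simp add: rc_def)
    show "e' \<in> envs X" using \<phi> assms(3) by (simp add: envs_def e'_def)
    show "P (case_nat x (case_nat y e)) = sat X (ren f \<phi>) (e'(0 := x, 1 := y))"
      if "x \<in> X" "y \<in> X" for x y
      using \<phi>(3) [of "case_nat x (case_nat y e)"] that assms(3)
      by (simp add: sat_ren inj_on_subset [OF inj] f [unfolded One_nat_def] del: fun_upd_apply)
  qed
qed

text \<open>Admits a formula with a variable numbering of its own: \<open>s\<close> selects the
  variables that serve as arguments, all others are frozen at \<open>p\<close>. Distinct variables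
  must select distinct arguments because only injective renamings are sound.\<close>

lemma Dfn_formula:
  assumes "Delta0 \<phi>" "p \<in> envs X" "\<And>m n i. s m = Some i \<Longrightarrow> s n = Some i \<Longrightarrow> m = n"
  shows "Dfn Delta0 X (\<lambda>e. sat X \<phi> (\<lambda>n. case s n of None \<Rightarrow> p n | Some i \<Rightarrow> e i))"
proof -
  obtain k where k: "\<And>n. n \<in> vars \<phi> \<Longrightarrow> n < k"
    using finite_vars [of \<phi>] by (meson finite_nat_bounded lessThan_iff subset_iff)
  define f where "f n = (case s n of None \<Rightarrow> n | Some i \<Rightarrow> k + i)" for n
  have inj: "inj_on f (vars \<phi>)"
  proof (rule inj_onI)
    fix m n assume mn: "m \<in> vars \<phi>" "n \<in> vars \<phi>" "f m = f n"
    then show "m = n"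
      using k [OF mn(1)] k [OF mn(2)] assms(3) by (auto simp: f_def split: option.splits)
  qed
  have "sat X \<phi> (lay k p e \<circ> f) = sat X \<phi> (\<lambda>n. case s n of None \<Rightarrow> p n | Some i \<Rightarrow> e i)" for e
  proof (rule sat_cong)
    fix n assume "n \<in> fv \<phi>"
    then have "n < k" using k fv_vars by blast
    then show "(lay k p e \<circ> f) n = (case s n of None \<Rightarrow> p n | Some i \<Rightarrow> e i)"
      by (simp add: f_def lay_def split: option.split)
  qed
  then show ?thesis
    unfolding Dfn_def using assms(1,2) inj Delta0_ren [OF assms(1) inj] by (metis sat_ren)
qed

locale tm =
  fixes X :: "'a hset set"
  assumes trs: "x \<in> X \<Longrightarrow> elts x \<subseteq> X" and ne: "X \<noteq> {}"
begin

lemma trsD: "x \<in> X \<Longrightarrow> y \<in> elts x \<Longrightarrow> y \<in> X"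
  using trs by blast

lemma ex_env: "\<exists>e. e \<in> envs X"
  using ne by (auto simp: envs_def)

lemma D_mem: "dc \<Gamma> \<Longrightarrow> Dfn \<Gamma> X (\<lambda>e. e i \<in> elts (e j))"
  using ex_env Dfn_mem by blast

lemma D_eq: "dc \<Gamma> \<Longrightarrow> Dfn \<Gamma> X (\<lambda>e. e i = e j)"
  using ex_env Dfn_eq by blast

lemma D_bex:
  "dc \<Gamma> \<Longrightarrow> Dfn \<Gamma> X (\<lambda>e. P (e 0) (\<lambda>n. e (Suc n))) \<Longrightarrow> Dfn \<Gamma> X (\<lambda>e. \<exists>x\<in>elts (e i). P x e)"
  by (rule Dfn_bex) (use trs in auto)

lemma D_ball:
  assumes "dc \<Gamma>" "Dfn \<Gamma> X (\<lambda>e. P (e 0) (\<lambda>n. e (Suc n)))"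
  shows "Dfn \<Gamma> X (\<lambda>e. \<forall>x\<in>elts (e i). P x e)"
proof -
  have "Dfn \<Gamma> X (\<lambda>e. \<not> (\<exists>x\<in>elts (e i). \<not> P x e))" by (intro Dfn_neg D_bex assms)
  then show ?thesis by (rule Dfn_cong) blast
qed

lemmas D_intros = dc_simps D_mem D_eq Dfn_neg Dfn_and Dfn_or Dfn_imp Dfn_iff D_bex D_ball

lemma D_subset: "dc \<Gamma> \<Longrightarrow> Dfn \<Gamma> X (\<lambda>e. elts (e i) \<subseteq> elts (e j))"
  unfolding subset_eq by (intro D_intros)

lemma D_Ord: "dc \<Gamma> \<Longrightarrow> Dfn \<Gamma> X (\<lambda>e. Ord (e i))"
  unfolding Ord_def Transset_def by (intro D_intros D_subset)

end

section \<open>The constructible hierarchy\<close>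

lemma L_mono: "elts \<beta> \<subseteq> elts \<gamma> \<Longrightarrow> L \<beta> \<subseteq> L \<gamma>"
  by (subst (1 2) L.simps) blast

lemma L_memE:
  assumes "x \<in> L \<gamma>"
  obtains \<beta> where "\<beta> \<in> elts \<gamma>" "definable (\<lambda>_. True) (L \<beta>) (elts x)"
  using assms by (subst (asm) L.simps) blast

lemma L_memI: "\<beta> \<in> elts \<gamma> \<Longrightarrow> definable (\<lambda>_. True) (L \<beta>) (elts x) \<Longrightarrow> x \<in> L \<gamma>"
  by (subst L.simps) blast

lemma definable_subset: "definable \<Gamma> X S \<Longrightarrow> S \<subseteq> X"
  by (auto simp: definable_def)

lemma L_trans: "Ord \<gamma> \<Longrightarrow> x \<in> L \<gamma> \<Longrightarrow> elts x \<subseteq> L \<gamma>"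
  by (metis L_memE L_mono Ord_elts_subset definable_subset subset_trans)

text \<open>An ordinal defined over \<open>L \<beta>\<close> consists of ordinals in
  \<open>L \<beta>\<close>, which inductively are below \<beta>, so it is at most \<beta>. Together
  with \<open>Ord_mem_L\<close>, the ordinals in \<open>L \<gamma>\<close> are exactly those below
  \<gamma>.\<close>

lemma L_Ord_imp: "Ord \<gamma> \<Longrightarrow> Ord x \<Longrightarrow> x \<in> L \<gamma> \<Longrightarrow> x \<in> elts \<gamma>"
proof (induction \<gamma> arbitrary: x rule: hset_induct)
  case (1 \<gamma>)
  obtain \<beta> where \<beta>: "\<beta> \<in> elts \<gamma>" "definable (\<lambda>_. True) (L \<beta>) (elts x)"
    using L_memE [OF 1(4)] by blast
  have "Ord \<beta>" using 1 \<beta> Ord_mem by blast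
  have "elts x \<subseteq> elts \<beta>"
    using 1(1) [OF \<beta>(1) \<open>Ord \<beta>\<close>] definable_subset [OF \<beta>(2)] Ord_mem [OF 1(3)] by blast
  then have "x \<in> elts \<beta> \<or> x = \<beta>" using Ord_subset_iff [OF 1(3) \<open>Ord \<beta>\<close>] by blast
  then show ?case using \<beta>(1) Ord_trans [OF 1(2)] by blast
qed

lemma Dfn_definableI:
  assumes "rc \<Gamma>" "Dfn \<Gamma> X P" "e \<in> envs X"
  shows "definable \<Gamma> X {x \<in> X. P (case_nat x e)}"
  using assms
proof (rule Dfn_definable)
  fix \<phi> e' assume "\<Gamma> \<phi>" "e' \<in> envs X" "\<And>x. x \<in> X \<Longrightarrow> P (case_nat x e) = sat X \<phi> (e'(0 := x))"
  then show ?thesis unfolding definable_def by (intro exI [of _ \<phi>] exI [of _ e']) (auto intro: envsD)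
qed

lemma Ord_definable_L:
  assumes "Ord \<beta>" "elts \<beta> \<subseteq> L \<beta>"
  shows "definable (\<lambda>_. True) (L \<beta>) (elts \<beta>)"
\<comment> \<open>An empty level admits no environments, and the locale \<open>tm\<close> that
  supplies the definability rules requires an element.\<close>
proof (cases "L \<beta> = {}")
  case True
  then show ?thesis using assms(2) by (auto simp: definable_def intro!: exI [of _ "Eq 0 0"])
next
  case False
  interpret tm "L \<beta>" by unfold_locales (use L_trans assms False in auto)
  obtain e where e: "e \<in> envs (L \<beta>)" using ex_env by blast
  have "definable (\<lambda>_. True) (L \<beta>) {x \<in> L \<beta>. Ord (case_nat x e 0)}"
    by (rule Dfn_definableI [OF rc_dc D_Ord e]) auto
  moreover have "{x \<in> L \<beta>. Ord (case_nat x e 0)} = elts \<beta>"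
    using assms L_Ord_imp Ord_mem by auto
  ultimately show ?thesis by simp
qed

lemma Ord_mem_L: "Ord \<gamma> \<Longrightarrow> \<beta> \<in> elts \<gamma> \<Longrightarrow> \<beta> \<in> L \<gamma>"
proof (induction \<beta> arbitrary: \<gamma> rule: hset_induct)
  case (1 \<beta>)
  have "Ord \<beta>" using 1 Ord_mem by blast
  then have "elts \<beta> \<subseteq> L \<beta>" using 1(1) by blast
  then show ?case using L_memI [OF 1(3)] Ord_definable_L \<open>Ord \<beta>\<close> by blast
qed

section \<open>Set operations inside \<open>L \<alpha>\<close>\<close>

definition zer :: "'a hset" where "zer = mk {}"
definition up :: "'a hset \<Rightarrow> 'a hset \<Rightarrow> 'a hset" where "up a b = mk {a, b}"
definition pair :: "'a hset \<Rightarrow> 'a hset \<Rightarrow> 'a hset" where "pair a b = up (up a a) (up a b)"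
definition hinsert :: "'a hset \<Rightarrow> 'a hset \<Rightarrow> 'a hset" where "hinsert a x = mk (insert a (elts x))"
definition hUnion :: "'a hset \<Rightarrow> 'a hset" where "hUnion x = mk (\<Union> (elts ` elts x))"

primrec ordn :: "nat \<Rightarrow> 'a hset" where
  "ordn 0 = zer"
| "ordn (Suc n) = hinsert (ordn n) (ordn n)"

definition omega :: "'a hset" where "omega = mk (range ordn)"

text \<open>Uncountability is assumed from the start, to be refuted in the end. It makes the type
  \<open>'a\<close> infinite, so that all countable sets are small, it puts \<open>omega\<close>
  below \<alpha>, and it keeps countable collapses below \<alpha>.\<close>

locale adm =
  fixes \<alpha> :: "'a hset"
  assumes adm: "Sigma1_admissible \<alpha>" and unc: "uncountable (elts \<alpha>)"
begin

abbreviation X :: "'a hset set" where "X \<equiv> L \<alpha>"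

lemma Ord_alpha: "Ord \<alpha>"
  using adm unfolding Sigma1_admissible_def Limit_def by blast

lemma Lim: "\<beta> \<in> elts \<alpha> \<Longrightarrow> \<exists>\<gamma>\<in>elts \<alpha>. \<beta> \<in> elts \<gamma>"
  using adm unfolding Sigma1_admissible_def Limit_def by blast

lemma alpha_ne: "elts \<alpha> \<noteq> {}"
  using unc by auto

lemma Ord_in_alpha: "\<beta> \<in> elts \<alpha> \<Longrightarrow> Ord \<beta>"
  using Ord_alpha Ord_mem by blast

lemma inf: "infinite (UNIV :: 'a set)"
proof
  assume fin: "finite (UNIV :: 'a set)"
  obtain f :: "'a \<Rightarrow> 'a hset" where "elts \<alpha> \<subseteq> range f" using ex_elts_iff [of "elts \<alpha>"] by blast
  then have "finite (elts \<alpha>)" using fin finite_imageI finite_subset by blast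
  then show False using unc countable_finite by blast
qed

lemma small_countable:
  fixes S :: "'a hset set"
  assumes "countable S" shows "small S"
proof (cases "S = {}")
  case False
  obtain g :: "nat \<Rightarrow> 'a" where g: "inj g" using inf infinite_countable_subset by blast
  have "S \<subseteq> range (\<lambda>i. from_nat_into S (inv g i))"
  proof
    fix y assume "y \<in> S"
    then obtain n where "y = from_nat_into S n" using range_from_nat_into [OF False assms] by blast
    then have "y = from_nat_into S (inv g (g n))" using g by simp
    then show "y \<in> range (\<lambda>i. from_nat_into S (inv g i))" by blast
  qed
  then show ?thesis unfolding small_def ex_elts_iff by (rule exI [of _ "\<lambda>i. from_nat_into S (inv g i)"])
qed (auto simp: small_def ex_elts_iff)

lemma small_finite: "finite S \<Longrightarrow> small (S :: 'a hset set)"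
  by (simp add: small_countable countable_finite)

lemma small_UN:
  fixes F :: "'a hset \<Rightarrow> 'a hset set"
  assumes A: "small A" and F: "\<And>x. x \<in> A \<Longrightarrow> small (F x)"
  shows "small (\<Union>x\<in>A. F x)"
proof -
  obtain f :: "'a \<Rightarrow> 'a hset" where f: "A \<subseteq> range f" using A unfolding small_def ex_elts_iff by blast
  have "\<forall>x\<in>A. \<exists>h :: 'a \<Rightarrow> 'a hset. F x \<subseteq> range h" using F unfolding small_def ex_elts_iff by blast
  then obtain h :: "'a hset \<Rightarrow> 'a \<Rightarrow> 'a hset" where h: "\<forall>x\<in>A. F x \<subseteq> range (h x)" by metis
  \<comment> \<open>The union is indexed by pairs of indices, and an infinite type is equinumerous
    with its square.\<close>
  have "(card_of (UNIV :: ('a \<times> 'a) set), card_of (UNIV :: 'a set)) \<in> ordIso"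
    using card_of_Times_same_infinite [OF inf] by simp
  then obtain k :: "'a \<times> 'a \<Rightarrow> 'a" where k: "inj k"
    using card_of_ordIso [of "UNIV :: ('a \<times> 'a) set" "UNIV :: 'a set"] bij_betw_imp_inj_on by blast
  have "(\<Union>x\<in>A. F x) \<subseteq> range (\<lambda>i. h (f (fst (inv k i))) (snd (inv k i)))"
  proof
    fix y assume "y \<in> (\<Union>x\<in>A. F x)"
    then obtain x where x: "x \<in> A" "y \<in> F x" by blast
    obtain a b where "x = f a" "y = h x b" using f h x by blast
    then have "y = h (f (fst (inv k (k (a, b))))) (snd (inv k (k (a, b))))" using k by simp
    then show "y \<in> range (\<lambda>i. h (f (fst (inv k i))) (snd (inv k i)))" by blast
  qed
  then show ?thesis
    unfolding small_def ex_elts_iff by (rule exI [of _ "\<lambda>i. h (f (fst (inv k i))) (snd (inv k i))"])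
qed

lemma elts_zer [simp]: "elts (zer :: 'a hset) = {}"
  unfolding zer_def by (rule elts_mk) (simp add: small_finite)

lemma elts_up [simp]: "elts (up a b :: 'a hset) = {a, b}"
  unfolding up_def by (rule elts_mk) (simp add: small_finite)

lemma small_Un:
  assumes "small S" "small T" shows "small (S \<union> T :: 'a hset set)"
proof -
  have ne: "up zer zer \<noteq> (zer :: 'a hset)" by (metis elts_up elts_zer insert_not_empty)
  have "small (\<Union>x\<in>elts (up zer (up zer zer)). if x = (zer :: 'a hset) then S else T)"
    by (rule small_UN [OF small_elts]) (use assms in auto)
  moreover have "(\<Union>x\<in>elts (up zer (up zer zer)). if x = (zer :: 'a hset) then S else T) = S \<union> T"
    using ne by auto
  ultimately show ?thesis by simp
qed

lemma elts_hinsert [simp]: "elts (hinsert a x :: 'a hset) = insert a (elts x)"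
  unfolding hinsert_def
  by (rule elts_mk) (use small_Un [OF small_finite [of "{a}"] small_elts] in simp)

lemma elts_hUnion [simp]: "elts (hUnion x :: 'a hset) = \<Union> (elts ` elts x)"
  unfolding hUnion_def by (rule elts_mk) (rule small_UN, auto)

lemma up_inject: "up a b = (up c d :: 'a hset) \<longleftrightarrow> (a = c \<and> b = d) \<or> (a = d \<and> b = c)"
  by (metis doubleton_eq_iff elts_inject elts_up)

lemma pair_inject [simp]: "pair a b = (pair c d :: 'a hset) \<longleftrightarrow> a = c \<and> b = d"
  unfolding pair_def up_inject by blast

lemma elts_ordn: "elts (ordn n :: 'a hset) = ordn ` {..<n}"
  by (induction n) (auto simp: lessThan_Suc)

lemma elts_omega: "elts (omega :: 'a hset) = range ordn"
  unfolding omega_def by (rule elts_mk) (simp add: small_countable)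

lemma ordn_inj: "ordn m = (ordn n :: 'a hset) \<longleftrightarrow> m = n"
proof -
  have "ordn m \<noteq> (ordn n :: 'a hset)" if "m < n" for m n
    using that mem_irrefl [of "ordn n :: 'a hset"] by (metis elts_ordn imageI lessThan_iff)
  then show ?thesis by (metis linorder_neqE_nat)
qed

lemma Ord_ordn: "Ord (ordn n :: 'a hset)"
proof (induction n rule: less_induct)
  case (less n)
  show ?case
    by (rule OrdI) (use less in \<open>auto simp: elts_ordn\<close>)
qed

lemma Ord_omega: "Ord (omega :: 'a hset)"
  by (rule OrdI) (auto simp: elts_omega Ord_ordn elts_ordn)

lemma omega_alpha: "omega \<in> elts \<alpha>"
proof -
  have "\<alpha> \<noteq> omega" using unc by (auto simp: elts_omega)
  moreover have "\<alpha> \<notin> elts omega"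
  proof
    assume "\<alpha> \<in> elts omega"
    then obtain n where "\<alpha> = ordn n" by (auto simp: elts_omega)
    then show False using unc by (simp add: elts_ordn countable_finite)
  qed
  ultimately show ?thesis using Ord_linear [OF Ord_alpha Ord_omega] by blast
qed

lemma X_trans: "x \<in> X \<Longrightarrow> elts x \<subseteq> X"
  using L_trans Ord_alpha by blast

lemma Ord_X_iff: "Ord x \<Longrightarrow> x \<in> X \<longleftrightarrow> x \<in> elts \<alpha>"
  using L_Ord_imp Ord_mem_L Ord_alpha by blast

lemma alpha_X: "x \<in> elts \<alpha> \<Longrightarrow> x \<in> X"
  using Ord_mem_L Ord_alpha by blast

lemma omega_X: "omega \<in> X"
  using omega_alpha alpha_X by blast

lemma ordn_X: "ordn n \<in> X"
  using X_trans [OF omega_X] by (auto simp: elts_omega)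

lemma zer_X: "zer \<in> X"
  using ordn_X [of 0] by simp

lemma X_nonempty: "X \<noteq> {}"
  using omega_X by blast

end

sublocale adm \<subseteq> tm X
  by unfold_locales (use X_trans X_nonempty in auto)

context adm
begin

text \<open>The levels form a chain without a last one, so finitely many parameters meet in a single
  level. What is definable over that level is then in \<open>L \<alpha>\<close> by
  \<open>X_definable\<close>.\<close>

lemma X_dir: "finite F \<Longrightarrow> F \<subseteq> X \<Longrightarrow> \<exists>\<gamma>\<in>elts \<alpha>. F \<subseteq> L \<gamma>"
proof (induction rule: finite_induct)
  case empty
  then show ?case using alpha_ne by blast
next
  case (insert x F)
  obtain \<gamma> where \<gamma>: "\<gamma> \<in> elts \<alpha>" "F \<subseteq> L \<gamma>" using insert by blast
  obtain \<beta> where \<beta>: "\<beta> \<in> elts \<alpha>" "definable (\<lambda>_. True) (L \<beta>) (elts x)"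
    using L_memE insert by blast
  obtain \<delta> where \<delta>: "\<delta> \<in> elts \<alpha>" "\<beta> \<in> elts \<delta>" using Lim \<beta> by blast
  have "x \<in> L \<delta>" using L_memI \<delta> \<beta> by blast
  moreover have "elts \<gamma> \<subseteq> elts \<delta> \<or> elts \<delta> \<subseteq> elts \<gamma>"
    using Ord_linear [of \<gamma> \<delta>] Ord_in_alpha \<gamma> \<delta> Ord_elts_subset by blast
  ultimately show ?case using \<gamma> \<delta> L_mono by blast
qed

definition inX :: "'a hset set \<Rightarrow> bool" where
  "inX S \<longleftrightarrow> small S \<and> mk S \<in> X"

lemma inX_iff: "inX S \<longleftrightarrow> (\<exists>x\<in>X. elts x = S)"
  unfolding inX_def by (metis elts_mk mk_elts small_elts)

lemma inX_mk: "inX S \<Longrightarrow> mk S \<in> X" and elts_mk_X: "inX S \<Longrightarrow> elts (mk S) = S"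
  by (auto simp: inX_def elts_mk)

lemma X_definable: "\<gamma> \<in> elts \<alpha> \<Longrightarrow> definable (\<lambda>_. True) (L \<gamma>) S \<Longrightarrow> small S \<Longrightarrow> inX S"
  unfolding inX_def using L_memI [of \<gamma> \<alpha> "mk S"] by (simp add: elts_mk)

lemma up_X: "a \<in> X \<Longrightarrow> b \<in> X \<Longrightarrow> up a b \<in> X"
proof -
  assume "a \<in> X" "b \<in> X"
  then obtain \<gamma> where \<gamma>: "\<gamma> \<in> elts \<alpha>" "{a, b} \<subseteq> L \<gamma>" using X_dir [of "{a, b}"] by auto
  have "definable (\<lambda>_. True) (L \<gamma>) {a, b}"
    unfolding definable_def
    by (rule exI [of _ "Neg (And (Neg (Eq 0 1)) (Neg (Eq 0 2)))"], rule exI [of _ "(\<lambda>_. b)(1 := a)"])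
      (use \<gamma> in auto)
  then show ?thesis using X_definable [OF \<gamma>(1)] small_finite [of "{a, b}"] by (simp add: inX_def up_def)
qed

lemma pair_X: "a \<in> X \<Longrightarrow> b \<in> X \<Longrightarrow> pair a b \<in> X"
  unfolding pair_def by (intro up_X)

lemma pair_XD: "pair a b \<in> X \<Longrightarrow> a \<in> X" "pair a b \<in> X \<Longrightarrow> b \<in> X"
  unfolding pair_def by (metis X_trans elts_up insert_subset)+

lemma hUnion_X: "x \<in> X \<Longrightarrow> hUnion x \<in> X"
proof -
  assume "x \<in> X"
  then obtain \<gamma> where \<gamma>: "\<gamma> \<in> elts \<alpha>" "{x} \<subseteq> L \<gamma>" using X_dir [of "{x}"] by auto
  have tr: "z \<in> L \<gamma>" if "z \<in> elts y" "y \<in> L \<gamma>" for z y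
    using L_trans [OF Ord_in_alpha [OF \<gamma>(1)] that(2)] that(1) by blast
  have "definable (\<lambda>_. True) (L \<gamma>) (elts (hUnion x))"
    unfolding definable_def
    by (rule exI [of _ "Ex 2 (And (Mem 2 1) (Mem 0 2))"], rule exI [of _ "\<lambda>_. x"])
      (use \<gamma> tr in auto)
  then show ?thesis using X_definable [OF \<gamma>(1)] by (metis inX_mk mk_elts small_elts)
qed

lemma hinsert_X: "a \<in> X \<Longrightarrow> x \<in> X \<Longrightarrow> hinsert a x \<in> X"
proof -
  assume "a \<in> X" "x \<in> X"
  moreover have "hinsert a x = hUnion (up (up a a) x)" by (rule hset_eqI) auto
  ultimately show ?thesis using hUnion_X up_X by simp
qed

text \<open>The set \<open>a\<close> and all parameters lie in one level, and by absoluteness the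
  formula has the same meaning there, so the subset is definable over that level. A fresh variable
  \<open>m\<close> carries \<open>a\<close>.\<close>

lemma sep_X:
  assumes "Dfn Delta0 X (\<lambda>e. P (e 0) (\<lambda>n. e (Suc n)))" "e \<in> envs X" "a \<in> X"
  shows "inX {x \<in> elts a. P x e}"
  using assms(1)
proof (rule Dfn_definable [OF rc_dc [OF dc_simps(1)] _ assms(2)])
  fix \<phi> e' assume \<phi>: "Delta0 \<phi>" "e' \<in> envs X"
    "\<And>x. x \<in> X \<Longrightarrow> P (case_nat x e 0) (\<lambda>n. case_nat x e (Suc n)) = sat X \<phi> (e'(0 := x))"
  obtain m where m: "m \<notin> insert 0 (fv \<phi>)" using finite_fv by (meson ex_new_if_finite finite_insert infinite_UNIV_nat)
  obtain \<gamma> where \<gamma>: "\<gamma> \<in> elts \<alpha>" "insert a (e' ` fv \<phi>) \<subseteq> L \<gamma>"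
    using X_dir [of "insert a (e' ` fv \<phi>)"] finite_fv [of \<phi>] assms(3) \<phi>(2) by (auto intro: envsD)
  have tr: "elts y \<subseteq> L \<gamma>" if "y \<in> L \<gamma>" for y
    using L_trans [OF Ord_in_alpha [OF \<gamma>(1)]] that by blast
  have sub: "L \<gamma> \<subseteq> X" using \<gamma>(1) by (simp add: L_mono Ord_elts_subset Ord_alpha)
  have "sat (L \<gamma>) \<phi> (e'(m := a, 0 := x)) = P x e" if "x \<in> L \<gamma>" for x
  proof -
    have "sat (L \<gamma>) \<phi> (e'(m := a, 0 := x)) = sat (L \<gamma>) \<phi> (e'(0 := x))"
      by (rule sat_cong) (use m in auto)
    also have "\<dots> = sat X \<phi> (e'(0 := x))"
      by (rule sat_Delta0_absolute [OF \<phi>(1) sub tr]) (use that \<gamma>(2) in auto)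
    finally show ?thesis using \<phi>(3) [of x] that sub by auto
  qed
  then have "{x \<in> elts a. P x e} = {x \<in> L \<gamma>. sat (L \<gamma>) (And (Mem 0 m) \<phi>) (e'(m := a, 0 := x))}"
    using tr [of a] \<gamma>(2) m by auto
  moreover have "\<forall>i\<in>fv (And (Mem 0 m) \<phi>) - {0}. (e'(m := a)) i \<in> L \<gamma>" using \<gamma>(2) by auto
  ultimately have "definable (\<lambda>_. True) (L \<gamma>) {x \<in> elts a. P x e}"
    unfolding definable_def by blast
  moreover have "small {x \<in> elts a. P x e}" by (rule small_subset [OF small_elts [of a]]) auto
  ultimately show ?thesis by (rule X_definable [OF \<gamma>(1)])
qed

lemma osuc_alpha: "\<beta> \<in> elts \<alpha> \<Longrightarrow> hinsert \<beta> \<beta> \<in> elts \<alpha>"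
proof -
  assume \<beta>: "\<beta> \<in> elts \<alpha>"
  have "Ord (hinsert \<beta> \<beta>)"
  proof (rule OrdI)
    fix \<gamma> assume "\<gamma> \<in> elts (hinsert \<beta> \<beta>)"
    then have "\<gamma> = \<beta> \<or> \<gamma> \<in> elts \<beta>" by simp
    then show "Ord \<gamma>" "elts \<gamma> \<subseteq> elts (hinsert \<beta> \<beta>)"
      using Ord_in_alpha [OF \<beta>] Ord_mem Ord_elts_subset by (simp_all, blast+)
  qed
  then show ?thesis using hinsert_X Ord_X_iff alpha_X [OF \<beta>] by blast
qed

lemma up_iff: "x = (up a b :: 'a hset) \<longleftrightarrow> a \<in> elts x \<and> b \<in> elts x \<and> (\<forall>y\<in>elts x. y = a \<or> y = b)"
proof -
  have "x = up a b \<longleftrightarrow> elts x = {a, b}" by (metis elts_inject elts_up)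
  then show ?thesis by auto
qed

lemma D_up: "dc \<Gamma> \<Longrightarrow> Dfn \<Gamma> X (\<lambda>e. e i = up (e j) (e k))"
  unfolding up_iff by (intro D_intros)

lemma pair_iff: "x = (pair a b :: 'a hset) \<longleftrightarrow> (\<exists>u\<in>elts x. \<exists>v\<in>elts x. u = up a a \<and> v = up a b \<and> x = up u v)"
  unfolding pair_def by auto

lemma D_pair: "dc \<Gamma> \<Longrightarrow> Dfn \<Gamma> X (\<lambda>e. e i = pair (e j) (e k))"
  unfolding pair_iff by (intro D_intros D_up)

lemma D_pair_mem: "dc \<Gamma> \<Longrightarrow> Dfn \<Gamma> X (\<lambda>e. pair (e i) (e j) \<in> elts (e k))"
proof -
  assume "dc \<Gamma>"
  then have "Dfn \<Gamma> X (\<lambda>e. \<exists>z\<in>elts (e k). z = pair (e i) (e j))" by (intro D_intros D_pair)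
  then show ?thesis by (rule Dfn_cong) blast
qed

lemma D_insert: "dc \<Gamma> \<Longrightarrow> Dfn \<Gamma> X (\<lambda>e. e i = hinsert (e j) (e k))"
proof -
  assume "dc \<Gamma>"
  then have "Dfn \<Gamma> X (\<lambda>e. e j \<in> elts (e i) \<and> (\<forall>z\<in>elts (e k). z \<in> elts (e i)) \<and>
    (\<forall>z\<in>elts (e i). z = e j \<or> z \<in> elts (e k)))" by (intro D_intros)
  then show ?thesis by (rule Dfn_cong) (auto simp: elts_inject [symmetric])
qed

lemma D_zer: "dc \<Gamma> \<Longrightarrow> Dfn \<Gamma> X (\<lambda>e. e i = zer)"
proof -
  assume "dc \<Gamma>"
  then have "Dfn \<Gamma> X (\<lambda>e. \<forall>z\<in>elts (e i). z \<noteq> z)" by (intro D_intros)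
  then show ?thesis by (rule Dfn_cong) (auto simp: elts_inject [symmetric])
qed

lemma D_Union: "dc \<Gamma> \<Longrightarrow> Dfn \<Gamma> X (\<lambda>e. e i = hUnion (e j))"
proof -
  assume "dc \<Gamma>"
  then have "Dfn \<Gamma> X (\<lambda>e. (\<forall>z\<in>elts (e i). \<exists>u\<in>elts (e j). z \<in> elts u) \<and>
    (\<forall>u\<in>elts (e j). \<forall>z\<in>elts u. z \<in> elts (e i)))" by (intro D_intros)
  then show ?thesis by (rule Dfn_cong) (auto simp: elts_inject [symmetric])
qed

text \<open>The components of a pair are elements of its elements, so quantifying over them is
  bounded. \<open>u\<close> and \<open>v\<close> are the intermediate sets through which they are
  reached; the renaming skips the slots of \<open>u\<close> and \<open>v\<close>.\<close>

lemma D_ex_eq_pair: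
  assumes "dc \<Gamma>" "Dfn \<Gamma> X (\<lambda>e. P (e (Suc 0)) (e 0) (\<lambda>n. e (Suc (Suc n))))"
  shows "Dfn \<Gamma> X (\<lambda>e. \<exists>a b. e i = pair a b \<and> P a b e)"
proof -
  have inj: "inj (case_nat 0 (case_nat 2 (\<lambda>n. n + 4)))"
    by (auto simp: inj_def split: nat.splits)
  have "Dfn \<Gamma> X (\<lambda>e. P (e 2) (e 0) (\<lambda>n. e (n + 4)))"
    using Dfn_ren [OF assms inj] by simp
  then have "Dfn \<Gamma> X (\<lambda>e. P (e (Suc (Suc 0))) (e 0) (\<lambda>n. e (Suc (Suc (Suc (Suc n))))))"
    by (simp add: numeral_eq_Suc)
  then have "Dfn \<Gamma> X (\<lambda>e. \<exists>u\<in>elts (e i). \<exists>a\<in>elts u. \<exists>v\<in>elts (e i). \<exists>b\<in>elts v. e i = pair a b \<and> P a b e)"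
    by (intro D_intros D_pair assms)
  then show ?thesis
    by (rule Dfn_cong) (auto simp: pair_def)
qed

lemma D_ex_pair_mem:
  assumes "dc \<Gamma>" "Dfn \<Gamma> X (\<lambda>e. P (e (Suc 0)) (e 0) (\<lambda>n. e (Suc (Suc n))))"
  shows "Dfn \<Gamma> X (\<lambda>e. \<exists>a b. pair a b \<in> elts (e i) \<and> P a b e)"
proof -
  have inj: "inj (case_nat 0 (case_nat 1 (\<lambda>n. n + 3)))"
    by (auto simp: inj_def split: nat.splits)
  have "Dfn \<Gamma> X (\<lambda>e. P (e 1) (e 0) (\<lambda>n. e (n + 3)))"
    using Dfn_ren [OF assms inj] by simp
  then have "Dfn \<Gamma> X (\<lambda>e. P (e (Suc 0)) (e 0) (\<lambda>n. e (Suc (Suc (Suc n)))))"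
    by (simp add: numeral_eq_Suc)
  then have "Dfn \<Gamma> X (\<lambda>e. \<exists>z\<in>elts (e i). \<exists>a b. z = pair a b \<and> P a b e)"
    by (intro D_intros D_ex_eq_pair assms)
  then show ?thesis
    by (rule Dfn_cong) blast
qed

lemma D_ex_pair_mem1:
  assumes "dc \<Gamma>" "Dfn \<Gamma> X (\<lambda>e. P (e 0) (\<lambda>n. e (Suc n)))"
  shows "Dfn \<Gamma> X (\<lambda>e. \<exists>b. pair (e j) b \<in> elts (e i) \<and> P b e)"
proof -
  have inj: "inj (case_nat 0 (\<lambda>n. n + 2))"
    by (auto simp: inj_def split: nat.splits)
  have "Dfn \<Gamma> X (\<lambda>e. P (e 0) (\<lambda>n. e (n + 2)))"
    using Dfn_ren [OF assms inj] by simp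
  then have "Dfn \<Gamma> X (\<lambda>e. P (e 0) (\<lambda>n. e (Suc (Suc n))))"
    by (simp add: numeral_eq_Suc)
  then have "Dfn \<Gamma> X (\<lambda>e. \<exists>a b. pair a b \<in> elts (e i) \<and> a = e j \<and> P b e)"
    by (intro D_intros D_ex_pair_mem assms)
  then show ?thesis
    by (rule Dfn_cong) blast
qed

lemma D_all_pair_mem:
  assumes "dc \<Gamma>" "Dfn \<Gamma> X (\<lambda>e. P (e (Suc 0)) (e 0) (\<lambda>n. e (Suc (Suc n))))"
  shows "Dfn \<Gamma> X (\<lambda>e. \<forall>a b. pair a b \<in> elts (e i) \<longrightarrow> P a b e)"
proof -
  have "Dfn \<Gamma> X (\<lambda>e. \<not> (\<exists>a b. pair a b \<in> elts (e i) \<and> \<not> P a b e))"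
    by (intro D_intros D_ex_pair_mem assms)
  then show ?thesis
    by (rule Dfn_cong) blast
qed

lemmas D_sets = D_intros D_subset D_Ord D_up D_pair D_pair_mem D_insert D_zer D_Union D_ex_eq_pair
  D_ex_pair_mem D_ex_pair_mem1 D_all_pair_mem

end

lemma Dfn_sub:
  "dc \<Gamma> \<Longrightarrow> Dfn \<Gamma> X Q \<Longrightarrow> inj f \<Longrightarrow> (\<And>e. g e = (\<lambda>n. e (f n))) \<Longrightarrow> Dfn \<Gamma> X (\<lambda>e. Q (g e))"
  using Dfn_ren [of \<Gamma> X Q f] by simp

section \<open>Recursion over graphs\<close>

definition lam :: "'a hset \<Rightarrow> ('a hset \<Rightarrow> 'a hset) \<Rightarrow> 'a hset" where
  "lam x F = mk ((\<lambda>y. pair y (F y)) ` elts x)"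

lemma elts_lam: "elts (lam x F) = (\<lambda>y. pair y (F y)) ` elts x"
  unfolding lam_def by (intro elts_mk small_image small_elts)

lemma lam_cong: "(\<And>y. y \<in> elts x \<Longrightarrow> F y = G y) \<Longrightarrow> lam x F = lam x G"
  unfolding lam_def by (metis (no_types, lifting) image_cong)

text \<open>The step function receives the restriction as a set of pairs and not as a function of
  the logic, so that the recursion can be carried out inside \<open>L \<alpha>\<close>.\<close>

definition hrec :: "('a hset \<Rightarrow> 'a hset) \<Rightarrow> 'a hset \<Rightarrow> 'a hset" where
  "hrec G = wfrec {(x, y). x \<in> elts y} (\<lambda>F x. G (lam x F))"

lemma hrec_eq: "hrec G x = G (lam x (hrec G))"
  unfolding hrec_def
  by (subst wfrec [OF wf_elts]) (intro arg_cong [of _ _ G] lam_cong, simp add: cut_def)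

context adm
begin

section \<open>Relations definable by \<open>\<Sigma>\<^sub>1\<close> formulas\<close>

definition Sig :: "((nat \<Rightarrow> 'a hset) \<Rightarrow> bool) \<Rightarrow> bool" where
  "Sig P \<longleftrightarrow> (\<exists>Q. Dfn Delta0 X Q \<and> (\<forall>e\<in>envs X. P e \<longleftrightarrow> (\<exists>w\<in>X. Q (case_nat w e))))"

text \<open>
  Replacement is only available for total functions, so bounded universal quantification of
  \<open>\<Sigma>\<^sub>1\<close> predicates is at first only possible if the witnesses are unique. This suffices to show
  that \<open>\<gamma> \<mapsto> L \<gamma>\<close> is \<open>\<Sigma>\<^sub>1\<close>, from which collection follows.
\<close>

definition USig :: "((nat \<Rightarrow> 'a hset) \<Rightarrow> bool) \<Rightarrow> bool" where
  "USig P \<longleftrightarrow> (\<exists>Q. Dfn Delta0 X Q \<and> (\<forall>e\<in>envs X. P e \<longleftrightarrow> (\<exists>w\<in>X. Q (case_nat w e))) \<and>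
    (\<forall>e\<in>envs X. \<forall>w\<in>X. \<forall>w'\<in>X. Q (case_nat w e) \<longrightarrow> Q (case_nat w' e) \<longrightarrow> w = w'))"

lemma USig_Sig: "USig P \<Longrightarrow> Sig P"
  unfolding USig_def Sig_def by blast

lemma Sig_cong: "Sig P \<Longrightarrow> (\<And>e. e \<in> envs X \<Longrightarrow> P e = Q e) \<Longrightarrow> Sig Q"
  unfolding Sig_def by auto

lemma USig_cong: "USig P \<Longrightarrow> (\<And>e. e \<in> envs X \<Longrightarrow> P e = Q e) \<Longrightarrow> USig Q"
  unfolding USig_def by auto

lemma SigI:
  "Dfn Delta0 X Q \<Longrightarrow> (\<And>e. e \<in> envs X \<Longrightarrow> P e \<longleftrightarrow> (\<exists>w\<in>X. Q (case_nat w e))) \<Longrightarrow> Sig P"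
  unfolding Sig_def by blast

lemma USigI:
  "Dfn Delta0 X Q \<Longrightarrow> (\<And>e. e \<in> envs X \<Longrightarrow> P e \<longleftrightarrow> (\<exists>w\<in>X. Q (case_nat w e))) \<Longrightarrow>
    (\<And>e w w'. e \<in> envs X \<Longrightarrow> w \<in> X \<Longrightarrow> w' \<in> X \<Longrightarrow> Q (case_nat w e) \<Longrightarrow> Q (case_nat w' e) \<Longrightarrow> w = w') \<Longrightarrow> USig P"
  unfolding USig_def by blast

lemma SigE:
  assumes "Sig P"
  obtains Q where "Dfn Delta0 X Q" "\<And>e. e \<in> envs X \<Longrightarrow> P e \<longleftrightarrow> (\<exists>w\<in>X. Q (case_nat w e))"
  using assms unfolding Sig_def by blast

lemma USigE:
  assumes "USig P"
  obtains Q where "Dfn Delta0 X Q" "\<And>e. e \<in> envs X \<Longrightarrow> P e \<longleftrightarrow> (\<exists>w\<in>X. Q (case_nat w e))"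
    "\<And>e w w'. e \<in> envs X \<Longrightarrow> w \<in> X \<Longrightarrow> w' \<in> X \<Longrightarrow> Q (case_nat w e) \<Longrightarrow> Q (case_nat w' e) \<Longrightarrow> w = w'"
  using assms unfolding USig_def by blast

lemma Sig_Sigma1: "Sig P \<Longrightarrow> Dfn Sigma1 X P"
proof (erule SigE, erule DfnE)
  fix Q \<phi> k p
  assume Q: "\<And>e. e \<in> envs X \<Longrightarrow> P e \<longleftrightarrow> (\<exists>w\<in>X. Q (case_nat w e))"
    and \<phi>: "Delta0 \<phi>" "p \<in> envs X" "\<And>e. e \<in> envs X \<Longrightarrow> Q e = sat X \<phi> (lay k p e)"
  show "Dfn Sigma1 X P"
    unfolding Dfn_def
  proof (intro exI conjI ballI)
    show "Sigma1 (Ex k \<phi>)" using \<phi> by (intro Sigma1.intros)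
    show "P e = sat X (Ex k \<phi>) (lay (Suc k) p e)" if "e \<in> envs X" for e
      using Q [OF that] \<phi>(3) [of "case_nat _ e"] that by (simp add: lay_upd del: fun_upd_apply)
  qed (fact \<phi>)
qed

lemma inj_up: "inj f \<Longrightarrow> inj (case_nat 0 (\<lambda>n. Suc (f n)))"
  by (rule injI) (auto split: nat.splits dest: injD)

lemma case_nat_ren: "case_nat w (\<lambda>n. e (f n)) = (\<lambda>n. case_nat w e (case_nat 0 (\<lambda>n. Suc (f n)) n))"
  by (auto simp: fun_eq_iff split: nat.splits)

lemma Sig_ren: "Sig P \<Longrightarrow> inj f \<Longrightarrow> Sig (\<lambda>e. P (\<lambda>n. e (f n)))"
proof (erule SigE)
  fix Q assume Q: "Dfn Delta0 X Q" "\<And>e. e \<in> envs X \<Longrightarrow> P e \<longleftrightarrow> (\<exists>w\<in>X. Q (case_nat w e))"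
    and f: "inj f"
  show ?thesis
    by (rule SigI [OF Dfn_ren [OF dc_simps(1) Q(1) inj_up [OF f]]])
      (simp only: Q(2) envs_comp case_nat_ren [symmetric])
qed

lemma USig_ren: "USig P \<Longrightarrow> inj f \<Longrightarrow> USig (\<lambda>e. P (\<lambda>n. e (f n)))"
proof (erule USigE)
  fix Q assume Q: "Dfn Delta0 X Q" "\<And>e. e \<in> envs X \<Longrightarrow> P e \<longleftrightarrow> (\<exists>w\<in>X. Q (case_nat w e))"
    "\<And>e w w'. e \<in> envs X \<Longrightarrow> w \<in> X \<Longrightarrow> w' \<in> X \<Longrightarrow> Q (case_nat w e) \<Longrightarrow> Q (case_nat w' e) \<Longrightarrow> w = w'"
    and f: "inj f"
  show ?thesis
  proof (rule USigI [OF Dfn_ren [OF dc_simps(1) Q(1) inj_up [OF f]]])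
    show "P (\<lambda>n. e (f n)) \<longleftrightarrow> (\<exists>w\<in>X. Q (\<lambda>n. case_nat w e (case_nat 0 (\<lambda>n. Suc (f n)) n)))"
      if "e \<in> envs X" for e
      using that by (simp only: Q(2) envs_comp case_nat_ren [symmetric])
    show "w = w'" if "e \<in> envs X" "w \<in> X" "w' \<in> X"
      "Q (\<lambda>n. case_nat w e (case_nat 0 (\<lambda>n. Suc (f n)) n))"
      "Q (\<lambda>n. case_nat w' e (case_nat 0 (\<lambda>n. Suc (f n)) n))" for e w w'
      using Q(3) [of "\<lambda>n. e (f n)" w w'] that by (simp only: envs_comp case_nat_ren [symmetric])
  qed
qed

lemma replacement_X:
  assumes "Sig P" "e \<in> envs X" "a \<in> X"
    and "\<And>x. x \<in> elts a \<Longrightarrow> \<exists>!y. y \<in> X \<and> P (case_nat x (case_nat y e))"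
  shows "inX {y \<in> X. \<exists>x\<in>elts a. P (case_nat x (case_nat y e))}"
proof (rule Dfn_definable2 [OF rc_Sigma1 Sig_Sigma1 [OF assms(1)] assms(2)])
  fix \<phi> e' assume \<phi>: "Sigma1 \<phi>" "e' \<in> envs X"
    "\<And>x y. x \<in> X \<Longrightarrow> y \<in> X \<Longrightarrow> P (case_nat x (case_nat y e)) = sat X \<phi> (e'(0 := x, 1 := y))"
  have a: "elts a \<inter> X = elts a" using X_trans [OF assms(3)] by blast
  have "\<exists>!y. y \<in> X \<and> sat X \<phi> (e'(0 := x, 1 := y))" if "x \<in> elts a" for x
    using assms(4) [OF that] \<phi>(3) [of x] that trsD [OF assms(3)] by metis
  moreover have "\<forall>i\<in>fv \<phi> - {0, 1}. e' i \<in> X" using \<phi>(2) envsD by blast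
  moreover have R: "Sigma1_replacement X" using adm by (simp add: Sigma1_admissible_def)
  ultimately have "\<exists>b\<in>X. \<forall>y\<in>X. y \<in> elts b \<longleftrightarrow> (\<exists>x\<in>elts a. sat X \<phi> (e'(0 := x, 1 := y)))"
    using bspec [OF spec [OF spec [OF R [unfolded Sigma1_replacement_def], of \<phi>], of e'] assms(3)] \<phi>(1)
    unfolding a by blast
  then obtain b where b: "b \<in> X"
    "\<forall>y\<in>X. y \<in> elts b \<longleftrightarrow> (\<exists>x\<in>elts a. sat X \<phi> (e'(0 := x, 1 := y)))" by blast
  have "elts b = {y \<in> X. \<exists>x\<in>elts a. P (case_nat x (case_nat y e))}"
    using b \<phi>(3) trsD [OF assms(3)] trsD [OF b(1)] by blast
  then show ?thesis using b(1) inX_iff by blast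
qed

lemma image_X:
  assumes "Sig (\<lambda>e. F (\<lambda>n. e (Suc (Suc n))) (e 0) = e (Suc 0))" "e \<in> envs X" "a \<in> X"
    and "\<And>x. x \<in> elts a \<Longrightarrow> F e x \<in> X"
  shows "inX (F e ` elts a)"
proof -
  have "inX {y \<in> X. \<exists>x\<in>elts a. F e x = y}"
  proof -
    have "\<exists>!y. y \<in> X \<and> F e x = y" if "x \<in> elts a" for x using assms(4) [OF that] by blast
    then show ?thesis using replacement_X [OF assms(1-3)] by simp
  qed
  moreover have "{y \<in> X. \<exists>x\<in>elts a. F e x = y} = F e ` elts a" using assms(4) by auto
  ultimately show ?thesis by simp
qed

lemma USig_Del:
  assumes "Dfn Delta0 X P" shows "USig P"
proof (rule USigI)
  \<comment> \<open>The predicate has no witness of its own, so a dummy is pinned to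
    \<open>zer\<close> to make it unique.\<close>
  show "Dfn Delta0 X (\<lambda>e. P (\<lambda>n. e (Suc n)) \<and> e 0 = zer)"
    by (intro D_sets Dfn_ren [OF _ assms]) auto
qed (use zer_X in auto)

lemma Sig_Del: "Dfn Delta0 X P \<Longrightarrow> Sig P"
  by (intro USig_Sig USig_Del)

lemma ex_pair_X: "(\<exists>w\<in>X. \<exists>a b. w = pair a b \<and> P a b) \<longleftrightarrow> (\<exists>a\<in>X. \<exists>b\<in>X. P a b)"
proof
  assume "\<exists>w\<in>X. \<exists>a b. w = pair a b \<and> P a b"
  then obtain a b where "pair a b \<in> X" "P a b" by blast
  then show "\<exists>a\<in>X. \<exists>b\<in>X. P a b" using pair_XD by blast
next
  assume "\<exists>a\<in>X. \<exists>b\<in>X. P a b"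
  then obtain a b where "a \<in> X" "b \<in> X" "P a b" by blast
  then show "\<exists>w\<in>X. \<exists>a b. w = pair a b \<and> P a b"
    by (intro bexI [of _ "pair a b"] exI [of _ a] exI [of _ b] pair_X conjI refl)
qed

lemma USig_and:
  assumes "USig P" "USig R" shows "USig (\<lambda>e. P e \<and> R e)"
  using assms(1)
proof (rule USigE)
  fix Q assume Q: "Dfn Delta0 X Q" "\<And>e. e \<in> envs X \<Longrightarrow> P e \<longleftrightarrow> (\<exists>w\<in>X. Q (case_nat w e))"
    "\<And>e w w'. e \<in> envs X \<Longrightarrow> w \<in> X \<Longrightarrow> w' \<in> X \<Longrightarrow> Q (case_nat w e) \<Longrightarrow> Q (case_nat w' e) \<Longrightarrow> w = w'"
  show ?thesis using assms(2)
  proof (rule USigE)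
    fix S assume S: "Dfn Delta0 X S" "\<And>e. e \<in> envs X \<Longrightarrow> R e \<longleftrightarrow> (\<exists>w\<in>X. S (case_nat w e))"
      "\<And>e w w'. e \<in> envs X \<Longrightarrow> w \<in> X \<Longrightarrow> w' \<in> X \<Longrightarrow> S (case_nat w e) \<Longrightarrow> S (case_nat w' e) \<Longrightarrow> w = w'"
    let ?Q = "\<lambda>e. \<exists>a b. e 0 = pair a b \<and> Q (case_nat a (\<lambda>n. e (Suc n))) \<and> S (case_nat b (\<lambda>n. e (Suc n)))"
    show ?thesis
    proof (rule USigI)
      have "Dfn Delta0 X (\<lambda>e. Q (case_nat (e (Suc 0)) (\<lambda>n. e (Suc (Suc (Suc n))))))"
        by (rule Dfn_sub [OF _ Q(1), of "case_nat 1 (\<lambda>n. n + 3)"])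
          (auto simp: inj_def fun_eq_iff numeral_eq_Suc split: nat.splits)
      moreover have "Dfn Delta0 X (\<lambda>e. S (case_nat (e 0) (\<lambda>n. e (Suc (Suc (Suc n))))))"
        by (rule Dfn_sub [OF _ S(1), of "case_nat 0 (\<lambda>n. n + 3)"])
          (auto simp: inj_def fun_eq_iff numeral_eq_Suc split: nat.splits)
      ultimately show "Dfn Delta0 X ?Q" by (intro D_sets)
      show "(P e \<and> R e) \<longleftrightarrow> (\<exists>w\<in>X. ?Q (case_nat w e))" if "e \<in> envs X" for e
        using Q(2) [OF that] S(2) [OF that] by (simp add: ex_pair_X)
      show "w = w'" if t: "e \<in> envs X" "w \<in> X" "w' \<in> X" "?Q (case_nat w e)" "?Q (case_nat w' e)" for e w w'
      proof -
        obtain a b where ab: "w = pair a b" "Q (case_nat a e)" "S (case_nat b e)" using t(4) by auto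
        obtain c d where cd: "w' = pair c d" "Q (case_nat c e)" "S (case_nat d e)" using t(5) by auto
        have "a \<in> X" "b \<in> X" "c \<in> X" "d \<in> X" using t(2,3) ab(1) cd(1) pair_XD by blast+
        then show ?thesis using Q(3) [OF t(1)] S(3) [OF t(1)] ab cd by blast
      qed
    qed
  qed
qed

text \<open>The new witness is the pair of \<open>x\<close> and the witness for \<open>x\<close>.
  For it to be unique, \<open>x\<close> has to be unique too.\<close>

lemma USig_ex1:
  assumes "USig (\<lambda>e. P (e 0) (\<lambda>n. e (Suc n)))"
    and "\<And>e x y. e \<in> envs X \<Longrightarrow> x \<in> X \<Longrightarrow> y \<in> X \<Longrightarrow> P x e \<Longrightarrow> P y e \<Longrightarrow> x = y"
  shows "USig (\<lambda>e. \<exists>x\<in>X. P x e)"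
  using assms(1)
proof (rule USigE)
  fix Q assume Q: "Dfn Delta0 X Q"
    "\<And>e. e \<in> envs X \<Longrightarrow> P (e 0) (\<lambda>n. e (Suc n)) \<longleftrightarrow> (\<exists>w\<in>X. Q (case_nat w e))"
    "\<And>e w w'. e \<in> envs X \<Longrightarrow> w \<in> X \<Longrightarrow> w' \<in> X \<Longrightarrow> Q (case_nat w e) \<Longrightarrow> Q (case_nat w' e) \<Longrightarrow> w = w'"
  have Q2: "P x e \<longleftrightarrow> (\<exists>w\<in>X. Q (case_nat w (case_nat x e)))" if "e \<in> envs X" "x \<in> X" for x e
    using Q(2) [of "case_nat x e"] that by simp
  let ?Q = "\<lambda>e. \<exists>x w. e 0 = pair x w \<and> Q (case_nat w (case_nat x (\<lambda>n. e (Suc n))))"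
  show ?thesis
  proof (rule USigI)
    have "Dfn Delta0 X (\<lambda>e. Q (case_nat (e 0) (case_nat (e (Suc 0)) (\<lambda>n. e (Suc (Suc (Suc n)))))))"
      by (rule Dfn_sub [OF _ Q(1), of "case_nat 0 (case_nat 1 (\<lambda>n. n + 3))"])
        (auto simp: inj_def fun_eq_iff numeral_eq_Suc split: nat.splits)
    then show "Dfn Delta0 X ?Q" by (intro D_sets)
    show "(\<exists>x\<in>X. P x e) \<longleftrightarrow> (\<exists>w\<in>X. ?Q (case_nat w e))" if "e \<in> envs X" for e
      using Q2 [OF that] by (simp add: ex_pair_X)
    show "w = w'" if t: "e \<in> envs X" "w \<in> X" "w' \<in> X" "?Q (case_nat w e)" "?Q (case_nat w' e)" for e w w'
    proof -
      obtain x u where xu: "w = pair x u" "Q (case_nat u (case_nat x e))" using t(4) by auto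
      obtain y v where yv: "w' = pair y v" "Q (case_nat v (case_nat y e))" using t(5) by auto
      have X: "x \<in> X" "u \<in> X" "y \<in> X" "v \<in> X" using xu(1) yv(1) t(2,3) pair_XD by blast+
      have "P x e" "P y e" using Q2 t(1) X xu yv by blast+
      then have "x = y" using assms(2) t(1) X by blast
      then have "u = v" using Q(3) [of "case_nat x e" u v] xu yv X t(1) by simp
      then show ?thesis using \<open>x = y\<close> xu yv by simp
    qed
  qed
qed

text \<open>Composition of functions: an intermediate value is determined by its arguments, so it
  may be quantified without losing uniqueness of witnesses.\<close>

lemma USig_let:
  assumes "USig (\<lambda>e. g (\<lambda>n. e (Suc n)) = e 0)" "USig (\<lambda>e. P (e 0) (\<lambda>n. e (Suc n)))"
    and "\<And>e. e \<in> envs X \<Longrightarrow> g e \<in> X"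
  shows "USig (\<lambda>e. P (g e) e)"
proof -
  have "USig (\<lambda>e. \<exists>x\<in>X. g e = x \<and> P x e)"
    by (rule USig_ex1) (use USig_and [OF assms(1,2)] in auto)
  then show ?thesis by (rule USig_cong) (use assms(3) in auto)
qed

lemma Sig_ex:
  assumes "Sig (\<lambda>e. P (e 0) (\<lambda>n. e (Suc n)))"
  shows "Sig (\<lambda>e. \<exists>x\<in>X. P x e)"
  using assms(1)
proof (rule SigE)
  fix Q assume Q: "Dfn Delta0 X Q"
    "\<And>e. e \<in> envs X \<Longrightarrow> P (e 0) (\<lambda>n. e (Suc n)) \<longleftrightarrow> (\<exists>w\<in>X. Q (case_nat w e))"
  have Q2: "P x e \<longleftrightarrow> (\<exists>w\<in>X. Q (case_nat w (case_nat x e)))" if "e \<in> envs X" "x \<in> X" for x e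
    using Q(2) [of "case_nat x e"] that by simp
  let ?Q = "\<lambda>e. \<exists>x w. e 0 = pair x w \<and> Q (case_nat w (case_nat x (\<lambda>n. e (Suc n))))"
  show ?thesis
  proof (rule SigI)
    have "Dfn Delta0 X (\<lambda>e. Q (case_nat (e 0) (case_nat (e (Suc 0)) (\<lambda>n. e (Suc (Suc (Suc n)))))))"
      by (rule Dfn_sub [OF _ Q(1), of "case_nat 0 (case_nat 1 (\<lambda>n. n + 3))"])
        (auto simp: inj_def fun_eq_iff numeral_eq_Suc split: nat.splits)
    then show "Dfn Delta0 X ?Q" by (intro D_sets)
    show "(\<exists>x\<in>X. P x e) \<longleftrightarrow> (\<exists>w\<in>X. ?Q (case_nat w e))" if "e \<in> envs X" for e
      using Q2 [OF that] by (simp add: ex_pair_X)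
  qed
qed

lemma Sig_and:
  assumes "Sig P" "Sig R" shows "Sig (\<lambda>e. P e \<and> R e)"
  using assms(1)
proof (rule SigE)
  fix Q assume Q: "Dfn Delta0 X Q" "\<And>e. e \<in> envs X \<Longrightarrow> P e \<longleftrightarrow> (\<exists>w\<in>X. Q (case_nat w e))"
  show ?thesis using assms(2)
  proof (rule SigE)
    fix S assume S: "Dfn Delta0 X S" "\<And>e. e \<in> envs X \<Longrightarrow> R e \<longleftrightarrow> (\<exists>w\<in>X. S (case_nat w e))"
    have "Dfn Delta0 X (\<lambda>e. Q (case_nat (e 0) (\<lambda>n. e (Suc (Suc n)))))"
      by (rule Dfn_sub [OF _ Q(1), of "case_nat 0 (\<lambda>n. n + 2)"])
        (auto simp: inj_def fun_eq_iff numeral_eq_Suc split: nat.splits)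
    moreover have "Dfn Delta0 X (\<lambda>e. S (case_nat (e (Suc 0)) (\<lambda>n. e (Suc (Suc n)))))"
      by (rule Dfn_sub [OF _ S(1), of "case_nat 1 (\<lambda>n. n + 2)"])
        (auto simp: inj_def fun_eq_iff numeral_eq_Suc split: nat.splits)
    ultimately have "Sig (\<lambda>e. \<exists>v\<in>X. \<exists>w\<in>X. Q (case_nat w e) \<and> S (case_nat v e))"
      by (intro Sig_ex Sig_Del D_sets)
    then show ?thesis by (rule Sig_cong) (auto simp: Q(2) S(2))
  qed
qed

lemma Sig_or:
  assumes "Sig P" "Sig R" shows "Sig (\<lambda>e. P e \<or> R e)"
  using assms(1)
proof (rule SigE)
  fix Q assume Q: "Dfn Delta0 X Q" "\<And>e. e \<in> envs X \<Longrightarrow> P e \<longleftrightarrow> (\<exists>w\<in>X. Q (case_nat w e))"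
  show ?thesis using assms(2)
  proof (rule SigE)
    fix S assume S: "Dfn Delta0 X S" "\<And>e. e \<in> envs X \<Longrightarrow> R e \<longleftrightarrow> (\<exists>w\<in>X. S (case_nat w e))"
    have "Dfn Delta0 X (\<lambda>e. Q e \<or> S e)" using Q(1) S(1) by (intro D_sets)
    then show ?thesis by (rule SigI) (auto simp: Q(2) S(2))
  qed
qed

text \<open>The witness is the set of all pairs of some \<open>x\<close> and the witness for
  \<open>x\<close>. Replacement yields this set because the individual witnesses are unique, and it
  is unique itself because \<open>?Q\<close> admits only such pairs and requires one for each
  \<open>x\<close>.\<close>

lemma USig_ball:
  assumes "USig (\<lambda>e. P (e 0) (\<lambda>n. e (Suc n)))"
  shows "USig (\<lambda>e. \<forall>x\<in>elts (e i). P x e)"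
  using assms(1)
proof (rule USigE)
  fix Q assume Q: "Dfn Delta0 X Q"
    "\<And>e. e \<in> envs X \<Longrightarrow> P (e 0) (\<lambda>n. e (Suc n)) \<longleftrightarrow> (\<exists>w\<in>X. Q (case_nat w e))"
    "\<And>e w w'. e \<in> envs X \<Longrightarrow> w \<in> X \<Longrightarrow> w' \<in> X \<Longrightarrow> Q (case_nat w e) \<Longrightarrow> Q (case_nat w' e) \<Longrightarrow> w = w'"
  have Q2: "P x e \<longleftrightarrow> (\<exists>w\<in>X. Q (case_nat w (case_nat x e)))" if "e \<in> envs X" "x \<in> X" for x e
    using Q(2) [of "case_nat x e"] that by simp
  let ?Q = "\<lambda>e. (\<forall>z\<in>elts (e 0). \<exists>x w. z = pair x w \<and> x \<in> elts (e (Suc i)) \<and>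
      Q (case_nat w (case_nat x (\<lambda>n. e (Suc n))))) \<and> (\<forall>x\<in>elts (e (Suc i)). \<exists>w. pair x w \<in> elts (e 0) \<and> w = w)"
  show ?thesis
  proof (rule USigI)
    have "Dfn Delta0 X (\<lambda>e. Q (case_nat (e 0) (case_nat (e (Suc 0)) (\<lambda>n. e (Suc (Suc (Suc (Suc n))))))))"
      by (rule Dfn_sub [OF _ Q(1), of "case_nat 0 (case_nat 1 (\<lambda>n. n + 4))"])
        (auto simp: inj_def fun_eq_iff numeral_eq_Suc split: nat.splits)
    then show "Dfn Delta0 X ?Q" by (intro D_sets)
    show "(\<forall>x\<in>elts (e i). P x e) \<longleftrightarrow> (\<exists>w\<in>X. ?Q (case_nat w e))" if e: "e \<in> envs X" for e
    proof
      assume *: "\<forall>x\<in>elts (e i). P x e"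
      have ei: "e i \<in> X" using envsD [OF e] .
      have "Dfn Delta0 X (\<lambda>e. Q (case_nat (e 0) (case_nat (e (Suc 0)) (\<lambda>n. e (Suc (Suc (Suc n)))))))"
        by (rule Dfn_sub [OF _ Q(1), of "case_nat 0 (case_nat 1 (\<lambda>n. n + 3))"])
          (auto simp: inj_def fun_eq_iff numeral_eq_Suc split: nat.splits)
      then have "Sig (\<lambda>e. \<exists>w\<in>X. e (Suc 0) = pair (e 0) w \<and> Q (case_nat w (case_nat (e 0) (\<lambda>n. e (Suc (Suc n))))))"
        by (intro Sig_ex Sig_Del D_sets)
      note rep = replacement_X [OF this e ei]
      have "\<exists>!y. y \<in> X \<and> (\<exists>w\<in>X. y = pair x w \<and> Q (case_nat w (case_nat x e)))"
        if x: "x \<in> elts (e i)" for x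
      proof -
        have xX: "x \<in> X" using x trsD [OF ei] by blast
        obtain w where w: "w \<in> X" "Q (case_nat w (case_nat x e))" using * x Q2 [OF e xX] by blast
        show ?thesis
        proof (rule ex1I [of _ "pair x w"])
          show "pair x w \<in> X \<and> (\<exists>v\<in>X. pair x w = pair x v \<and> Q (case_nat v (case_nat x e)))"
            using w pair_X [OF xX w(1)] by blast
          show "y = pair x w" if "y \<in> X \<and> (\<exists>v\<in>X. y = pair x v \<and> Q (case_nat v (case_nat x e)))" for y
            using that Q(3) [OF envs_cons [OF xX e] w(1) _ w(2)] by blast
        qed
      qed
      then have "inX {y \<in> X. \<exists>x\<in>elts (e i). \<exists>w\<in>X. y = pair x w \<and> Q (case_nat w (case_nat x e))}"
        using rep by simp
      then obtain g where g: "g \<in> X"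
        "elts g = {y \<in> X. \<exists>x\<in>elts (e i). \<exists>w\<in>X. y = pair x w \<and> Q (case_nat w (case_nat x e))}"
        using inX_iff by auto
      have "\<exists>w. pair x w \<in> elts g" if x: "x \<in> elts (e i)" for x
      proof -
        have xX: "x \<in> X" using x trsD [OF ei] by blast
        obtain w where w: "w \<in> X" "Q (case_nat w (case_nat x e))" using * x Q2 [OF e xX] by blast
        then show ?thesis using g(2) x pair_X [OF xX w(1)] by auto
      qed
      then show "\<exists>w\<in>X. ?Q (case_nat w e)" using g by (intro bexI [of _ g]) auto
    next
      assume "\<exists>w\<in>X. ?Q (case_nat w e)"
      then obtain g where g: "g \<in> X" "?Q (case_nat g e)" by blast
      show "\<forall>x\<in>elts (e i). P x e"
      proof
        fix x assume x: "x \<in> elts (e i)"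
        then obtain w where w: "pair x w \<in> elts g" using g(2) by auto
        then have "Q (case_nat w (case_nat x e))" using g(2) by auto
        moreover have "x \<in> X" "w \<in> X" using trsD [OF g(1) w] pair_XD by blast+
        ultimately show "P x e" using Q2 [OF e] by blast
      qed
    qed
    have sub: "elts g \<subseteq> elts g'"
      if t: "e \<in> envs X" "g \<in> X" "g' \<in> X" "?Q (case_nat g e)" "?Q (case_nat g' e)" for e g g'
    proof
      fix z assume z: "z \<in> elts g"
      have g: "\<And>z. z \<in> elts g \<Longrightarrow> \<exists>x w. z = pair x w \<and> x \<in> elts (e i) \<and> Q (case_nat w (case_nat x e))"
        and g': "\<And>z. z \<in> elts g' \<Longrightarrow> \<exists>x w. z = pair x w \<and> x \<in> elts (e i) \<and> Q (case_nat w (case_nat x e))"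
          "\<And>x. x \<in> elts (e i) \<Longrightarrow> \<exists>w. pair x w \<in> elts g'"
        using t(4,5) by auto
      obtain x u where xu: "z = pair x u" "x \<in> elts (e i)" "Q (case_nat u (case_nat x e))"
        using g [OF z] by blast
      obtain v where v: "pair x v \<in> elts g'" using g'(2) [OF xu(2)] by blast
      then have Qv: "Q (case_nat v (case_nat x e))" using g'(1) [OF v] by auto
      have "pair x u \<in> X" "pair x v \<in> X" using trsD t(2,3) z xu(1) v by blast+
      then have "u \<in> X" "v \<in> X" "x \<in> X" using pair_XD by blast+
      then have "u = v" using Q(3) [OF envs_cons [OF _ t(1)]] xu(3) Qv by blast
      then show "z \<in> elts g'" using v xu by simp
    qed
    show "w = w'" if "e \<in> envs X" "w \<in> X" "w' \<in> X" "?Q (case_nat w e)" "?Q (case_nat w' e)" for e w w'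
      using sub [OF that] sub [OF that(1,3,2,5,4)] by (intro hset_eqI) blast
  qed
qed

lemma USig_lam:
  assumes F: "USig (\<lambda>e. F (\<lambda>n. e (Suc (Suc n))) (e (Suc 0)) = e 0)"
    and F_X: "\<And>e x. e \<in> envs X \<Longrightarrow> x \<in> X \<Longrightarrow> F e x \<in> X"
  shows "USig (\<lambda>e. lam (e i) (F e) = e j)"
proof -
  have "USig (\<lambda>e. (\<forall>t\<in>elts (e j). \<exists>a b. t = pair a b \<and> a \<in> elts (e i)) \<and>
    (\<forall>y\<in>elts (e i). \<exists>v\<in>X. (pair y v \<in> elts (e j) \<and>
      (\<forall>a b. pair a b \<in> elts (e j) \<longrightarrow> a = y \<longrightarrow> b = v)) \<and> F e y = v))"
    by (intro USig_and USig_ball USig_ex1 USig_Del D_sets F) auto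
  then show ?thesis
  proof (rule USig_cong)
    fix e :: "nat \<Rightarrow> 'a hset" assume e: "e \<in> envs X"
    show "((\<forall>t\<in>elts (e j). \<exists>a b. t = pair a b \<and> a \<in> elts (e i)) \<and>
      (\<forall>y\<in>elts (e i). \<exists>v\<in>X. (pair y v \<in> elts (e j) \<and>
      (\<forall>a b. pair a b \<in> elts (e j) \<longrightarrow> a = y \<longrightarrow> b = v)) \<and> F e y = v)) = (lam (e i) (F e) = e j)"
      (is "?A \<and> ?B \<longleftrightarrow> ?C")
    proof
      assume C: ?C
      have "elts (e j) = (\<lambda>y. pair y (F e y)) ` elts (e i)" unfolding C [symmetric] by (rule elts_lam)
      moreover have "F e y \<in> X" if "y \<in> elts (e i)" for y
        using F_X [OF e trsD [OF envsD [OF e] that]] .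
      ultimately show "?A \<and> ?B" by auto
    next
      assume AB: "?A \<and> ?B"
      have 1: "pair y (F e y) \<in> elts (e j)" if "y \<in> elts (e i)" for y using AB that by blast
      have 2: "\<exists>y\<in>elts (e i). t = pair y (F e y)" if t: "t \<in> elts (e j)" for t
      proof -
        obtain a b where ab: "t = pair a b" "a \<in> elts (e i)" using AB t by blast
        then have "b = F e a" using AB t by blast
        then show ?thesis using ab by blast
      qed
      show ?C by (rule hset_eqI) (use 1 2 in \<open>auto simp: elts_lam\<close>)
    qed
  qed
qed

lemma Sig_lam_graph:
  assumes "Sig (\<lambda>e. F (\<lambda>n. e (Suc (Suc n))) (e 0) = e (Suc 0))"
    and "e \<in> envs X" "a \<in> X" and F_X: "\<And>x. x \<in> elts a \<Longrightarrow> F e x \<in> X"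
  shows "lam a (F e) \<in> X"
proof -
  have inj: "inj (case_nat 1 (case_nat 0 (\<lambda>n. n + 3)))" by (auto simp: inj_def split: nat.splits)
  have "Sig (\<lambda>e. F (\<lambda>n. e (Suc (Suc (Suc n)))) (e (Suc 0)) = e 0)"
    using Sig_ren [OF assms(1) inj] by (simp add: numeral_eq_Suc)
  then have S: "Sig (\<lambda>e. \<exists>v\<in>X. F (\<lambda>n. e (Suc (Suc n))) (e 0) = v \<and> e (Suc 0) = pair (e 0) v)"
    by (intro Sig_ex Sig_and) (assumption | intro Sig_Del D_sets)+
  have "inX {y \<in> X. \<exists>x\<in>elts a. \<exists>v\<in>X. F e x = v \<and> y = pair x v}"
  proof -
    have "\<exists>!y. y \<in> X \<and> (\<exists>v\<in>X. F e x = v \<and> y = pair x v)" if "x \<in> elts a" for x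
      using F_X [OF that] pair_X [OF trsD [OF assms(3) that] F_X [OF that]] by blast
    then show ?thesis using replacement_X [OF S assms(2,3)] by simp
  qed
  moreover have "{y \<in> X. \<exists>x\<in>elts a. \<exists>v\<in>X. F e x = v \<and> y = pair x v} = (\<lambda>y. pair y (F e y)) ` elts a"
    using F_X pair_X trsD [OF assms(3)] by auto
  ultimately show ?thesis unfolding lam_def by (simp add: inX_mk)
qed

section \<open>The recursion theorem inside \<open>L \<alpha>\<close>\<close>

context
  fixes G :: "(nat \<Rightarrow> 'a hset) \<Rightarrow> 'a hset \<Rightarrow> 'a hset"
  assumes G: "USig (\<lambda>e. G (\<lambda>n. e (Suc (Suc n))) (e (Suc 0)) = e 0)"
    and G_X: "\<And>e x. e \<in> envs X \<Longrightarrow> x \<in> X \<Longrightarrow> G e x \<in> X"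
begin

definition restr :: "'a hset \<Rightarrow> 'a hset \<Rightarrow> 'a hset \<Rightarrow> bool" where
  "restr f y r \<longleftrightarrow> (\<forall>t\<in>elts r. t \<in> elts f \<and> (\<exists>a b. t = pair a b \<and> a \<in> elts y)) \<and>
    (\<forall>a b. pair a b \<in> elts f \<longrightarrow> a \<in> elts y \<longrightarrow> pair a b \<in> elts r)"

text \<open>The approximations of the usual proof of the recursion theorem: \<open>f\<close> is a
  function on \<open>x\<close> that obeys the recursion equation at each argument. The value and the
  restriction are both determined by \<open>f\<close> and \<open>y\<close>, as \<open>USig\<close>
  demands.\<close>

definition Rec :: "'a hset \<Rightarrow> 'a hset \<Rightarrow> (nat \<Rightarrow> 'a hset) \<Rightarrow> bool" where
  "Rec x f e \<longleftrightarrow> (\<forall>t\<in>elts f. \<exists>a b. t = pair a b \<and> a \<in> elts x) \<and>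
    (\<forall>y\<in>elts x. \<exists>v\<in>X. (pair y v \<in> elts f \<and> (\<forall>a b. pair a b \<in> elts f \<longrightarrow> a = y \<longrightarrow> b = v)) \<and>
      (\<exists>r\<in>X. restr f y r \<and> G e r = v))"

lemma D_restr: "dc \<Gamma> \<Longrightarrow> Dfn \<Gamma> X (\<lambda>e. restr (e i) (e j) (e k))"
  unfolding restr_def by (intro D_sets)

lemma restr_lam:
  assumes "elts y \<subseteq> elts x"
  shows "restr (lam x F) y r \<longleftrightarrow> r = lam y F"
proof
  assume "restr (lam x F) y r"
  then have r: "\<And>t. t \<in> elts r \<Longrightarrow> t \<in> elts (lam x F) \<and> (\<exists>a b. t = pair a b \<and> a \<in> elts y)"
    "\<And>a b. pair a b \<in> elts (lam x F) \<Longrightarrow> a \<in> elts y \<Longrightarrow> pair a b \<in> elts r"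
    unfolding restr_def by blast+
  have "t \<in> elts (lam y F)" if "t \<in> elts r" for t
    using r(1) [OF that] unfolding elts_lam by auto
  moreover have "t \<in> elts r" if "t \<in> elts (lam y F)" for t
    using r(2) that assms unfolding elts_lam by auto
  ultimately show "r = lam y F" by (intro hset_eqI) blast
next
  assume "r = lam y F"
  moreover have "restr (lam x F) y (lam y F)"
    using assms unfolding restr_def elts_lam by auto
  ultimately show "restr (lam x F) y r" by simp
qed

lemma restr_unique:
  assumes "restr f y r" "restr f y r'"
  shows "r = r'"
proof -
  have "elts r \<subseteq> elts r'" if r: "restr f y r" "restr f y r'" for r r'
  proof
    fix t assume t: "t \<in> elts r"
    then obtain a b where "t = pair a b" "a \<in> elts y" "t \<in> elts f" using r(1) unfolding restr_def by blast
    then show "t \<in> elts r'" using r(2) unfolding restr_def by blast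
  qed
  then show ?thesis using assms by (intro hset_eqI) blast
qed

lemma USig_Rec: "USig (\<lambda>e. Rec (e i) (e j) (\<lambda>n. e (m + n)))"
proof -
  have inj: "inj (case_nat 1 (case_nat 0 (\<lambda>n. m + n + 3)))" by (auto simp: inj_def split: nat.splits)
  have "inj (case_nat 0 (case_nat 1 (\<lambda>n. m + n + 3)))" by (auto simp: inj_def split: nat.splits)
  from USig_ren [OF G inj]
  have "USig (\<lambda>e. G (\<lambda>n. e (Suc (Suc (Suc (m + n))))) (e 0) = e (Suc 0))"
    by (simp add: numeral_eq_Suc)
  then show ?thesis
    unfolding Rec_def
    by (intro USig_and USig_ball USig_ex1) ((assumption | intro USig_Del D_sets D_restr | auto intro: restr_unique)+)
qed

lemma Rec_imp_lam:
  assumes "e \<in> envs X" "Ord x" "Rec x f e"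
  shows "f = lam x (hrec (G e))"
proof -
  let ?F = "hrec (G e)"
  have Rf: "\<And>t. t \<in> elts f \<Longrightarrow> \<exists>a b. t = pair a b \<and> a \<in> elts x"
    and Rx: "\<And>y. y \<in> elts x \<Longrightarrow> \<exists>v r. pair y v \<in> elts f \<and> (\<forall>b. pair y b \<in> elts f \<longrightarrow> b = v) \<and>
      restr f y r \<and> G e r = v"
    using assms(3) unfolding Rec_def by blast+
  have iff: "pair y b \<in> elts f \<longleftrightarrow> b = ?F y" if "y \<in> elts x" for y b
    using that
  proof (induction y arbitrary: b rule: hset_induct)
    case (1 y)
    obtain v r where v: "pair y v \<in> elts f" "\<forall>b. pair y b \<in> elts f \<longrightarrow> b = v" "restr f y r" "G e r = v"
      using Rx [OF 1(2)] by blast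
    have yx: "elts y \<subseteq> elts x" using Ord_elts_subset assms(2) 1(2) by blast
    have "restr f y (lam y ?F)"
      unfolding restr_def elts_lam using 1(1) yx by auto
    then have "v = ?F y" using v(3,4) restr_unique hrec_eq by metis
    then show ?case using v(1,2) by blast
  qed
  have "elts f = elts (lam x ?F)"
  proof
    show "elts f \<subseteq> elts (lam x ?F)"
    proof
      fix t assume t: "t \<in> elts f"
      then obtain a b where ab: "t = pair a b" "a \<in> elts x" using Rf by blast
      then have "b = ?F a" using iff t by blast
      then show "t \<in> elts (lam x ?F)" using ab unfolding elts_lam by blast
    qed
    show "elts (lam x ?F) \<subseteq> elts f" using iff unfolding elts_lam by blast
  qed
  then show ?thesis by (rule hset_eqI)
qed

lemma lam_imp_Rec:
  assumes "e \<in> envs X" "Ord x" "\<And>y. y \<in> elts x \<Longrightarrow> lam y (hrec (G e)) \<in> X"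
  shows "Rec x (lam x (hrec (G e))) e"
proof -
  let ?F = "hrec (G e)"
  have "\<exists>v\<in>X. (pair y v \<in> elts (lam x ?F) \<and> (\<forall>a b. pair a b \<in> elts (lam x ?F) \<longrightarrow> a = y \<longrightarrow> b = v)) \<and>
      (\<exists>r\<in>X. restr (lam x ?F) y r \<and> G e r = v)" if y: "y \<in> elts x" for y
  proof -
    have "restr (lam x ?F) y (lam y ?F)" using restr_lam Ord_elts_subset [OF assms(2) y] by blast
    moreover have "G e (lam y ?F) = ?F y" by (rule hrec_eq [symmetric])
    moreover have "lam y ?F \<in> X" using assms(3) y by blast
    moreover from this have "?F y \<in> X" using hrec_eq G_X [OF assms(1)] by metis
    moreover have "pair y (?F y) \<in> elts (lam x ?F)"
      "\<forall>a b. pair a b \<in> elts (lam x ?F) \<longrightarrow> a = y \<longrightarrow> b = ?F y"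
      using y by (auto simp: elts_lam)
    ultimately show ?thesis by blast
  qed
  then show ?thesis unfolding Rec_def by (auto simp: elts_lam)
qed

text \<open>By induction the approximations for all \<open>y\<close> in \<open>x\<close> are in
  \<open>L \<alpha>\<close>. Thus the value at \<open>y\<close> is the unique one computed by an
  approximation, a Sigma_1 condition, and replacement collects the graph.\<close>

lemma lam_hrec_X: "e \<in> envs X \<Longrightarrow> x \<in> X \<Longrightarrow> Ord x \<Longrightarrow> lam x (hrec (G e)) \<in> X"
proof (induction x rule: hset_induct)
  case (1 x)
  let ?F = "hrec (G e)"
  have lam_X: "lam y ?F \<in> X" if "y \<in> elts x" for y
    using 1 that trsD Ord_mem by blast
  have F_X: "?F y \<in> X" if "y \<in> elts x" for y
    using hrec_eq G_X [OF 1(2) lam_X [OF that]] by metis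
  have eq: "(\<exists>f\<in>X. Rec y f e \<and> G e f = z) \<longleftrightarrow> ?F y = z" if y: "y \<in> elts x" for y z
  proof -
    have Oy: "Ord y" using 1(4) y Ord_mem by blast
    have "Rec y (lam y ?F) e"
      by (rule lam_imp_Rec [OF 1(2) Oy]) (use lam_X Ord_elts_subset [OF 1(4) y] in blast)
    then have "(\<exists>f\<in>X. Rec y f e \<and> G e f = z) \<longleftrightarrow> G e (lam y ?F) = z"
      using Rec_imp_lam [OF 1(2) Oy] lam_X [OF y] by blast
    then show ?thesis using hrec_eq by metis
  qed
  have rep: "inX {z \<in> X. \<exists>y\<in>elts x. \<exists>v\<in>X. \<exists>f\<in>X. Rec y f e \<and> G e f = v \<and> z = pair y v}"
  proof -
    have "USig (\<lambda>e. Rec (e (Suc (Suc 0))) (e 0) (\<lambda>n. e (Suc (Suc (Suc (Suc n))))))"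
      using USig_Rec [of "Suc (Suc 0)" 0 4] by (simp add: numeral_eq_Suc)
    moreover have inj: "inj (case_nat 1 (case_nat 0 (\<lambda>n. n + 4)))" by (auto simp: inj_def split: nat.splits)
    have "USig (\<lambda>e. G (\<lambda>n. e (Suc (Suc (Suc (Suc n))))) (e 0) = e (Suc 0))"
      using USig_ren [OF G inj] by (simp add: numeral_eq_Suc)
    ultimately have "Sig (\<lambda>e. \<exists>v\<in>X. \<exists>f\<in>X. Rec (e 0) f (\<lambda>n. e (Suc (Suc n))) \<and>
        G (\<lambda>n. e (Suc (Suc n))) f = v \<and> e (Suc 0) = pair (e 0) v)"
      by (intro Sig_ex Sig_and) (rule USig_Sig, assumption | intro Sig_Del D_sets)+
    note rp = replacement_X [OF this 1(2,3)]
    have "\<exists>!z. z \<in> X \<and> (\<exists>v\<in>X. \<exists>f\<in>X. Rec y f e \<and> G e f = v \<and> z = pair y v)" if y: "y \<in> elts x" for y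
    proof (rule ex1I [of _ "pair y (?F y)"])
      show "pair y (?F y) \<in> X \<and> (\<exists>v\<in>X. \<exists>f\<in>X. Rec y f e \<and> G e f = v \<and> pair y (?F y) = pair y v)"
        using eq [OF y] F_X [OF y] pair_X [OF trsD [OF 1(3) y] F_X [OF y]] by blast
      show "z = pair y (?F y)" if "z \<in> X \<and> (\<exists>v\<in>X. \<exists>f\<in>X. Rec y f e \<and> G e f = v \<and> z = pair y v)" for z
      proof -
        obtain v f where v: "f \<in> X" "Rec y f e" "G e f = v" "z = pair y v"
          using \<open>z \<in> X \<and> _\<close> by blast
        then have "?F y = v" using eq [OF y, of v] by blast
        then show ?thesis using v by simp
      qed
    qed
    then show ?thesis using rp by simp
  qed
  have "{z \<in> X. \<exists>y\<in>elts x. \<exists>v\<in>X. \<exists>f\<in>X. Rec y f e \<and> G e f = v \<and> z = pair y v} =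
      (\<lambda>y. pair y (?F y)) ` elts x" (is "?L = ?R")
  proof
    show "?L \<subseteq> ?R"
    proof
      fix z assume "z \<in> ?L"
      then obtain y v f where v: "y \<in> elts x" "f \<in> X" "Rec y f e" "G e f = v" "z = pair y v" by blast
      then have "?F y = v" using eq [of y v] by blast
      then show "z \<in> ?R" using v by blast
    qed
    show "?R \<subseteq> ?L"
    proof
      fix z assume "z \<in> ?R"
      then obtain y where y: "y \<in> elts x" "z = pair y (?F y)" by blast
      moreover have "z \<in> X" using y pair_X [OF trsD [OF 1(3)] F_X] by blast
      ultimately show "z \<in> ?L" using eq [OF y(1), of "?F y"] F_X [OF y(1)] by blast
    qed
  qed
  then show ?case using rep unfolding lam_def by (simp add: inX_mk)
qed

lemma hrec_X: "e \<in> envs X \<Longrightarrow> x \<in> X \<Longrightarrow> Ord x \<Longrightarrow> hrec (G e) x \<in> X"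
  using lam_hrec_X G_X hrec_eq by metis

lemma USig_hrec: "USig (\<lambda>e. Ord (e i) \<and> hrec (G e) (e i) = e j)"
proof -
  have "USig (\<lambda>e. Rec (e (Suc i)) (e 0) (\<lambda>n. e (Suc n)))"
    using USig_Rec [of "Suc i" 0 1] by simp
  then have A: "USig (\<lambda>e. Ord (e (Suc i)) \<and> Rec (e (Suc i)) (e 0) (\<lambda>n. e (Suc n)))"
    by (rule USig_and [OF USig_Del [OF D_Ord [OF dc_simps(1)]]])
  \<comment> \<open>The assumption on \<open>G\<close> has its value in variable 0, so the value is
    first named by a new variable and then equated with \<open>e j\<close>.\<close>
  have B: "USig (\<lambda>e. e 0 = e (Suc (Suc j)) \<and> G (\<lambda>n. e (Suc (Suc n))) (e (Suc 0)) = e 0)"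
    by (rule USig_and [OF USig_Del [OF D_eq [OF dc_simps(1)]] G])
  have C: "USig (\<lambda>e. \<exists>v\<in>X. v = e (Suc j) \<and> G (\<lambda>n. e (Suc n)) (e 0) = v)"
    apply (rule USig_ex1)
     apply (rule B)
    apply (elim conjE)
    apply (simp only:)
    done
  have "USig (\<lambda>e. \<exists>f\<in>X. (Ord (e i) \<and> Rec (e i) f e) \<and> (\<exists>v\<in>X. v = e j \<and> G e f = v))"
    apply (rule USig_ex1)
     apply (rule USig_and [OF A C])
    apply (elim conjE)
    apply (rule trans [OF Rec_imp_lam sym [OF Rec_imp_lam]], assumption+)
    done
  then show ?thesis
  proof (rule USig_cong)
    fix e assume e: "e \<in> envs X"
    have ei: "e i \<in> X" "e j \<in> X" using envsD [OF e] by auto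
    show "(\<exists>f\<in>X. (Ord (e i) \<and> Rec (e i) f e) \<and> (\<exists>v\<in>X. v = e j \<and> G e f = v)) =
      (Ord (e i) \<and> hrec (G e) (e i) = e j)"
    proof (cases "Ord (e i)")
      case True
      have "Rec (e i) (lam (e i) (hrec (G e))) e"
        by (rule lam_imp_Rec [OF e True]) (use lam_hrec_X [OF e] trsD [OF ei(1)] Ord_mem [OF True] in blast)
      then have "(\<exists>f\<in>X. Rec (e i) f e \<and> G e f = e j) \<longleftrightarrow> G e (lam (e i) (hrec (G e))) = e j"
        using Rec_imp_lam [OF e True] lam_hrec_X [OF e ei(1) True] by blast
      then show ?thesis using True ei(2) hrec_eq [of "G e" "e i"] by auto
    qed auto
  qed
qed

end

end

section \<open>Closures and finite sets\<close>

inductive_set cl :: "'a hset \<Rightarrow> 'a hset \<Rightarrow> ('a hset \<Rightarrow> 'a hset \<Rightarrow> 'a hset \<Rightarrow> 'a hset) \<Rightarrow> 'a hset set"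
  for b C h where
  base: "x \<in> elts b \<Longrightarrow> x \<in> cl b C h"
| step: "v \<in> elts C \<Longrightarrow> P \<in> cl b C h \<Longrightarrow> Q \<in> cl b C h \<Longrightarrow> h v P Q \<in> cl b C h"

definition stpS :: "'a hset \<Rightarrow> 'a hset \<Rightarrow> ('a hset \<Rightarrow> 'a hset \<Rightarrow> 'a hset \<Rightarrow> 'a hset) \<Rightarrow> 'a hset \<Rightarrow> 'a hset set" where
  "stpS b C h U = elts b \<union> {h v P Q | v P Q. v \<in> elts C \<and> P \<in> elts U \<and> Q \<in> elts U}"

definition stp where "stp b C h U = mk (stpS b C h U)"

definition ranU :: "'a hset \<Rightarrow> 'a hset" where
  "ranU f = mk {P. \<exists>a y. pair a y \<in> elts f \<and> P \<in> elts y}"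

definition clG where "clG b C h f = stp b C h (ranU f)"

text \<open>Recursion up to \<omega> suffices because every member of the closure is reached in
  finitely many steps. The construction serves twice: with \<open>ins\<close> it yields the finite
  subsets of a set, with \<open>hT\<close> the relations defined by formulas.\<close>

definition Cl where "Cl b C h = hrec (clG b C h) omega"

context adm
begin

lemma USig_const:
  assumes "USig (\<lambda>e. P (e 0) (\<lambda>n. e (Suc n)))" "c \<in> X"
  shows "USig (P c)"
  using assms(1)
proof (rule USigE)
  fix Q assume Q: "Dfn Delta0 X Q"
    "\<And>e. e \<in> envs X \<Longrightarrow> P (e 0) (\<lambda>n. e (Suc n)) \<longleftrightarrow> (\<exists>w\<in>X. Q (case_nat w e))"
    "\<And>e w w'. e \<in> envs X \<Longrightarrow> w \<in> X \<Longrightarrow> w' \<in> X \<Longrightarrow> Q (case_nat w e) \<Longrightarrow> Q (case_nat w' e) \<Longrightarrow> w = w'"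
  show ?thesis
  proof (rule USigI)
    have D: "Dfn Delta0 X (\<lambda>e. Q (case_nat (e (Suc 0)) (case_nat (e 0) (\<lambda>n. e (Suc (Suc n))))))"
      by (rule Dfn_sub [OF _ Q(1), of "case_nat 1 (case_nat 0 (\<lambda>n. n + 2))"])
        (auto simp: inj_def fun_eq_iff numeral_eq_Suc split: nat.splits)
    show "Dfn Delta0 X (\<lambda>e. Q (case_nat (e 0) (case_nat c (\<lambda>n. e (Suc n)))))"
      using Dfn_const [where P = "\<lambda>c e. Q (case_nat (e 0) (case_nat c (\<lambda>n. e (Suc n))))", OF D assms(2)] .
    show "P c e \<longleftrightarrow> (\<exists>w\<in>X. Q (case_nat (case_nat w e 0) (case_nat c (\<lambda>n. case_nat w e (Suc n)))))"
      if "e \<in> envs X" for e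
      using Q(2) [OF envs_cons [OF assms(2) that]] by simp
    show "w = w'" if "e \<in> envs X" "w \<in> X" "w' \<in> X"
      "Q (case_nat (case_nat w e 0) (case_nat c (\<lambda>n. case_nat w e (Suc n))))"
      "Q (case_nat (case_nat w' e 0) (case_nat c (\<lambda>n. case_nat w' e (Suc n))))" for e w w'
      using Q(3) [OF envs_cons [OF assms(2) that(1)] that(2,3)] that(4,5) by simp
  qed
qed

lemma Sig_const:
  assumes "Sig (\<lambda>e. P (e 0) (\<lambda>n. e (Suc n)))" "c \<in> X"
  shows "Sig (P c)"
  using assms(1)
proof (rule SigE)
  fix Q assume Q: "Dfn Delta0 X Q"
    "\<And>e. e \<in> envs X \<Longrightarrow> P (e 0) (\<lambda>n. e (Suc n)) \<longleftrightarrow> (\<exists>w\<in>X. Q (case_nat w e))"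
  show ?thesis
  proof (rule SigI)
    have D: "Dfn Delta0 X (\<lambda>e. Q (case_nat (e (Suc 0)) (case_nat (e 0) (\<lambda>n. e (Suc (Suc n))))))"
      by (rule Dfn_sub [OF _ Q(1), of "case_nat 1 (case_nat 0 (\<lambda>n. n + 2))"])
        (auto simp: inj_def fun_eq_iff numeral_eq_Suc split: nat.splits)
    show "Dfn Delta0 X (\<lambda>e. Q (case_nat (e 0) (case_nat c (\<lambda>n. e (Suc n)))))"
      using Dfn_const [where P = "\<lambda>c e. Q (case_nat (e 0) (case_nat c (\<lambda>n. e (Suc n))))", OF D assms(2)] .
    show "P c e \<longleftrightarrow> (\<exists>w\<in>X. Q (case_nat (case_nat w e 0) (case_nat c (\<lambda>n. case_nat w e (Suc n)))))"
      if "e \<in> envs X" for e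
      using Q(2) [OF envs_cons [OF assms(2) that]] by simp
  qed
qed

lemma inXE:
  assumes "inX S" obtains x where "x \<in> X" "elts x = S"
  using inX_mk [OF assms] elts_mk_X [OF assms] by (rule that)

lemma inX_elts: "x \<in> X \<Longrightarrow> inX (elts x)"
  by (simp add: inX_def)

lemma D_Collect:
  assumes "dc \<Gamma>" "Dfn \<Gamma> X (\<lambda>e. P (e 0) (\<lambda>n. e (Suc n)))"
  shows "Dfn \<Gamma> X (\<lambda>e. mk {x \<in> elts (e i). P x e} = e j)"
proof -
  have 1: "Dfn \<Gamma> X (\<lambda>e. \<forall>x\<in>elts (e j). x \<in> elts (e i) \<and> P x e)"
    by (intro D_intros assms)
  have 2: "Dfn \<Gamma> X (\<lambda>e. \<forall>x\<in>elts (e i). P x e \<longrightarrow> x \<in> elts (e j))"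
    by (intro D_intros assms)
  show ?thesis
  proof (rule Dfn_cong [OF Dfn_and [OF assms(1) 1 2]])
    fix e :: "nat \<Rightarrow> 'a hset"
    have "elts (mk {x \<in> elts (e i). P x e}) = {x \<in> elts (e i). P x e}"
      by (rule elts_mk, rule small_subset [OF small_elts [of "e i"]]) auto
    then have "mk {x \<in> elts (e i). P x e} = e j \<longleftrightarrow> {x \<in> elts (e i). P x e} = elts (e j)"
      by (metis elts_inject)
    then show "((\<forall>x\<in>elts (e j). x \<in> elts (e i) \<and> P x e) \<and> (\<forall>x\<in>elts (e i). P x e \<longrightarrow> x \<in> elts (e j))) =
        (mk {x \<in> elts (e i). P x e} = e j)" by blast
  qed
qed

lemma elts_Collect [simp]: "elts (mk {x \<in> elts a. P x}) = {x \<in> elts (a :: 'a hset). P x}"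
  by (rule elts_mk, rule small_subset [OF small_elts [of a]]) auto

definition prod :: "'a hset \<Rightarrow> 'a hset \<Rightarrow> 'a hset" where
  "prod a b = mk {pair x y | x y. x \<in> elts a \<and> y \<in> elts b}"

text \<open>Replacement is applied twice: for each \<open>x\<close> to form the row of its pairs,
  then to collect the rows. The product is the union of the rows.\<close>

lemma inX_prod:
  assumes "a \<in> X" "b \<in> X"
  shows "inX {pair x y | x y. x \<in> elts a \<and> y \<in> elts b}"
proof -
  let ?row = "\<lambda>x. pair x ` elts b"
  have row: "inX (?row x)" if "x \<in> elts a" for x
  proof -
    have "Sig (\<lambda>e. pair (e (Suc (Suc 0))) (e 0) = e (Suc 0))"
      by (intro Sig_Del Dfn_cong [OF D_pair [OF dc_simps(1), of "Suc 0" "Suc (Suc 0)" 0]]) auto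
    from image_X [where F = "\<lambda>e y. pair (e 0) y", OF this, of "case_nat x (\<lambda>_. zer)" b]
    show ?thesis using trsD [OF assms(1) that] assms(2) zer_X pair_X trsD [OF assms(2)]
      by (simp add: envs_def split: nat.splits)
  qed
  have "Dfn Delta0 X (\<lambda>e. (\<forall>t\<in>elts (e (Suc 0)). \<exists>y\<in>elts (e (Suc (Suc 0))). t = pair (e 0) y) \<and>
      (\<forall>y\<in>elts (e (Suc (Suc 0))). \<exists>t\<in>elts (e (Suc 0)). t = pair (e 0) y))"
    by (intro D_sets)
  from replacement_X [OF Sig_Del [OF this], of "case_nat b (\<lambda>_. zer)" a]
  have rep: "(\<And>x. x \<in> elts a \<Longrightarrow> \<exists>!z. z \<in> X \<and> (\<forall>t\<in>elts z. \<exists>y\<in>elts b. t = pair x y) \<and>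
      (\<forall>y\<in>elts b. \<exists>t\<in>elts z. t = pair x y)) \<Longrightarrow>
    inX {z \<in> X. \<exists>x\<in>elts a. (\<forall>t\<in>elts z. \<exists>y\<in>elts b. t = pair x y) \<and>
      (\<forall>y\<in>elts b. \<exists>t\<in>elts z. t = pair x y)}"
    using assms zer_X by (simp add: envs_def split: nat.splits)
  have eq: "((\<forall>t\<in>elts z. \<exists>y\<in>elts b. t = pair x y) \<and> (\<forall>y\<in>elts b. \<exists>t\<in>elts z. t = pair x y)) \<longleftrightarrow>
      elts z = ?row x" for z x by auto
  have "inX {z \<in> X. \<exists>x\<in>elts a. elts z = ?row x}"
  proof -
    have "\<exists>!z. z \<in> X \<and> elts z = ?row x" if x: "x \<in> elts a" for x
    proof -
      obtain z where z: "z \<in> X" "elts z = ?row x" using row [OF x] inX_iff by blast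
      show ?thesis
      proof (rule ex1I [of _ z])
        show "y = z" if "y \<in> X \<and> elts y = ?row x" for y
          by (rule hset_eqI) (use that z(2) in simp)
      qed (use z in blast)
    qed
    then show ?thesis using rep unfolding eq by blast
  qed
  then obtain R where R: "R \<in> X" "elts R = {z \<in> X. \<exists>x\<in>elts a. elts z = ?row x}" by (rule inXE)
  have "elts (hUnion R) = {pair x y | x y. x \<in> elts a \<and> y \<in> elts b}"
  proof
    show "elts (hUnion R) \<subseteq> {pair x y | x y. x \<in> elts a \<and> y \<in> elts b}" using R(2) by auto
    show "{pair x y | x y. x \<in> elts a \<and> y \<in> elts b} \<subseteq> elts (hUnion R)"
    proof
      fix t assume "t \<in> {pair x y | x y. x \<in> elts a \<and> y \<in> elts b}"
      then obtain x y where xy: "x \<in> elts a" "y \<in> elts b" "t = pair x y" by blast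
      obtain z where z: "z \<in> X" "elts z = ?row x" using row [OF xy(1)] inX_iff by blast
      then have "z \<in> elts R" "t \<in> elts z" using R(2) xy by auto
      then show "t \<in> elts (hUnion R)" by auto
    qed
  qed
  then show ?thesis using hUnion_X [OF R(1)] inX_iff by metis
qed

lemma elts_prod_X: "a \<in> X \<Longrightarrow> b \<in> X \<Longrightarrow> elts (prod a b) = {pair x y | x y. x \<in> elts a \<and> y \<in> elts b}"
  and prod_X: "a \<in> X \<Longrightarrow> b \<in> X \<Longrightarrow> prod a b \<in> X"
  unfolding prod_def using inX_prod elts_mk_X inX_mk by blast+

lemma D_prod: "dc \<Gamma> \<Longrightarrow> Dfn \<Gamma> X (\<lambda>e. prod (e i) (e j) = e k)"
proof -
  assume "dc \<Gamma>"
  then have "Dfn \<Gamma> X (\<lambda>e. (\<forall>t\<in>elts (e k). \<exists>x\<in>elts (e i). \<exists>y\<in>elts (e j). t = pair x y) \<and>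
    (\<forall>x\<in>elts (e i). \<forall>y\<in>elts (e j). \<exists>t\<in>elts (e k). t = pair x y))" by (intro D_sets)
  then show ?thesis
  proof (rule Dfn_cong)
    fix e assume e: "e \<in> envs X"
    have "prod (e i) (e j) = e k \<longleftrightarrow> elts (prod (e i) (e j)) = elts (e k)" by (metis elts_inject)
    then show "((\<forall>t\<in>elts (e k). \<exists>x\<in>elts (e i). \<exists>y\<in>elts (e j). t = pair x y) \<and>
      (\<forall>x\<in>elts (e i). \<forall>y\<in>elts (e j). \<exists>t\<in>elts (e k). t = pair x y)) = (prod (e i) (e j) = e k)"
      unfolding elts_prod_X [OF envsD [OF e] envsD [OF e]] by blast
  qed
qed

lemma inX_ranU:
  assumes "f \<in> X" shows "inX {P. \<exists>a y. pair a y \<in> elts f \<and> P \<in> elts y}"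
proof -
  let ?e = "\<lambda>_. f"
  have "Dfn Delta0 X (\<lambda>e. \<exists>a y. pair a y \<in> elts (e (Suc 0)) \<and> e 0 \<in> elts y)" by (intro D_sets)
  from sep_X [where P = "\<lambda>x e. \<exists>a y. pair a y \<in> elts (e 0) \<and> x \<in> elts y", OF this, of ?e "hUnion (hUnion (hUnion f))"]
  have "inX {x \<in> elts (hUnion (hUnion (hUnion f))). \<exists>a y. pair a y \<in> elts f \<and> x \<in> elts y}"
    using assms by (simp add: envs_def hUnion_X)
  moreover have "{x \<in> elts (hUnion (hUnion (hUnion f))). \<exists>a y. pair a y \<in> elts f \<and> x \<in> elts y} =
      {P. \<exists>a y. pair a y \<in> elts f \<and> P \<in> elts y}"
  proof -
    have "x \<in> elts (hUnion (hUnion (hUnion f)))" if "pair a y \<in> elts f" "x \<in> elts y" for a x y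
    proof -
      have "up a y \<in> elts (hUnion f)" using that(1) by (auto simp: pair_def intro!: bexI [of _ "pair a y"])
      then have "y \<in> elts (hUnion (hUnion f))" unfolding elts_hUnion [of "hUnion f"] by (intro UN_I) auto
      then show ?thesis unfolding elts_hUnion [of "hUnion (hUnion f)"] using that(2) by (intro UN_I)
    qed
    then show ?thesis by blast
  qed
  ultimately show ?thesis by simp
qed

lemma elts_ranU_X: "f \<in> X \<Longrightarrow> elts (ranU f) = {P. \<exists>a y. pair a y \<in> elts f \<and> P \<in> elts y}"
  and ranU_X: "f \<in> X \<Longrightarrow> ranU f \<in> X"
  unfolding ranU_def using inX_ranU elts_mk_X inX_mk by blast+

lemma D_ranU: "dc \<Gamma> \<Longrightarrow> Dfn \<Gamma> X (\<lambda>e. ranU (e i) = e j)"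
proof -
  assume "dc \<Gamma>"
  then have "Dfn \<Gamma> X (\<lambda>e. (\<forall>P\<in>elts (e j). \<exists>a y. pair a y \<in> elts (e i) \<and> P \<in> elts y) \<and>
    (\<forall>a y. pair a y \<in> elts (e i) \<longrightarrow> (\<forall>P\<in>elts y. P \<in> elts (e j))))" by (intro D_sets)
  then show ?thesis
  proof (rule Dfn_cong)
    fix e assume e: "e \<in> envs X"
    have "ranU (e i) = e j \<longleftrightarrow> elts (ranU (e i)) = elts (e j)" by (metis elts_inject)
    then show "((\<forall>P\<in>elts (e j). \<exists>a y. pair a y \<in> elts (e i) \<and> P \<in> elts y) \<and>
      (\<forall>a y. pair a y \<in> elts (e i) \<longrightarrow> (\<forall>P\<in>elts y. P \<in> elts (e j)))) = (ranU (e i) = e j)"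
      unfolding elts_ranU_X [OF envsD [OF e]] by blast
  qed
qed

context
  fixes h :: "(nat \<Rightarrow> 'a hset) \<Rightarrow> 'a hset \<Rightarrow> 'a hset \<Rightarrow> 'a hset \<Rightarrow> 'a hset"
  assumes D_h: "Dfn Delta0 X (\<lambda>e. h (\<lambda>n. e (Suc (Suc (Suc (Suc n))))) (e (Suc (Suc (Suc 0)))) (e (Suc (Suc 0))) (e (Suc 0)) = e 0)"
    and h_X: "\<And>e v P Q. e \<in> envs X \<Longrightarrow> v \<in> X \<Longrightarrow> P \<in> X \<Longrightarrow> Q \<in> X \<Longrightarrow> h e v P Q \<in> X"
begin

lemma stpS_inX:
  assumes "e \<in> envs X" "b \<in> X" "C \<in> X" "U \<in> X"
  shows "inX (stpS b C (h e) U)"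
proof -
  have inj: "inj (case_nat 5 (case_nat 0 (case_nat 1 (case_nat 3 (\<lambda>n. n + 6)))))"
    by (auto simp: inj_def split: nat.splits)
  have "Dfn Delta0 X (\<lambda>e. h (\<lambda>n. e (Suc (Suc (Suc (Suc (Suc (Suc n))))))) (e (Suc (Suc (Suc 0)))) (e (Suc 0)) (e 0) = e (Suc (Suc (Suc (Suc (Suc 0))))))"
    using Dfn_ren [OF dc_simps(1) D_h inj] by (simp add: numeral_eq_Suc)
  then have D: "Dfn Delta0 X (\<lambda>e. \<exists>v r. e 0 = pair v r \<and> (\<exists>P Q. r = pair P Q \<and> h (\<lambda>n. e (Suc (Suc n))) v P Q = e (Suc 0)))"
    by (intro D_ex_eq_pair dc_simps)
  let ?D = "prod C (prod U U)"
  have DX: "?D \<in> X" using assms prod_X by simp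
  have elD: "elts ?D = {pair v (pair P Q) | v P Q. v \<in> elts C \<and> P \<in> elts U \<and> Q \<in> elts U}"
    using assms prod_X by (auto simp: elts_prod_X)
  have "\<exists>!y. y \<in> X \<and> (\<exists>v r. x = pair v r \<and> (\<exists>P Q. r = pair P Q \<and> h e v P Q = y))" if x: "x \<in> elts ?D" for x
  proof -
    obtain v P Q where v: "x = pair v (pair P Q)" "v \<in> elts C" "P \<in> elts U" "Q \<in> elts U" using x elD by blast
    then have "h e v P Q \<in> X" using h_X [OF assms(1)] trsD assms by blast
    then show ?thesis using v(1) by (intro ex1I [of _ "h e v P Q"]) auto
  qed
  then have "inX {y \<in> X. \<exists>x\<in>elts ?D. \<exists>v r. x = pair v r \<and> (\<exists>P Q. r = pair P Q \<and> h e v P Q = y)}"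
    using replacement_X [OF Sig_Del [OF D] assms(1) DX] by simp
  moreover have "{y \<in> X. \<exists>x\<in>elts ?D. \<exists>v r. x = pair v r \<and> (\<exists>P Q. r = pair P Q \<and> h e v P Q = y)} =
      {h e v P Q | v P Q. v \<in> elts C \<and> P \<in> elts U \<and> Q \<in> elts U}" (is "?L = ?R")
  proof
    show "?L \<subseteq> ?R"
    proof
      fix y assume "y \<in> ?L"
      then obtain v P Q where "pair v (pair P Q) \<in> elts ?D" "h e v P Q = y" by blast
      moreover from this have "v \<in> elts C \<and> P \<in> elts U \<and> Q \<in> elts U" unfolding elD by auto
      ultimately show "y \<in> ?R" by blast
    qed
    show "?R \<subseteq> ?L"
    proof
      fix y assume "y \<in> ?R"
      then obtain v P Q where v: "y = h e v P Q" "v \<in> elts C" "P \<in> elts U" "Q \<in> elts U" by blast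
      then have "y \<in> X" using h_X [OF assms(1)] trsD assms by blast
      moreover have "pair v (pair P Q) \<in> elts ?D" using v elD by blast
      ultimately show "y \<in> ?L" using v(1) by blast
    qed
  qed
  ultimately obtain S where S: "S \<in> X" "elts S = {h e v P Q | v P Q. v \<in> elts C \<and> P \<in> elts U \<and> Q \<in> elts U}"
    by (simp only:) (rule inXE)
  have "elts (hUnion (up b S)) = stpS b C (h e) U" using S by (auto simp: stpS_def)
  then show ?thesis using hUnion_X [OF up_X [OF assms(2) S(1)]] inX_iff by blast
qed

lemma elts_stp_X: "e \<in> envs X \<Longrightarrow> b \<in> X \<Longrightarrow> C \<in> X \<Longrightarrow> U \<in> X \<Longrightarrow> elts (stp b C (h e) U) = stpS b C (h e) U"
  and stp_X: "e \<in> envs X \<Longrightarrow> b \<in> X \<Longrightarrow> C \<in> X \<Longrightarrow> U \<in> X \<Longrightarrow> stp b C (h e) U \<in> X"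
  unfolding stp_def using stpS_inX elts_mk_X inX_mk by blast+

lemma D_stp: "Dfn Delta0 X (\<lambda>e. stp (e i) (e j) (h e) (e k) = e l)"
proof -
  have inj: "inj (case_nat 3 (case_nat 0 (case_nat 1 (case_nat 2 (\<lambda>n. n + 4)))))"
    by (auto simp: inj_def split: nat.splits)
  have 1: "Dfn Delta0 X (\<lambda>e. h (\<lambda>n. e (Suc (Suc (Suc (Suc n))))) (e (Suc (Suc 0))) (e (Suc 0)) (e 0) = e (Suc (Suc (Suc 0))))"
    using Dfn_ren [OF dc_simps(1) D_h inj] by (simp add: numeral_eq_Suc)
  have "Dfn Delta0 X (\<lambda>e. (\<forall>x\<in>elts (e l). x \<in> elts (e i) \<or> (\<exists>v\<in>elts (e j). \<exists>P\<in>elts (e k). \<exists>Q\<in>elts (e k). h e v P Q = x)) \<and>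
      (\<forall>x\<in>elts (e i). x \<in> elts (e l)) \<and>
      (\<forall>v\<in>elts (e j). \<forall>P\<in>elts (e k). \<forall>Q\<in>elts (e k). \<exists>x\<in>elts (e l). h e v P Q = x))"
    by (intro D_intros 1 D_h)
  then show ?thesis
  proof (rule Dfn_cong)
    fix e assume e: "e \<in> envs X"
    have "stp (e i) (e j) (h e) (e k) = e l \<longleftrightarrow> elts (stp (e i) (e j) (h e) (e k)) = elts (e l)" by (metis elts_inject)
    then show "((\<forall>x\<in>elts (e l). x \<in> elts (e i) \<or> (\<exists>v\<in>elts (e j). \<exists>P\<in>elts (e k). \<exists>Q\<in>elts (e k). h e v P Q = x)) \<and>
      (\<forall>x\<in>elts (e i). x \<in> elts (e l)) \<and>
      (\<forall>v\<in>elts (e j). \<forall>P\<in>elts (e k). \<forall>Q\<in>elts (e k). \<exists>x\<in>elts (e l). h e v P Q = x)) =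
      (stp (e i) (e j) (h e) (e k) = e l)"
      unfolding elts_stp_X [OF e envsD [OF e] envsD [OF e] envsD [OF e]] stpS_def by blast
  qed
qed

end

context
  fixes h :: "(nat \<Rightarrow> 'a hset) \<Rightarrow> 'a hset \<Rightarrow> 'a hset \<Rightarrow> 'a hset \<Rightarrow> 'a hset" and i j :: nat
  assumes D_h: "Dfn Delta0 X (\<lambda>e. h (\<lambda>n. e (Suc (Suc (Suc (Suc n))))) (e (Suc (Suc (Suc 0)))) (e (Suc (Suc 0))) (e (Suc 0)) = e 0)"
    and h_X: "\<And>e v P Q. e \<in> envs X \<Longrightarrow> v \<in> X \<Longrightarrow> P \<in> X \<Longrightarrow> Q \<in> X \<Longrightarrow> h e v P Q \<in> X"
begin

lemma clG_X: "e \<in> envs X \<Longrightarrow> f \<in> X \<Longrightarrow> clG (e i) (e j) (h e) f \<in> X"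
  unfolding clG_def using stp_X [OF D_h h_X] ranU_X envsD by blast

lemma USig_clG: "USig (\<lambda>e. clG (e (Suc (Suc i))) (e (Suc (Suc j))) (h (\<lambda>n. e (Suc (Suc n)))) (e (Suc 0)) = e 0)"
proof -
  let ?h = "\<lambda>e. h (\<lambda>n. e (Suc (Suc (Suc n))))"
  have inj: "inj (case_nat 0 (case_nat 1 (case_nat 2 (case_nat 3 (\<lambda>n. n + 7)))))"
    by (auto simp: inj_def split: nat.splits)
  have D_h': "Dfn Delta0 X (\<lambda>e. h (\<lambda>n. e (Suc (Suc (Suc (Suc (Suc (Suc (Suc n)))))))) (e (Suc (Suc (Suc 0)))) (e (Suc (Suc 0))) (e (Suc 0)) = e 0)"
    using Dfn_ren [OF dc_simps(1) D_h inj] by (simp add: numeral_eq_Suc)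
  have 1: "Dfn Delta0 X (\<lambda>e. stp (e (Suc (Suc (Suc i)))) (e (Suc (Suc (Suc j)))) (h (\<lambda>n. e (Suc (Suc (Suc n))))) (e 0) = e (Suc 0))"
    by (rule D_stp [of ?h]) (rule D_h', rule h_X [OF envs_comp])
  show ?thesis
    unfolding clG_def
  proof (rule USig_let [where g = "\<lambda>e. ranU (e (Suc 0))" and
        P = "\<lambda>U e. stp (e (Suc (Suc i))) (e (Suc (Suc j))) (h (\<lambda>n. e (Suc (Suc n)))) U = e 0"])
    show "USig (\<lambda>e. ranU (e (Suc (Suc 0))) = e 0)" by (intro USig_Del D_ranU dc_simps)
    show "USig (\<lambda>e. stp (e (Suc (Suc (Suc i)))) (e (Suc (Suc (Suc j)))) (h (\<lambda>n. e (Suc (Suc (Suc n))))) (e 0) = e (Suc 0))"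
      by (intro USig_Del 1)
  qed (use ranU_X envsD in blast)
qed

lemma Cl_X: "e \<in> envs X \<Longrightarrow> Cl (e i) (e j) (h e) \<in> X"
  unfolding Cl_def
  using hrec_X [of "\<lambda>e. clG (e i) (e j) (h e)", OF USig_clG clG_X _ omega_X Ord_omega] by blast

lemma elts_clG_lam:
  assumes e: "e \<in> envs X" and "x \<in> X" "Ord x"
  shows "elts (hrec (clG (e i) (e j) (h e)) x) =
    elts (e i) \<union> {h e v P Q | v P Q. v \<in> elts (e j) \<and> (\<exists>y\<in>elts x. P \<in> elts (hrec (clG (e i) (e j) (h e)) y)) \<and>
      (\<exists>y\<in>elts x. Q \<in> elts (hrec (clG (e i) (e j) (h e)) y))}"
proof -
  let ?F = "hrec (clG (e i) (e j) (h e))"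
  have lX: "lam x ?F \<in> X"
    using lam_hrec_X [of "\<lambda>e. clG (e i) (e j) (h e)", OF USig_clG clG_X e] assms by blast
  have "elts (ranU (lam x ?F)) = {P. \<exists>y\<in>elts x. P \<in> elts (?F y)}"
    unfolding elts_ranU_X [OF lX] elts_lam by auto
  moreover have "elts (?F x) = stpS (e i) (e j) (h e) (ranU (lam x ?F))"
    unfolding hrec_eq [of _ x] clG_def [of _ _ _ "lam x ?F"]
    by (rule elts_stp_X [OF D_h h_X e envsD [OF e] envsD [OF e] ranU_X [OF lX]])
  ultimately show ?thesis unfolding stpS_def by simp
qed

lemma elts_Cl:
  assumes e: "e \<in> envs X"
  shows "elts (Cl (e i) (e j) (h e)) = cl (e i) (e j) (h e)"
proof -
  let ?F = "hrec (clG (e i) (e j) (h e))"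
  have sub: "x \<in> X \<Longrightarrow> Ord x \<Longrightarrow> elts (?F x) \<subseteq> cl (e i) (e j) (h e)" for x
  proof (induction x rule: hset_induct)
    case (1 x)
    have "elts (?F y) \<subseteq> cl (e i) (e j) (h e)" if "y \<in> elts x" for y
      using 1 that trsD Ord_mem by blast
    then show ?case
      unfolding elts_clG_lam [OF e 1(2,3)] by (auto intro: cl.intros)
  qed
  have n: "elts (?F (ordn n)) = elts (e i) \<union> {h e v P Q | v P Q. v \<in> elts (e j) \<and>
      (\<exists>m<n. P \<in> elts (?F (ordn m))) \<and> (\<exists>m<n. Q \<in> elts (?F (ordn m)))}" for n
    unfolding elts_clG_lam [OF e ordn_X [of n] Ord_ordn [of n]] elts_ordn by (simp add: Bex_def)
  have mono: "elts (?F (ordn m)) \<subseteq> elts (?F (ordn n))" if "m \<le> n" for m n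
    unfolding n [of m] n [of n] using order_less_le_trans [OF _ that] by blast
  have ex: "\<exists>n. x \<in> elts (?F (ordn n))" if "x \<in> cl (e i) (e j) (h e)" for x
    using that
  proof induction
    case (base x)
    then show ?case using n by blast
  next
    case (step v P Q)
    then obtain k m where "P \<in> elts (?F (ordn k))" "Q \<in> elts (?F (ordn m))" by blast
    then have "P \<in> elts (?F (ordn (max k m)))" "Q \<in> elts (?F (ordn (max k m)))"
      using mono [of k "max k m"] mono [of m "max k m"] by auto
    then have "h e v P Q \<in> elts (?F (ordn (Suc (max k m))))"
      unfolding n [of "Suc (max k m)"] using step(1) by blast
    then show ?case by blast
  qed
  show ?thesis
    unfolding Cl_def
  proof
    show "elts (?F omega) \<subseteq> cl (e i) (e j) (h e)" using sub omega_X Ord_omega by blast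
    have om: "elts (?F omega) = elts (e i) \<union> {h e v P Q | v P Q. v \<in> elts (e j) \<and>
      (\<exists>m. P \<in> elts (?F (ordn m))) \<and> (\<exists>m. Q \<in> elts (?F (ordn m)))}"
      unfolding elts_clG_lam [OF e omega_X Ord_omega] elts_omega by simp
    show "cl (e i) (e j) (h e) \<subseteq> elts (?F omega)"
    proof
      fix x assume "x \<in> cl (e i) (e j) (h e)"
      then obtain k where "x \<in> elts (?F (ordn k))" using ex by blast
      then show "x \<in> elts (?F omega)" unfolding n [of k] om by blast
    qed
  qed
qed

lemma USig_Cl: "USig (\<lambda>e. Cl (e i) (e j) (h e) = e l)"
proof -
  have inj: "inj (case_nat 0 (case_nat 1 (\<lambda>n. n + 3)))"
    by (auto simp: inj_def split: nat.splits)
  have "USig (\<lambda>e. clG (e (Suc (Suc (Suc i)))) (e (Suc (Suc (Suc j)))) (h (\<lambda>n. e (Suc (Suc (Suc n))))) (e (Suc 0)) = e 0)"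
    using USig_ren [OF USig_clG inj] by (simp add: numeral_eq_Suc)
  note cG = this
  have "USig (\<lambda>e. Ord (e 0) \<and> hrec (clG (e (Suc i)) (e (Suc j)) (h (\<lambda>n. e (Suc n)))) (e 0) = e (Suc l))"
    by (rule USig_hrec [of "\<lambda>e. clG (e (Suc i)) (e (Suc j)) (h (\<lambda>n. e (Suc n)))"])
      (rule cG, rule clG_X [OF envs_comp [where f = Suc]])
  from USig_const [where P = "\<lambda>c e. Ord c \<and> hrec (clG (e i) (e j) (h e)) c = e l", OF this omega_X]
  show ?thesis unfolding Cl_def by (rule USig_cong) (simp add: Ord_omega)
qed

end

declare ordn.simps(2) [simp del]

section \<open>The hierarchy is definable\<close>

text \<open>For codes of finite assignments this says that \<open>s\<close> is
  \<open>t(i \<mapsto> a)\<close> for some \<open>a\<close>. The conjunct \<open>b = b\<close>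
  brings the clause into the shape of \<open>D_ex_pair_mem1\<close>.\<close>

definition agr :: "'a hset \<Rightarrow> 'a hset \<Rightarrow> 'a hset \<Rightarrow> bool" where
  "agr s t i \<longleftrightarrow> (\<exists>b. pair i b \<in> elts s \<and> b = b) \<and> (\<forall>z\<in>elts s. z \<in> elts t \<or> (\<exists>a b. z = pair a b \<and> a = i)) \<and>
    (\<forall>z\<in>elts t. z \<in> elts s \<or> (\<exists>a b. z = pair a b \<and> a = i))"

definition isone :: "'a hset \<Rightarrow> bool" where
  "isone k \<longleftrightarrow> (\<exists>z\<in>elts k. z = zer) \<and> (\<forall>z\<in>elts k. z = zer)"

text \<open>
  Formulas over \<open>A\<close> are represented by sets of finite partial assignments. The index \<open>(i, j, k)\<close>
  selects an operation: membership, equality, or the combination of negation, conjunction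
  and quantification that maps \<open>P\<close>, \<open>Q\<close> to \<open>\<not> (P \<and> (\<exists>x\<^sub>i. Q))\<close>.
\<close>

definition hC :: "'a hset \<Rightarrow> 'a hset \<Rightarrow> 'a hset \<Rightarrow> 'a hset \<Rightarrow> bool" where
  "hC v P Q t \<longleftrightarrow> (\<exists>i r. v = pair i r \<and> (\<exists>j k. r = pair j k \<and>
    (k = zer \<and> (\<exists>a. pair i a \<in> elts t \<and> (\<exists>b. pair j b \<in> elts t \<and> a \<in> elts b)) \<or>
     isone k \<and> (\<exists>a. pair i a \<in> elts t \<and> (\<exists>b. pair j b \<in> elts t \<and> a = b)) \<or>
     k \<noteq> zer \<and> \<not> isone k \<and> \<not> (t \<in> elts P \<and> (\<exists>s\<in>elts Q. agr s t i)))))"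

definition hT :: "'a hset \<Rightarrow> 'a hset \<Rightarrow> 'a hset \<Rightarrow> 'a hset \<Rightarrow> 'a hset" where
  "hT E v P Q = mk {t \<in> elts E. hC v P Q t}"

definition func :: "'a hset \<Rightarrow> bool" where
  "func t \<longleftrightarrow> (\<forall>a b. pair a b \<in> elts t \<longrightarrow> (\<forall>c d. pair c d \<in> elts t \<longrightarrow> a = c \<longrightarrow> b = d))"

definition ins :: "'a hset \<Rightarrow> 'a hset \<Rightarrow> 'a hset \<Rightarrow> 'a hset" where
  "ins v P Q = hinsert v P"

text \<open>The subset of \<open>A\<close> that the relation \<open>R\<close> defines from the
  parameters in the assignment \<open>t\<close>. Variable \<open>z\<close> is reserved for the
  argument, so \<open>t\<close> must leave it undefined. The list of arguments is the one that
  \<open>stp\<close> expects of an operation.\<close>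

definition SA :: "'a hset \<Rightarrow> 'a hset \<Rightarrow> 'a hset \<Rightarrow> 'a hset \<Rightarrow> 'a hset \<Rightarrow> 'a hset" where
  "SA z A t R Q = mk {a \<in> elts A. \<not> (\<exists>b. pair z b \<in> elts t \<and> b = b) \<and>
    (\<exists>s\<in>elts R. \<exists>p\<in>elts s. p = pair z a \<and> s = hinsert p t)}"

lemma D_agr: "dc \<Gamma> \<Longrightarrow> Dfn \<Gamma> X (\<lambda>e. agr (e i) (e j) (e k))"
  unfolding agr_def by (intro D_sets)

lemma D_isone: "dc \<Gamma> \<Longrightarrow> Dfn \<Gamma> X (\<lambda>e. isone (e i))"
  unfolding isone_def by (intro D_sets)

lemma D_func: "dc \<Gamma> \<Longrightarrow> Dfn \<Gamma> X (\<lambda>e. func (e i))"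
  unfolding func_def by (intro D_sets)

lemma D_hC: "dc \<Gamma> \<Longrightarrow> Dfn \<Gamma> X (\<lambda>e. hC (e i) (e j) (e k) (e l))"
  unfolding hC_def by (intro D_sets D_agr D_isone)

lemma D_hT: "dc \<Gamma> \<Longrightarrow> Dfn \<Gamma> X (\<lambda>e. hT (e m) (e i) (e j) (e k) = e l)"
  unfolding hT_def by (intro D_Collect D_hC)

lemma D_ins: "dc \<Gamma> \<Longrightarrow> Dfn \<Gamma> X (\<lambda>e. ins (e i) (e j) (e k) = e l)"
proof -
  assume "dc \<Gamma>"
  then have "Dfn \<Gamma> X (\<lambda>e. e l = hinsert (e i) (e j))" by (rule D_insert)
  then show ?thesis unfolding ins_def by (rule Dfn_cong) auto
qed

lemma D_SA: "dc \<Gamma> \<Longrightarrow> Dfn \<Gamma> X (\<lambda>e. SA (e z) (e A) (e t) (e R) (e q) = e l)"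
  unfolding SA_def by (intro D_Collect D_sets)

lemma ins_X: "v \<in> X \<Longrightarrow> P \<in> X \<Longrightarrow> ins v P Q \<in> X"
  unfolding ins_def by (rule hinsert_X)

lemma hT_X: "E \<in> X \<Longrightarrow> v \<in> X \<Longrightarrow> P \<in> X \<Longrightarrow> Q \<in> X \<Longrightarrow> hT E v P Q \<in> X"
proof -
  assume X: "E \<in> X" "v \<in> X" "P \<in> X" "Q \<in> X"
  have "Dfn Delta0 X (\<lambda>e. hC (e (Suc 0)) (e (Suc (Suc 0))) (e (Suc (Suc (Suc 0)))) (e 0))"
    by (intro D_hC dc_simps)
  from sep_X [where P = "\<lambda>x e. hC (e 0) (e (Suc 0)) (e (Suc (Suc 0))) x", OF this,
      of "case_nat v (case_nat P (case_nat Q (\<lambda>_. zer)))" E]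
  show ?thesis unfolding hT_def using X zer_X by (simp add: envs_def inX_mk split: nat.splits)
qed

lemma SA_X: "z \<in> X \<Longrightarrow> A \<in> X \<Longrightarrow> t \<in> X \<Longrightarrow> R \<in> X \<Longrightarrow> SA z A t R Q \<in> X"
proof -
  assume X: "z \<in> X" "A \<in> X" "t \<in> X" "R \<in> X"
  have "Dfn Delta0 X (\<lambda>e. \<not> (\<exists>b. pair (e (Suc 0)) b \<in> elts (e (Suc (Suc 0))) \<and> b = b) \<and>
    (\<exists>s\<in>elts (e (Suc (Suc (Suc 0)))). \<exists>p\<in>elts s. p = pair (e (Suc 0)) (e 0) \<and> s = hinsert p (e (Suc (Suc 0)))))"
    by (intro D_sets)
  from sep_X [where P = "\<lambda>a e. \<not> (\<exists>b. pair (e 0) b \<in> elts (e (Suc 0)) \<and> b = b) \<and>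
    (\<exists>s\<in>elts (e (Suc (Suc 0))). \<exists>p\<in>elts s. p = pair (e 0) a \<and> s = hinsert p (e (Suc 0)))", OF this,
      of "case_nat z (case_nat t (case_nat R (\<lambda>_. zer)))" A]
  show ?thesis unfolding SA_def using X zer_X by (simp add: envs_def inX_mk split: nat.splits)
qed

text \<open>\<open>b\<close>, \<open>w\<close> and \<open>z\<close> stand for \<open>one\<close>,
  \<open>omega\<close> and \<open>zer\<close>; they stay variables until \<open>USig_const\<close>
  turns them into parameters. The only element of \<open>one\<close> is the empty set, which starts
  both closures: as a finite set in \<open>fF\<close>, as the empty relation in \<open>fT\<close>.
  \<open>fE\<close> keeps the finite sets that are assignments, and \<open>DefO\<close> is the
  definable power set of \<open>A\<close>.\<close>

definition fF where "fF b w A = Cl b (prod w A) ins"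
definition fE where "fE b w A = mk {t \<in> elts (fF b w A). func t}"
definition fT where "fT b w A = Cl b (prod w (prod w w)) (hT (fE b w A))"
definition DefO where "DefO b w z A = stp z (fE b w A) (SA z A) (fT b w A)"

lemma Cl_ins_X: "b \<in> X \<Longrightarrow> C \<in> X \<Longrightarrow> Cl b C ins \<in> X"
  using Cl_X [of "\<lambda>e. ins", OF D_ins [OF dc_simps(1)] ins_X, of "case_nat b (\<lambda>_. C)" 0 1]
  by (simp add: envs_def split: nat.splits)

lemma Cl_hT_X: "b \<in> X \<Longrightarrow> C \<in> X \<Longrightarrow> E \<in> X \<Longrightarrow> Cl b C (hT E) \<in> X"
  using Cl_X [of "\<lambda>e. hT (e 2)", OF D_hT [OF dc_simps(1)] hT_X, of "case_nat b (case_nat C (\<lambda>_. E))" 0 1]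
  by (simp add: envs_def numeral_eq_Suc split: nat.splits)

lemma elts_Cl_ins: "b \<in> X \<Longrightarrow> C \<in> X \<Longrightarrow> elts (Cl b C ins) = cl b C ins"
  using elts_Cl [of "\<lambda>e. ins", OF D_ins [OF dc_simps(1)] ins_X, of "case_nat b (\<lambda>_. C)" 0 1]
  by (simp add: envs_def split: nat.splits)

lemma elts_Cl_hT: "b \<in> X \<Longrightarrow> C \<in> X \<Longrightarrow> E \<in> X \<Longrightarrow> elts (Cl b C (hT E)) = cl b C (hT E)"
  using elts_Cl [of "\<lambda>e. hT (e 2)", OF D_hT [OF dc_simps(1)] hT_X, of "case_nat b (case_nat C (\<lambda>_. E))" 0 1]
  by (simp add: envs_def numeral_eq_Suc split: nat.splits)

lemma fF_X: "o' \<in> X \<Longrightarrow> w \<in> X \<Longrightarrow> A \<in> X \<Longrightarrow> fF o' w A \<in> X"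
  unfolding fF_def by (intro Cl_ins_X prod_X)

lemma fE_X: "o' \<in> X \<Longrightarrow> w \<in> X \<Longrightarrow> A \<in> X \<Longrightarrow> fE o' w A \<in> X"
proof -
  assume X: "o' \<in> X" "w \<in> X" "A \<in> X"
  have "Dfn Delta0 X (\<lambda>e. func (e 0))" by (intro D_func dc_simps)
  from sep_X [where P = "\<lambda>x e. func x", OF this, of "\<lambda>_. zer" "fF o' w A"]
  show ?thesis unfolding fE_def using fF_X [OF X] zer_X by (simp add: envs_def inX_mk)
qed

lemma fT_X: "o' \<in> X \<Longrightarrow> w \<in> X \<Longrightarrow> A \<in> X \<Longrightarrow> fT o' w A \<in> X"
  unfolding fT_def by (intro Cl_hT_X prod_X fE_X)

lemma elts_DefO: "o' \<in> X \<Longrightarrow> w \<in> X \<Longrightarrow> z \<in> X \<Longrightarrow> A \<in> X \<Longrightarrow>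
    elts (DefO o' w z A) = stpS z (fE o' w A) (SA z A) (fT o' w A)"
  unfolding DefO_def
  using elts_stp_X [of "\<lambda>e. SA (e 0) (e 1)", OF D_SA [OF dc_simps(1)] SA_X, of "case_nat z (\<lambda>_. A)" z "fE o' w A" "fT o' w A"]
  by (simp add: envs_def fE_X fT_X split: nat.splits)

lemma DefO_X: "o' \<in> X \<Longrightarrow> w \<in> X \<Longrightarrow> z \<in> X \<Longrightarrow> A \<in> X \<Longrightarrow> DefO o' w z A \<in> X"
  unfolding DefO_def
  using stp_X [of "\<lambda>e. SA (e 0) (e 1)", OF D_SA [OF dc_simps(1)] SA_X, of "case_nat z (\<lambda>_. A)" z "fE o' w A" "fT o' w A"]
  by (simp add: envs_def fE_X fT_X split: nat.splits)

lemma USig_fF: "USig (\<lambda>e. fF (e i) (e j) (e k) = e l)"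
  unfolding fF_def
proof (rule USig_let [where g = "\<lambda>e. prod (e j) (e k)" and P = "\<lambda>B e. Cl (e i) B ins = e l"])
  show "USig (\<lambda>e. Cl (e (Suc i)) (e 0) ins = e (Suc l))"
    by (rule USig_Cl [of "\<lambda>e. ins"]) (rule D_ins [OF dc_simps(1)], rule ins_X)
qed (intro USig_Del D_prod dc_simps, intro prod_X envsD)

lemma USig_fE: "USig (\<lambda>e. fE (e i) (e j) (e k) = e l)"
  unfolding fE_def
proof (rule USig_let [where g = "\<lambda>e. fF (e i) (e j) (e k)" and P = "\<lambda>F e. mk {t \<in> elts F. func t} = e l"])
  show "USig (\<lambda>e. mk {t \<in> elts (e 0). func t} = e (Suc l))"
    by (intro USig_Del D_Collect D_func dc_simps)
qed (rule USig_fF, intro fF_X envsD)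

lemma USig_fT: "USig (\<lambda>e. fT (e i) (e j) (e k) = e l)"
  unfolding fT_def
proof (rule USig_let [where g = "\<lambda>e. fE (e i) (e j) (e k)" and P = "\<lambda>E e. Cl (e i) (prod (e j) (prod (e j) (e j))) (hT E) = e l"])
  show "USig (\<lambda>e. Cl (e (Suc i)) (prod (e (Suc j)) (prod (e (Suc j)) (e (Suc j)))) (hT (e 0)) = e (Suc l))"
  proof (rule USig_let [where g = "\<lambda>e. prod (e (Suc j)) (e (Suc j))" and P = "\<lambda>W e. Cl (e (Suc i)) (prod (e (Suc j)) W) (hT (e 0)) = e (Suc l)"])
    show "USig (\<lambda>e. Cl (e (Suc (Suc i))) (prod (e (Suc (Suc j))) (e 0)) (hT (e (Suc 0))) = e (Suc (Suc l)))"
    proof (rule USig_let [where g = "\<lambda>e. prod (e (Suc (Suc j))) (e 0)" and P = "\<lambda>C e. Cl (e (Suc (Suc i))) C (hT (e (Suc 0))) = e (Suc (Suc l))"])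
      show "USig (\<lambda>e. Cl (e (Suc (Suc (Suc i)))) (e 0) (hT (e (Suc (Suc 0)))) = e (Suc (Suc (Suc l))))"
        by (rule USig_Cl [of "\<lambda>e. hT (e (Suc (Suc 0)))"]) (rule D_hT [OF dc_simps(1)], rule hT_X [OF envsD])
    qed (intro USig_Del D_prod dc_simps, intro prod_X envsD)
  qed (intro USig_Del D_prod dc_simps, intro prod_X envsD)
qed (rule USig_fE, intro fE_X envsD)

lemma USig_DefO: "USig (\<lambda>e. DefO (e i) (e j) (e m) (e k) = e l)"
  unfolding DefO_def
proof (rule USig_let [where g = "\<lambda>e. fE (e i) (e j) (e k)" and P = "\<lambda>E e. stp (e m) E (SA (e m) (e k)) (fT (e i) (e j) (e k)) = e l"])
  show "USig (\<lambda>e. stp (e (Suc m)) (e 0) (SA (e (Suc m)) (e (Suc k))) (fT (e (Suc i)) (e (Suc j)) (e (Suc k))) = e (Suc l))"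
  proof (rule USig_let [where g = "\<lambda>e. fT (e (Suc i)) (e (Suc j)) (e (Suc k))" and
        P = "\<lambda>T e. stp (e (Suc m)) (e 0) (SA (e (Suc m)) (e (Suc k))) T = e (Suc l)"])
    have "Dfn Delta0 X (\<lambda>e. stp (e (Suc (Suc m))) (e (Suc 0)) (SA (e (Suc (Suc m))) (e (Suc (Suc k)))) (e 0) = e (Suc (Suc l)))"
      by (rule D_stp [of "\<lambda>e. SA (e (Suc (Suc m))) (e (Suc (Suc k)))"])
        (rule D_SA [OF dc_simps(1)], rule SA_X [OF envsD envsD])
    then show "USig (\<lambda>e. stp (e (Suc (Suc m))) (e (Suc 0)) (SA (e (Suc (Suc m))) (e (Suc (Suc k)))) (e 0) = e (Suc (Suc l)))"
      by (rule USig_Del)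
  qed (rule USig_fT, intro fT_X envsD)
qed (rule USig_fE, intro fE_X envsD)

subsection \<open>Correctness\<close>

abbreviation one :: "'a hset" where "one \<equiv> ordn (Suc 0)"

lemma elts_one [simp]: "elts (ordn (Suc 0) :: 'a hset) = {zer}"
  by (simp add: ordn.simps(2))

lemma isone_iff: "isone k \<longleftrightarrow> k = ordn (Suc 0)"
proof -
  have "k = ordn (Suc 0) \<longleftrightarrow> elts k = {zer}" by (metis elts_inject elts_one)
  then show ?thesis unfolding isone_def by auto
qed

definition enc :: "(nat \<Rightarrow> 'a hset option) \<Rightarrow> 'a hset" where
  "enc m = mk {pair (ordn i) a | i a. m i = Some a}"

lemma elts_enc: "finite (dom m) \<Longrightarrow> elts (enc m) = {pair (ordn i) a | i a. m i = Some a}"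
  unfolding enc_def
proof (rule elts_mk, rule small_finite)
  assume "finite (dom m)"
  then have "finite ((\<lambda>i. pair (ordn i) (the (m i))) ` dom m)" by simp
  moreover have "{pair (ordn i) a | i a. m i = Some a} \<subseteq> (\<lambda>i. pair (ordn i) (the (m i))) ` dom m" by force
  ultimately show "finite {pair (ordn i) a | i a. m i = Some a}" by (rule rev_finite_subset)
qed

lemma pair_enc: "finite (dom m) \<Longrightarrow> pair (ordn i) a \<in> elts (enc m) \<longleftrightarrow> m i = Some a"
  by (auto simp: elts_enc ordn_inj)

lemma pair_encD: "finite (dom m) \<Longrightarrow> z \<in> elts (enc m) \<Longrightarrow> \<exists>i a. z = pair (ordn i) a \<and> m i = Some a"
  by (auto simp: elts_enc)

lemma enc_inj: "finite (dom m) \<Longrightarrow> finite (dom m') \<Longrightarrow> enc m = enc m' \<Longrightarrow> m = m'"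
proof
  fix i assume *: "finite (dom m)" "finite (dom m')" "enc m = enc m'"
  have "m i = Some a \<longleftrightarrow> m' i = Some a" for a using pair_enc [OF *(1)] pair_enc [OF *(2)] *(3) by metis
  then show "m i = m' i" by (metis not_None_eq)
qed

lemma elts_Fin:
  assumes "B \<in> X"
  shows "elts (Cl one B ins) = {x. finite (elts x) \<and> elts x \<subseteq> elts B}"
  unfolding elts_Cl_ins [OF ordn_X assms]
proof (intro set_eqI iffI)
  fix x assume "x \<in> cl one B ins"
  then show "x \<in> {x. finite (elts x) \<and> elts x \<subseteq> elts B}"
    by induction (auto simp: ins_def)
next
  fix x assume x: "x \<in> {x. finite (elts x) \<and> elts x \<subseteq> elts B}"
  have z: "zer \<in> cl one B ins" by (rule cl.base) simp
  have "mk S \<in> cl one B ins" if "finite S" "S \<subseteq> elts B" for S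
    using that
  proof (induction rule: finite_induct)
    case empty
    then show ?case using z by (simp add: zer_def)
  next
    case (insert v S)
    have "mk (insert v S) = ins v (mk S) zer"
      unfolding ins_def hinsert_def using elts_mk [OF small_finite [OF insert(1)]] by simp
    then show ?case using cl.step [OF _ _ z] insert by simp
  qed
  from this [of "elts x"] show "x \<in> cl one B ins" using x by simp
qed

lemma elts_fE:
  assumes "A \<in> X"
  shows "elts (fE one omega A) = {enc m | m. finite (dom m) \<and> ran m \<subseteq> elts A}"
proof -
  have F: "elts (fE one omega A) = {t. finite (elts t) \<and> elts t \<subseteq> elts (prod omega A) \<and> func t}"
  proof -
    have "elts (fE one omega A) = {t \<in> elts (Cl one (prod omega A) ins). func t}"
      unfolding fE_def fF_def by (rule elts_Collect)
    then show ?thesis unfolding elts_Fin [OF prod_X [OF omega_X assms]] by auto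
  qed
  show ?thesis
  proof (intro set_eqI iffI)
    fix t assume "t \<in> elts (fE one omega A)"
    then have t: "finite (elts t)" "elts t \<subseteq> elts (prod omega A)" "func t" unfolding F by auto
    define m where "m i = (if \<exists>a. pair (ordn i) a \<in> elts t then Some (SOME a. pair (ordn i) a \<in> elts t) else None)" for i
    have m: "m i = Some a \<longleftrightarrow> pair (ordn i) a \<in> elts t" for i a
    proof
      assume "m i = Some a"
      then show "pair (ordn i) a \<in> elts t"
        unfolding m_def by (auto split: if_splits intro: someI)
    next
      assume a: "pair (ordn i) a \<in> elts t"
      then have "pair (ordn i) (SOME a. pair (ordn i) a \<in> elts t) \<in> elts t" by (rule someI)
      then show "m i = Some a" using a t(3) unfolding m_def func_def by auto
    qed
    have te: "elts t = {pair (ordn i) a | i a. m i = Some a}"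
      using t(2) unfolding m elts_prod_X [OF omega_X assms] elts_omega by blast
    have fin: "finite (dom m)"
    proof -
      have "(\<lambda>i. pair (ordn i) (the (m i))) ` dom m \<subseteq> elts t" using te by auto
      then have "finite ((\<lambda>i. pair (ordn i) (the (m i))) ` dom m)" using t(1) finite_subset by blast
      moreover have "inj_on (\<lambda>i. pair (ordn i) (the (m i))) (dom m)" by (auto simp: inj_on_def ordn_inj)
      ultimately show ?thesis using finite_imageD by blast
    qed
    have "ran m \<subseteq> elts A"
      using t(2) m unfolding ran_def elts_prod_X [OF omega_X assms] by auto
    moreover have "t = enc m" by (rule hset_eqI) (simp only: te elts_enc [OF fin])
    ultimately show "t \<in> {enc m | m. finite (dom m) \<and> ran m \<subseteq> elts A}" using fin by blast
  next
    fix t assume "t \<in> {enc m | m. finite (dom m) \<and> ran m \<subseteq> elts A}"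
    then obtain m where m: "t = enc m" "finite (dom m)" "ran m \<subseteq> elts A" by blast
    have "elts t \<subseteq> (\<lambda>i. pair (ordn i) (the (m i))) ` dom m"
      unfolding m(1) elts_enc [OF m(2)] by force
    then have "finite (elts t)" using m(2) finite_subset by blast
    moreover have "elts t \<subseteq> elts (prod omega A)"
      unfolding m(1) elts_enc [OF m(2)] elts_prod_X [OF omega_X assms] elts_omega
      using m(3) ranI [of m] by blast
    moreover have "func t"
      unfolding func_def m(1) elts_enc [OF m(2)] by (auto simp: ordn_inj)
    ultimately show "t \<in> elts (fE one omega A)" unfolding F by blast
  qed
qed

lemma agr_enc:
  assumes "finite (dom m)" "finite (dom m')"
  shows "agr (enc m') (enc m) (ordn i) \<longleftrightarrow> (\<exists>a. m' = m(i \<mapsto> a))"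
proof
  assume a: "agr (enc m') (enc m) (ordn i)"
  then obtain a where a1: "m' i = Some a" unfolding agr_def using pair_enc [OF assms(2)] by auto
  have "m' j = m j" if "j \<noteq> i" for j
  proof -
    have "m' j = Some b \<Longrightarrow> m j = Some b" for b
      using a that unfolding agr_def pair_enc [OF assms(2), symmetric] pair_enc [OF assms(1), symmetric]
      by (auto simp: ordn_inj)
    moreover have "m j = Some b \<Longrightarrow> m' j = Some b" for b
      using a that unfolding agr_def pair_enc [OF assms(2), symmetric] pair_enc [OF assms(1), symmetric]
      by (auto simp: ordn_inj)
    ultimately show ?thesis by (metis not_None_eq)
  qed
  then have "m' = m(i \<mapsto> a)" using a1 by auto
  then show "\<exists>a. m' = m(i \<mapsto> a)" by blast
next
  assume "\<exists>a. m' = m(i \<mapsto> a)"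
  then obtain a where m': "m' = m(i \<mapsto> a)" by blast
  have "\<exists>b. pair (ordn i) b \<in> elts (enc m') \<and> b = b" using pair_enc [OF assms(2), of i a] m' by auto
  moreover have "z \<in> elts (enc m) \<or> (\<exists>a b. z = pair a b \<and> a = ordn i)" if z: "z \<in> elts (enc m')" for z
  proof -
    obtain j b where "z = pair (ordn j) b" "m' j = Some b" using pair_encD [OF assms(2) z] by blast
    then show ?thesis using pair_enc [OF assms(1), of j b] m' by (cases "j = i") auto
  qed
  moreover have "z \<in> elts (enc m') \<or> (\<exists>a b. z = pair a b \<and> a = ordn i)" if z: "z \<in> elts (enc m)" for z
  proof -
    obtain j b where "z = pair (ordn j) b" "m j = Some b" using pair_encD [OF assms(1) z] by blast
    then show ?thesis using pair_enc [OF assms(2), of j b] m' by (cases "j = i") auto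
  qed
  ultimately show "agr (enc m') (enc m) (ordn i)" unfolding agr_def by blast
qed

definition asg :: "'a hset \<Rightarrow> (nat \<Rightarrow> 'a hset option) set" where
  "asg A = {m. finite (dom m) \<and> ran m \<subseteq> elts A}"

lemma asg_upd: "m \<in> asg A \<Longrightarrow> a \<in> elts A \<Longrightarrow> m(i \<mapsto> a) \<in> asg A"
  unfolding asg_def by (auto simp: ran_def split: if_splits)

lemma asg_updD: "m(i \<mapsto> a) \<in> asg A \<Longrightarrow> a \<in> elts A"
  unfolding asg_def using ranI [of "m(i \<mapsto> a)" i a] by auto

lemma asg_fin: "m \<in> asg A \<Longrightarrow> finite (dom m)"
  by (simp add: asg_def)

definition idx :: "nat \<Rightarrow> nat \<Rightarrow> nat \<Rightarrow> 'a hset" where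
  "idx i j k = pair (ordn i) (pair (ordn j) (ordn k))"

lemma elts_idx: "elts (prod omega (prod omega omega)) = {idx i j k | i j k. True}"
  unfolding idx_def elts_prod_X [OF omega_X prod_X [OF omega_X omega_X]] elts_prod_X [OF omega_X omega_X] elts_omega
  by blast

abbreviation tt :: "'a hset \<Rightarrow> 'a hset set" where
  "tt A \<equiv> cl one (prod omega (prod omega omega)) (hT (fE one omega A))"

lemma elts_fT: "A \<in> X \<Longrightarrow> elts (fT one omega A) = tt A"
  unfolding fT_def by (intro elts_Cl_hT ordn_X prod_X omega_X fE_X)

lemma mem_hT:
  assumes "A \<in> X"
  shows "x \<in> elts (hT (fE one omega A) v P Q) \<longleftrightarrow> (\<exists>m\<in>asg A. x = enc m \<and> hC v P Q (enc m))"
proof -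
  have "elts (hT (fE one omega A) v P Q) = {t \<in> elts (fE one omega A). hC v P Q t}"
    unfolding hT_def by (rule elts_Collect)
  then have "x \<in> elts (hT (fE one omega A) v P Q) \<longleftrightarrow> x \<in> elts (fE one omega A) \<and> hC v P Q x"
    by simp
  moreover have "x \<in> elts (fE one omega A) \<longleftrightarrow> (\<exists>m. m \<in> asg A \<and> x = enc m)"
    unfolding elts_fE [OF assms] asg_def by (simp only: mem_Collect_eq conj_commute)
  ultimately have "x \<in> elts (hT (fE one omega A) v P Q) \<longleftrightarrow> (\<exists>m. m \<in> asg A \<and> x = enc m) \<and> hC v P Q x"
    by (simp only:)
  also have "\<dots> \<longleftrightarrow> (\<exists>m\<in>asg A. x = enc m \<and> hC v P Q (enc m))" by auto
  finally show ?thesis .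
qed

lemma tt_sub: "A \<in> X \<Longrightarrow> R \<in> tt A \<Longrightarrow> x \<in> elts R \<Longrightarrow> \<exists>m\<in>asg A. x = enc m"
  by (erule cl.cases) (auto simp: mem_hT)

lemma enc_hT:
  assumes "A \<in> X" "m \<in> asg A"
  shows "enc m \<in> elts (hT (fE one omega A) v P Q) \<longleftrightarrow> hC v P Q (enc m)"
  using assms mem_hT enc_inj asg_fin by metis

lemma hC_mem: "m \<in> asg A \<Longrightarrow> hC (idx i j 0) P Q (enc m) \<longleftrightarrow> (\<exists>a b. m i = Some a \<and> m j = Some b \<and> a \<in> elts b)"
  unfolding hC_def idx_def using asg_fin [of m A] ordn_inj [of 0 "Suc 0"]
  by (auto simp: pair_enc isone_iff)

lemma hC_eq: "m \<in> asg A \<Longrightarrow> hC (idx i j 1) P Q (enc m) \<longleftrightarrow> (\<exists>a. m i = Some a \<and> m j = Some a)"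
  unfolding hC_def idx_def using asg_fin [of m A] ordn_inj [of "Suc 0" 0]
  by (auto simp: pair_enc isone_iff)

lemma hC_nand:
  assumes "A \<in> X" "m \<in> asg A" "Q \<in> tt A" "k \<noteq> 0" "k \<noteq> 1"
  shows "hC (idx i j k) P Q (enc m) \<longleftrightarrow> \<not> (enc m \<in> elts P \<and> (\<exists>a\<in>elts A. enc (m(i \<mapsto> a)) \<in> elts Q))"
proof -
  have "(\<exists>s\<in>elts Q. agr s (enc m) (ordn i)) \<longleftrightarrow> (\<exists>a\<in>elts A. enc (m(i \<mapsto> a)) \<in> elts Q)"
  proof
    assume "\<exists>s\<in>elts Q. agr s (enc m) (ordn i)"
    then obtain s where s: "s \<in> elts Q" "agr s (enc m) (ordn i)" by blast
    obtain m' where m': "m' \<in> asg A" "s = enc m'" using tt_sub [OF assms(1,3) s(1)] by blast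
    then obtain a where "m' = m(i \<mapsto> a)"
      using agr_enc [OF asg_fin [OF assms(2)] asg_fin [OF m'(1)]] s(2) by blast
    then show "\<exists>a\<in>elts A. enc (m(i \<mapsto> a)) \<in> elts Q" using s m' asg_updD by blast
  next
    assume "\<exists>a\<in>elts A. enc (m(i \<mapsto> a)) \<in> elts Q"
    then obtain a where a: "a \<in> elts A" "enc (m(i \<mapsto> a)) \<in> elts Q" by blast
    have "agr (enc (m(i \<mapsto> a))) (enc m) (ordn i)"
      using agr_enc [OF asg_fin [OF assms(2)] asg_fin [OF asg_upd [OF assms(2) a(1)]]] by blast
    then show "\<exists>s\<in>elts Q. agr s (enc m) (ordn i)" using a by blast
  qed
  moreover have "ordn k \<noteq> (zer :: 'a hset)" "\<not> isone (ordn k)"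
    using assms(4,5) ordn_inj [of k 0] ordn_inj [of k "Suc 0"] by (auto simp: isone_iff)
  ultimately show ?thesis unfolding hC_def idx_def by auto
qed

text \<open>The correspondence is restricted to assignments that cover the free variables: an atomic
  relation fails where one of its variables is undefined, a case that \<open>sat\<close> does not
  have.\<close>

definition Rel :: "'a hset \<Rightarrow> 'a hset \<Rightarrow> fm \<Rightarrow> bool" where
  "Rel A R \<phi> \<longleftrightarrow> R \<in> tt A \<and> (\<forall>m\<in>asg A. fv \<phi> \<subseteq> dom m \<longrightarrow> (enc m \<in> elts R \<longleftrightarrow> sat (elts A) \<phi> (\<lambda>i. the (m i))))"

lemma tt_step: "A \<in> X \<Longrightarrow> P \<in> tt A \<Longrightarrow> Q \<in> tt A \<Longrightarrow> hT (fE one omega A) (idx i j k) P Q \<in> tt A"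
  by (rule cl.step) (auto simp: elts_idx)

lemma tt_zer: "zer \<in> tt A"
  by (rule cl.base) simp

text \<open>The operation \<not> (P \<and> (\<exists>x. Q)) generates all connectives. From the
  empty relation it yields truth, with Q true it yields the negation of P, and negating its value
  gives conjunction, when x is not free in Q, and quantification, when P is true. Dummy quantifiers
  are harmless because \<open>A\<close> is nonempty.\<close>

lemma Rel_ex:
  assumes A: "A \<in> X" and ne: "elts A \<noteq> {}"
  shows "\<exists>R. Rel A R \<phi>"
proof (induction \<phi>)
  case (Mem i j)
  show ?case
    unfolding Rel_def
    by (rule exI [of _ "hT (fE one omega A) (idx i j 0) zer zer"])
      (auto simp: enc_hT [OF A] hC_mem tt_step [OF A tt_zer tt_zer])
next
  case (Eq i j)
  show ?case
    unfolding Rel_def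
    by (rule exI [of _ "hT (fE one omega A) (idx i j 1) zer zer"])
      (auto simp: enc_hT [OF A] hC_eq [unfolded One_nat_def] tt_step [OF A tt_zer tt_zer])
next
  case (Neg \<phi>)
  then obtain R where R: "Rel A R \<phi>" by blast
  \<comment> \<open>Truth. The third index 2 selects the combined operation, as would any number
    other than 0 and 1; the first index is a dummy variable.\<close>
  let ?T = "hT (fE one omega A) (idx 0 0 2) zer zer"
  have T: "?T \<in> tt A" "\<And>m. m \<in> asg A \<Longrightarrow> enc m \<in> elts ?T"
    by (auto simp: enc_hT [OF A] hC_nand [OF A _ tt_zer] tt_step [OF A tt_zer tt_zer])
  have Rt: "R \<in> tt A" using R by (simp add: Rel_def)
  have "Rel A (hT (fE one omega A) (idx 0 0 2) R ?T) (Neg \<phi>)"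
    unfolding Rel_def
  proof (intro conjI ballI impI)
    show "hT (fE one omega A) (idx 0 0 2) R ?T \<in> tt A" by (rule tt_step [OF A Rt T(1)])
    fix m assume m: "m \<in> asg A" "fv (Neg \<phi>) \<subseteq> dom m"
    have "\<exists>a\<in>elts A. enc (m(0 \<mapsto> a)) \<in> elts ?T" using ne T(2) asg_upd [OF m(1)] by blast
    then have "enc m \<in> elts (hT (fE one omega A) (idx 0 0 2) R ?T) \<longleftrightarrow> enc m \<notin> elts R"
      unfolding enc_hT [OF A m(1)] using hC_nand [OF A m(1) T(1), of 2 0 0 R] by simp
    then show "enc m \<in> elts (hT (fE one omega A) (idx 0 0 2) R ?T) \<longleftrightarrow> sat (elts A) (Neg \<phi>) (\<lambda>i. the (m i))"
      using R m by (simp add: Rel_def)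
  qed
  then show ?case by blast
next
  case (And \<phi> \<psi>)
  then obtain R S where RS: "Rel A R \<phi>" "Rel A S \<psi>" by blast
  let ?T = "hT (fE one omega A) (idx 0 0 2) zer zer"
  have T: "?T \<in> tt A" "\<And>m. m \<in> asg A \<Longrightarrow> enc m \<in> elts ?T"
    by (auto simp: enc_hT [OF A] hC_nand [OF A _ tt_zer] tt_step [OF A tt_zer tt_zer])
  have t: "R \<in> tt A" "S \<in> tt A" using RS by (auto simp: Rel_def)
  \<comment> \<open>Quantifying over a variable that is not free in \<psi> leaves its relation
    intact, so the operation reduces to the negated conjunction.\<close>
  obtain k where k: "k \<notin> fv \<psi>" using finite_fv ex_new_if_finite infinite_UNIV_nat by metis
  let ?N = "hT (fE one omega A) (idx k 0 2) R S"
  have N: "?N \<in> tt A" by (rule tt_step [OF A t])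
  have "Rel A (hT (fE one omega A) (idx 0 0 2) ?N ?T) (And \<phi> \<psi>)"
    unfolding Rel_def
  proof (intro conjI ballI impI)
    show "hT (fE one omega A) (idx 0 0 2) ?N ?T \<in> tt A" by (rule tt_step [OF A N T(1)])
    fix m assume m: "m \<in> asg A" "fv (And \<phi> \<psi>) \<subseteq> dom m"
    have S: "enc (m(k \<mapsto> a)) \<in> elts S \<longleftrightarrow> sat (elts A) \<psi> (\<lambda>i. the (m i))" if a: "a \<in> elts A" for a
    proof -
      have "enc (m(k \<mapsto> a)) \<in> elts S \<longleftrightarrow> sat (elts A) \<psi> (\<lambda>i. the ((m(k \<mapsto> a)) i))"
      proof -
        have "fv \<psi> \<subseteq> dom (m(k \<mapsto> a))" using m(2) by auto
        then show ?thesis using RS(2) asg_upd [OF m(1) a, of k] unfolding Rel_def by blast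
      qed
      also have "\<dots> \<longleftrightarrow> sat (elts A) \<psi> (\<lambda>i. the (m i))" by (rule sat_cong) (use k in auto)
      finally show ?thesis .
    qed
    have "\<exists>a\<in>elts A. enc (m(0 \<mapsto> a)) \<in> elts ?T" using ne T(2) asg_upd [OF m(1)] by blast
    then have "enc m \<in> elts (hT (fE one omega A) (idx 0 0 2) ?N ?T) \<longleftrightarrow> enc m \<notin> elts ?N"
      unfolding enc_hT [OF A m(1), of _ ?N ?T] using hC_nand [OF A m(1) T(1), of 2 0 0 ?N] by simp
    also have "\<dots> \<longleftrightarrow> enc m \<in> elts R \<and> (\<exists>a\<in>elts A. enc (m(k \<mapsto> a)) \<in> elts S)"
      unfolding enc_hT [OF A m(1)] using hC_nand [OF A m(1) t(2), of 2 k 0 R] by simp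
    also have "\<dots> \<longleftrightarrow> sat (elts A) (And \<phi> \<psi>) (\<lambda>i. the (m i))"
      using RS(1) m S ne by (auto simp: Rel_def)
    finally show "enc m \<in> elts (hT (fE one omega A) (idx 0 0 2) ?N ?T) \<longleftrightarrow> sat (elts A) (And \<phi> \<psi>) (\<lambda>i. the (m i))" .
  qed
  then show ?case by blast
next
  case (Ex k \<phi>)
  then obtain R where R: "Rel A R \<phi>" by blast
  let ?T = "hT (fE one omega A) (idx 0 0 2) zer zer"
  have T: "?T \<in> tt A" "\<And>m. m \<in> asg A \<Longrightarrow> enc m \<in> elts ?T"
    by (auto simp: enc_hT [OF A] hC_nand [OF A _ tt_zer] tt_step [OF A tt_zer tt_zer])
  have t: "R \<in> tt A" using R by (auto simp: Rel_def)
  let ?N = "hT (fE one omega A) (idx k 0 2) ?T R"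
  have N: "?N \<in> tt A" by (rule tt_step [OF A T(1) t])
  have "Rel A (hT (fE one omega A) (idx 0 0 2) ?N ?T) (Ex k \<phi>)"
    unfolding Rel_def
  proof (intro conjI ballI impI)
    show "hT (fE one omega A) (idx 0 0 2) ?N ?T \<in> tt A" by (rule tt_step [OF A N T(1)])
    fix m assume m: "m \<in> asg A" "fv (Ex k \<phi>) \<subseteq> dom m"
    have S: "enc (m(k \<mapsto> a)) \<in> elts R \<longleftrightarrow> sat (elts A) \<phi> ((\<lambda>i. the (m i))(k := a))" if a: "a \<in> elts A" for a
    proof -
      have "enc (m(k \<mapsto> a)) \<in> elts R \<longleftrightarrow> sat (elts A) \<phi> (\<lambda>i. the ((m(k \<mapsto> a)) i))"
      proof -
        have "fv \<phi> \<subseteq> dom (m(k \<mapsto> a))" using m(2) by auto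
        then show ?thesis using R asg_upd [OF m(1) a, of k] unfolding Rel_def by blast
      qed
      also have "\<dots> \<longleftrightarrow> sat (elts A) \<phi> ((\<lambda>i. the (m i))(k := a))" by (rule sat_cong) auto
      finally show ?thesis .
    qed
    have "\<exists>a\<in>elts A. enc (m(0 \<mapsto> a)) \<in> elts ?T" using ne T(2) asg_upd [OF m(1)] by blast
    then have "enc m \<in> elts (hT (fE one omega A) (idx 0 0 2) ?N ?T) \<longleftrightarrow> enc m \<notin> elts ?N"
      unfolding enc_hT [OF A m(1), of _ ?N ?T] using hC_nand [OF A m(1) T(1), of 2 0 0 ?N] by simp
    also have "\<dots> \<longleftrightarrow> (\<exists>a\<in>elts A. enc (m(k \<mapsto> a)) \<in> elts R)"
      unfolding enc_hT [OF A m(1), of _ ?T R] using hC_nand [OF A m(1) t, of 2 k 0 ?T] T(2) [OF m(1)] by simp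
    also have "\<dots> \<longleftrightarrow> sat (elts A) (Ex k \<phi>) (\<lambda>i. the (m i))"
      using S by simp
    finally show "enc m \<in> elts (hT (fE one omega A) (idx 0 0 2) ?N ?T) \<longleftrightarrow> sat (elts A) (Ex k \<phi>) (\<lambda>i. the (m i))" .
  qed
  then show ?case by blast
qed

text \<open>The formula depends on the domain \<open>d\<close> of the assignments, because an atomic
  relation with a variable outside \<open>d\<close> is false. Such a case is rendered by a closed
  false formula, which fits every \<open>d\<close>. Under a quantifier the domain grows by the bound
  variable.\<close>

lemma tt_formula:
  assumes A: "A \<in> X" and "R \<in> tt A"
  shows "finite d \<Longrightarrow> \<exists>\<phi>. fv \<phi> \<subseteq> d \<and> (\<forall>m\<in>asg A. dom m = d \<longrightarrow> (enc m \<in> elts R \<longleftrightarrow> sat (elts A) \<phi> (\<lambda>i. the (m i))))"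
  using assms(2)
proof (induction arbitrary: d)
  case (base R)
  then have "elts R = {}" by simp
  then show ?case by (intro exI [of _ "Ex 0 (Neg (Eq 0 0))"]) auto
next
  case (step v P Q)
  obtain i j k where v: "v = idx i j k" using step(1) unfolding elts_idx by blast
  consider "k = 0" | "k = 1" | "k \<noteq> 0" "k \<noteq> 1" by blast
  then show ?case
  proof cases
    case 1
    show ?thesis
    proof (cases "i \<in> d \<and> j \<in> d")
      case True
      then show ?thesis
        unfolding v 1 by (intro exI [of _ "Mem i j"]) (auto simp: enc_hT [OF A] hC_mem)
    next
      case False
      then show ?thesis
        unfolding v 1 by (intro exI [of _ "Ex 0 (Neg (Eq 0 0))"]) (auto simp: enc_hT [OF A] hC_mem)
    qed
  next
    case 2
    show ?thesis
    proof (cases "i \<in> d \<and> j \<in> d")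
      case True
      then show ?thesis
        unfolding v 2 by (intro exI [of _ "Eq i j"]) (auto simp: enc_hT [OF A] hC_eq [unfolded One_nat_def])
    next
      case False
      then show ?thesis
        unfolding v 2 by (intro exI [of _ "Ex 0 (Neg (Eq 0 0))"]) (auto simp: enc_hT [OF A] hC_eq [unfolded One_nat_def])
    qed
  next
    case 3
    obtain \<phi> where \<phi>: "fv \<phi> \<subseteq> d" "\<And>m. m \<in> asg A \<Longrightarrow> dom m = d \<Longrightarrow> enc m \<in> elts P \<longleftrightarrow> sat (elts A) \<phi> (\<lambda>i. the (m i))"
      using step(4) [OF step.prems] by blast
    have fin: "finite (insert i d)" using step.prems by simp
    obtain \<psi> where \<psi>: "fv \<psi> \<subseteq> insert i d"
        "\<And>m. m \<in> asg A \<Longrightarrow> dom m = insert i d \<Longrightarrow> enc m \<in> elts Q \<longleftrightarrow> sat (elts A) \<psi> (\<lambda>i. the (m i))"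
      using step(5) [OF fin] by blast
    have "enc m \<in> elts (hT (fE one omega A) v P Q) \<longleftrightarrow> sat (elts A) (Neg (And \<phi> (Ex i \<psi>))) (\<lambda>i. the (m i))"
      if m: "m \<in> asg A" "dom m = d" for m
    proof -
      have "enc (m(i \<mapsto> a)) \<in> elts Q \<longleftrightarrow> sat (elts A) \<psi> ((\<lambda>i. the (m i))(i := a))" if a: "a \<in> elts A" for a
      proof -
        have "enc (m(i \<mapsto> a)) \<in> elts Q \<longleftrightarrow> sat (elts A) \<psi> (\<lambda>j. the ((m(i \<mapsto> a)) j))"
          using \<psi>(2) [OF asg_upd [OF m(1) a]] m(2) by simp
        also have "\<dots> \<longleftrightarrow> sat (elts A) \<psi> ((\<lambda>i. the (m i))(i := a))" by (rule sat_cong) auto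
        finally show ?thesis .
      qed
      then show ?thesis
        unfolding enc_hT [OF A m(1)] v using hC_nand [OF A m(1) step(3) 3] \<phi>(2) [OF m] by simp
    qed
    moreover have "fv (Neg (And \<phi> (Ex i \<psi>))) \<subseteq> d" using \<phi>(1) \<psi>(1) by auto
    ultimately show ?thesis by blast
  qed
qed

lemma mem_SA:
  assumes A: "A \<in> X" and m: "m \<in> asg A"
  shows "a \<in> elts (SA zer A (enc m) R Q) \<longleftrightarrow> a \<in> elts A \<and> 0 \<notin> dom m \<and> enc (m(0 \<mapsto> a)) \<in> elts R"
proof -
  have "(\<exists>b. pair zer b \<in> elts (enc m) \<and> b = b) \<longleftrightarrow> 0 \<in> dom m"
    using pair_enc [OF asg_fin [OF m], of 0] by auto
  moreover have "hinsert (pair zer a) (enc m) = enc (m(0 \<mapsto> a))" if "0 \<notin> dom m" "a \<in> elts A"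
  proof (rule hset_eqI, rule set_eqI, rule iffI)
    have m0: "m 0 = None" using that(1) by auto
    have el: "elts (enc (m(0 \<mapsto> a))) = {pair (ordn i) b | i b. (m(0 \<mapsto> a)) i = Some b}"
      by (rule elts_enc [OF asg_fin [OF asg_upd [OF m that(2)]]])
    fix z
    show "z \<in> elts (enc (m(0 \<mapsto> a)))" if z: "z \<in> elts (hinsert (pair zer a) (enc m))"
    proof (cases "z = pair zer a")
      case True
      then have "z = pair (ordn 0) a \<and> (m(0 \<mapsto> a)) 0 = Some a" by simp
      then show ?thesis unfolding el by blast
    next
      case False
      then have "z \<in> elts (enc m)" using z by simp
      then obtain i b where i: "z = pair (ordn i) b" "m i = Some b"
        using pair_encD [OF asg_fin [OF m]] by blast
      then have "(m(0 \<mapsto> a)) i = Some b" using m0 by (cases "i = 0") auto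
      then show ?thesis unfolding el using i(1) by blast
    qed
    show "z \<in> elts (hinsert (pair zer a) (enc m))" if z: "z \<in> elts (enc (m(0 \<mapsto> a)))"
    proof -
      obtain i b where i: "z = pair (ordn i) b" "(m(0 \<mapsto> a)) i = Some b" using z unfolding el by blast
      show ?thesis
      proof (cases "i = 0")
        case True
        then show ?thesis using i by simp
      next
        case False
        then have "z \<in> elts (enc m)" using i pair_enc [OF asg_fin [OF m]] by simp
        then show ?thesis by simp
      qed
    qed
  qed
  moreover have "a \<in> elts (SA zer A (enc m) R Q) \<longleftrightarrow> a \<in> elts A \<and> \<not> (\<exists>b. pair zer b \<in> elts (enc m) \<and> b = b) \<and>
    hinsert (pair zer a) (enc m) \<in> elts R"
    unfolding SA_def elts_Collect by auto
  ultimately show ?thesis by metis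
qed

lemma elts_DefO_eq:
  assumes A: "A \<in> X"
  shows "elts (DefO one omega zer A) = {x. definable (\<lambda>_. True) (elts A) (elts x)}"
proof (intro set_eqI iffI)
  fix x assume "x \<in> elts (DefO one omega zer A)"
  then obtain t R Q where x: "x = SA zer A t R Q" "t \<in> elts (fE one omega A)" "R \<in> elts (fT one omega A)"
    unfolding elts_DefO [OF ordn_X omega_X zer_X A] stpS_def by auto
  obtain m where m: "m \<in> asg A" "t = enc m" using x(2) unfolding elts_fE [OF A] asg_def by blast
  have R: "R \<in> tt A" using x(3) elts_fT [OF A] by simp
  have xe: "elts x = {a \<in> elts A. 0 \<notin> dom m \<and> enc (m(0 \<mapsto> a)) \<in> elts R}"
    unfolding x(1) m(2) using mem_SA [OF A m(1)] by blast
  show "x \<in> {x. definable (\<lambda>_. True) (elts A) (elts x)}"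
  proof (cases "0 \<in> dom m")
    case True
    then have "elts x = {}" using xe by auto
    then show ?thesis unfolding definable_def by (auto intro!: exI [of _ "Neg (Eq 0 0)"])
  next
    case False
    obtain \<phi> where \<phi>: "fv \<phi> \<subseteq> insert 0 (dom m)" "\<And>m'. m' \<in> asg A \<Longrightarrow> dom m' = insert 0 (dom m) \<Longrightarrow>
        enc m' \<in> elts R \<longleftrightarrow> sat (elts A) \<phi> (\<lambda>i. the (m' i))"
      using tt_formula [OF A R, of "insert 0 (dom m)"] asg_fin [OF m(1)] by auto
    have "enc (m(0 \<mapsto> a)) \<in> elts R \<longleftrightarrow> sat (elts A) \<phi> ((\<lambda>i. the (m i))(0 := a))" if "a \<in> elts A" for a
    proof -
      have "enc (m(0 \<mapsto> a)) \<in> elts R \<longleftrightarrow> sat (elts A) \<phi> (\<lambda>i. the ((m(0 \<mapsto> a)) i))"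
        using \<phi>(2) [OF asg_upd [OF m(1) that]] by simp
      also have "\<dots> \<longleftrightarrow> sat (elts A) \<phi> ((\<lambda>i. the (m i))(0 := a))" by (rule sat_cong) auto
      finally show ?thesis .
    qed
    then have "elts x = {a \<in> elts A. sat (elts A) \<phi> ((\<lambda>i. the (m i))(0 := a))}" using xe False by auto
    moreover have "the (m i) \<in> elts A" if "i \<in> fv \<phi> - {0}" for i
    proof -
      have "i \<in> dom m" using that \<phi>(1) by blast
      then obtain b where "m i = Some b" by blast
      then show ?thesis using m(1) unfolding asg_def ran_def by auto
    qed
    ultimately have "definable (\<lambda>_. True) (elts A) (elts x)"
      unfolding definable_def by (intro exI [of _ \<phi>] exI [of _ "\<lambda>i. the (m i)"]) auto
    then show ?thesis by blast
  qed
next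
  fix x assume "x \<in> {x. definable (\<lambda>_. True) (elts A) (elts x)}"
  then obtain \<phi> e where \<phi>: "\<forall>i\<in>fv \<phi> - {0}. e i \<in> elts A" "elts x = {a \<in> elts A. sat (elts A) \<phi> (e(0 := a))}"
    unfolding definable_def by blast
  \<comment> \<open>Only the parameters are assigned; variable 0 stays undefined, as
    \<open>SA\<close> demands.\<close>
  define m where "m i = (if i \<in> fv \<phi> - {0} then Some (e i) else None)" for i
  have dom: "dom m = fv \<phi> - {0}" by (auto simp: m_def dom_def split: if_splits)
  have m: "m \<in> asg A"
  proof -
    have "b \<in> elts A" if b: "b \<in> ran m" for b
    proof -
      obtain i where "m i = Some b" using b unfolding ran_def by blast
      then have "i \<in> fv \<phi> - {0}" "b = e i" unfolding m_def by (metis option.distinct(1), metis option.distinct(1) option.sel)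
      then show ?thesis using \<phi>(1) by blast
    qed
    then show ?thesis unfolding asg_def using finite_fv [of \<phi>] dom by auto
  qed
  have "\<exists>R\<in>tt A. x = SA zer A (enc m) R zer"
  \<comment> \<open>\<open>Rel_ex\<close> needs an element of \<open>A\<close>. For empty
    \<open>A\<close> the empty relation will do.\<close>
  proof (cases "elts A = {}")
    case True
    then have "elts x = elts (SA zer A (enc m) zer zer)" using \<phi>(2) mem_SA [OF A m] by auto
    then show ?thesis using hset_eqI tt_zer by blast
  next
    case False
    obtain R where R: "R \<in> tt A" "\<And>m. m \<in> asg A \<Longrightarrow> fv \<phi> \<subseteq> dom m \<Longrightarrow> enc m \<in> elts R \<longleftrightarrow> sat (elts A) \<phi> (\<lambda>i. the (m i))"
      using Rel_ex [OF A False] unfolding Rel_def by blast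
    have "enc (m(0 \<mapsto> a)) \<in> elts R \<longleftrightarrow> sat (elts A) \<phi> (e(0 := a))" if "a \<in> elts A" for a
    proof -
      have "enc (m(0 \<mapsto> a)) \<in> elts R \<longleftrightarrow> sat (elts A) \<phi> (\<lambda>i. the ((m(0 \<mapsto> a)) i))"
        by (rule R(2) [OF asg_upd [OF m that]]) (auto simp: dom)
      also have "\<dots> \<longleftrightarrow> sat (elts A) \<phi> (e(0 := a))" by (rule sat_cong) (auto simp: m_def)
      finally show ?thesis .
    qed
    then have "elts x = elts (SA zer A (enc m) R zer)" using \<phi>(2) mem_SA [OF A m] by (auto simp: dom)
    then show ?thesis using hset_eqI R(1) by blast
  qed
  then obtain R where R: "R \<in> tt A" "x = SA zer A (enc m) R zer" by blast
  have "enc m \<in> elts (fE one omega A)" unfolding elts_fE [OF A] using m asg_def by blast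
  then show "x \<in> elts (DefO one omega zer A)"
    unfolding elts_DefO [OF ordn_X omega_X zer_X A] stpS_def elts_fT [OF A] using R tt_zer by blast
qed

end

section \<open>The function that maps \<gamma> to \<open>L \<gamma>\<close>\<close>

definition rs :: "'a hset \<Rightarrow> 'a hset" where
  "rs f = mk {y. \<exists>a. pair a y \<in> elts f}"

context adm
begin

lemma inX_rs:
  assumes "f \<in> X" shows "inX {y. \<exists>a. pair a y \<in> elts f}"
proof -
  have "Dfn Delta0 X (\<lambda>e. \<exists>a b. pair a b \<in> elts (e (Suc 0)) \<and> b = e 0)" by (intro D_sets)
  from sep_X [where P = "\<lambda>x e. \<exists>a b. pair a b \<in> elts (e 0) \<and> b = x", OF this, of "\<lambda>_. f" "hUnion (hUnion f)"]
  have "inX {x \<in> elts (hUnion (hUnion f)). \<exists>a. pair a x \<in> elts f}"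
    using assms by (simp add: envs_def hUnion_X)
  moreover have "{x \<in> elts (hUnion (hUnion f)). \<exists>a. pair a x \<in> elts f} = {y. \<exists>a. pair a y \<in> elts f}"
  proof -
    have "y \<in> elts (hUnion (hUnion f))" if "pair a y \<in> elts f" for a y
    proof -
      have "up a y \<in> elts (hUnion f)" using that(1) by (auto simp: pair_def intro!: bexI [of _ "pair a y"])
      then show ?thesis unfolding elts_hUnion [of "hUnion f"] by (intro UN_I) auto
    qed
    then show ?thesis by blast
  qed
  ultimately show ?thesis by simp
qed

lemma elts_rs_X: "f \<in> X \<Longrightarrow> elts (rs f) = {y. \<exists>a. pair a y \<in> elts f}"
  and rs_X: "f \<in> X \<Longrightarrow> rs f \<in> X"
  unfolding rs_def using inX_rs elts_mk_X inX_mk by blast+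

lemma D_rs: "dc \<Gamma> \<Longrightarrow> Dfn \<Gamma> X (\<lambda>e. rs (e i) = e j)"
proof -
  assume "dc \<Gamma>"
  then have "Dfn \<Gamma> X (\<lambda>e. (\<forall>y\<in>elts (e j). \<exists>a b. pair a b \<in> elts (e i) \<and> b = y) \<and>
    (\<forall>a y. pair a y \<in> elts (e i) \<longrightarrow> y \<in> elts (e j)))" by (intro D_sets)
  then show ?thesis
  proof (rule Dfn_cong)
    fix e assume e: "e \<in> envs X"
    have "rs (e i) = e j \<longleftrightarrow> elts (rs (e i)) = elts (e j)" by (metis elts_inject)
    then show "((\<forall>y\<in>elts (e j). \<exists>a b. pair a b \<in> elts (e i) \<and> b = y) \<and>
      (\<forall>a y. pair a y \<in> elts (e i) \<longrightarrow> y \<in> elts (e j))) = (rs (e i) = e j)"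
      unfolding elts_rs_X [OF envsD [OF e]] by blast
  qed
qed

text \<open>One step of the hierarchy: \<open>rs f\<close> is the set of the earlier levels, whose
  definable power sets are tabulated by \<open>lam\<close> so that \<open>ranU\<close> can form
  their union.\<close>

definition LG :: "'a hset \<Rightarrow> 'a hset \<Rightarrow> 'a hset \<Rightarrow> 'a hset \<Rightarrow> 'a hset" where
  "LG b w z f = ranU (lam (rs f) (DefO b w z))"

definition Lset :: "'a hset \<Rightarrow> 'a hset" where
  "Lset = hrec (LG one omega zer)"

lemma lam_DefO_X:
  assumes "b \<in> X" "w \<in> X" "z \<in> X" "x \<in> X"
  shows "lam x (DefO b w z) \<in> X"
proof -
  have "Sig (\<lambda>e. DefO (e (Suc (Suc 0))) (e (Suc (Suc (Suc 0)))) (e (Suc (Suc (Suc (Suc 0))))) (e 0) = e (Suc 0))"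
    by (intro USig_Sig USig_DefO)
  from Sig_lam_graph [where F = "\<lambda>e. DefO (e 0) (e (Suc 0)) (e (Suc (Suc 0)))", OF this,
      of "case_nat b (case_nat w (\<lambda>_. z))" x]
  show ?thesis using assms DefO_X trsD [OF assms(4)] by (simp add: envs_def split: nat.splits)
qed

lemma LG_X: "b \<in> X \<Longrightarrow> w \<in> X \<Longrightarrow> z \<in> X \<Longrightarrow> f \<in> X \<Longrightarrow> LG b w z f \<in> X"
  unfolding LG_def by (intro ranU_X lam_DefO_X rs_X)

lemma USig_LG0: "USig (\<lambda>e. LG (e a) (e b) (e c) (e i) = e j)"
  unfolding LG_def
proof (rule USig_let [where g = "\<lambda>e. rs (e i)" and P = "\<lambda>r e. ranU (lam r (DefO (e a) (e b) (e c))) = e j"])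
  show "USig (\<lambda>e. ranU (lam (e 0) (DefO (e (Suc a)) (e (Suc b)) (e (Suc c)))) = e (Suc j))"
  proof (rule USig_let [where g = "\<lambda>e. lam (e 0) (DefO (e (Suc a)) (e (Suc b)) (e (Suc c)))" and P = "\<lambda>f e. ranU f = e (Suc j)"])
    show "USig (\<lambda>e. lam (e (Suc 0)) (DefO (e (Suc (Suc a))) (e (Suc (Suc b))) (e (Suc (Suc c)))) = e 0)"
      by (rule USig_lam [of "\<lambda>e. DefO (e (Suc (Suc a))) (e (Suc (Suc b))) (e (Suc (Suc c)))"])
        (rule USig_DefO, rule DefO_X [OF envsD envsD envsD])
    show "USig (\<lambda>e. ranU (e 0) = e (Suc (Suc j)))" by (intro USig_Del D_ranU dc_simps)
  qed (intro lam_DefO_X envsD)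
qed (intro USig_Del D_rs dc_simps, intro rs_X envsD)

lemma USig_LG: "USig (\<lambda>e. LG one omega zer (e i) = e j)"
proof -
  have 1: "USig (\<lambda>e. LG one (e 0) (e (Suc 0)) (e (Suc (Suc i))) = e (Suc (Suc j)))"
    by (rule USig_const [where P = "\<lambda>c e. LG c (e 0) (e (Suc 0)) (e (Suc (Suc i))) = e (Suc (Suc j))", OF USig_LG0 ordn_X])
  have 2: "USig (\<lambda>e. LG one omega (e 0) (e (Suc i)) = e (Suc j))"
    by (rule USig_const [where P = "\<lambda>c e. LG one c (e 0) (e (Suc i)) = e (Suc j)", OF 1 omega_X])
  show ?thesis
    by (rule USig_const [where P = "\<lambda>c e. LG one omega c (e i) = e j", OF 2 zer_X])
qed

lemma Lset_X: "x \<in> X \<Longrightarrow> Ord x \<Longrightarrow> Lset x \<in> X"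
  unfolding Lset_def
  using hrec_X [of "\<lambda>e. LG one omega zer", OF USig_LG LG_X [OF ordn_X omega_X zer_X], of "\<lambda>_. zer"] zer_X
  by (simp add: envs_def)

lemma USig_Lset: "USig (\<lambda>e. Ord (e i) \<and> Lset (e i) = e j)"
  unfolding Lset_def
  by (rule USig_hrec [of "\<lambda>e. LG one omega zer", OF USig_LG LG_X [OF ordn_X omega_X zer_X]])

lemma elts_Lset: "x \<in> X \<Longrightarrow> Ord x \<Longrightarrow> elts (Lset x) = L x"
proof (induction x rule: hset_induct)
  case (1 x)
  let ?D = "DefO one omega zer"
  let ?f = "lam x Lset"
  have e: "(\<lambda>_. zer) \<in> envs X" using zer_X by (simp add: envs_def)
  have fX: "?f \<in> X"
    using lam_hrec_X [of "\<lambda>e. LG one omega zer", OF USig_LG LG_X [OF ordn_X omega_X zer_X] e 1(2,3)]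
    unfolding Lset_def .
  have rs: "elts (rs ?f) = Lset ` elts x"
    unfolding elts_rs_X [OF fX] elts_lam by auto
  have LX: "Lset y \<in> X" if "y \<in> elts x" for y
    using Lset_X trsD [OF 1(2) that] Ord_mem [OF 1(3) that] by blast
  have gX: "lam (rs ?f) ?D \<in> X" by (intro lam_DefO_X ordn_X omega_X zer_X rs_X fX)
  have "elts (Lset x) = elts (ranU (lam (rs ?f) ?D))"
    unfolding Lset_def by (subst hrec_eq) (simp only: LG_def)
  also have "\<dots> = {P. \<exists>y\<in>elts x. P \<in> elts (?D (Lset y))}"
    unfolding elts_ranU_X [OF gX] elts_lam [of "rs ?f"] rs by auto
  also have "\<dots> = {P. \<exists>y\<in>elts x. definable (\<lambda>_. True) (L y) (elts P)}"
  proof -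
    have "elts (?D (Lset y)) = {P. definable (\<lambda>_. True) (L y) (elts P)}" if "y \<in> elts x" for y
      using elts_DefO_eq [OF LX [OF that]] 1(1) [OF that trsD [OF 1(2) that] Ord_mem [OF 1(3) that]] by simp
    then show ?thesis by auto
  qed
  also have "\<dots> = L x" by (subst (2) L.simps) simp
  finally show ?case .
qed

section \<open>Collection\<close>

text \<open>Replacement wants a function, and the least \<sigma> for which
  \<open>Lset \<sigma>\<close> contains a witness for \<open>x\<close> is one. It is Sigma_1 because
  \<open>Lset\<close> is and because the quantifier over smaller ordinals in the leastness clause
  falls under \<open>USig_ball\<close>. The union of the values is the desired bound.\<close>

lemma collection:
  assumes Q: "Dfn Delta0 X Q" and e: "e \<in> envs X" and a: "a \<in> X"
    and ex: "\<And>x. x \<in> elts a \<Longrightarrow> \<exists>w\<in>X. Q (case_nat w (case_nat x e))"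
  shows "\<exists>\<sigma>\<in>elts \<alpha>. \<forall>x\<in>elts a. \<exists>w\<in>elts (Lset \<sigma>). Q (case_nat w (case_nat x e))"
proof -
  have 1: "Dfn Delta0 X (\<lambda>e. Q (case_nat (e 0) (case_nat (e (Suc (Suc 0))) (\<lambda>n. e (Suc (Suc (Suc (Suc n))))))))"
    by (rule Dfn_sub [OF _ Q, of "case_nat 0 (case_nat 2 (\<lambda>n. n + 4))"])
      (auto simp: inj_def fun_eq_iff numeral_eq_Suc split: nat.splits)
  have 2: "Dfn Delta0 X (\<lambda>e. Q (case_nat (e 0) (case_nat (e (Suc (Suc (Suc 0)))) (\<lambda>n. e (Suc (Suc (Suc (Suc (Suc n)))))))))"
    by (rule Dfn_sub [OF _ Q, of "case_nat 0 (case_nat 3 (\<lambda>n. n + 5))"])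
      (auto simp: inj_def fun_eq_iff numeral_eq_Suc split: nat.splits)
  have A: "USig (\<lambda>e. \<exists>Z\<in>X. (Ord (e (Suc 0)) \<and> Lset (e (Suc 0)) = Z) \<and> (\<exists>w\<in>elts Z. Q (case_nat w (case_nat (e 0) (\<lambda>n. e (Suc (Suc n)))))))"
    apply (rule USig_ex1)
     apply (rule USig_and [OF USig_Lset USig_Del])
     apply (rule D_bex [OF dc_simps(1)])
     apply (rule 1)
    apply (elim conjE)
    apply (simp only:)
    done
  have B': "USig (\<lambda>e. \<exists>Z\<in>X. (Ord (e 0) \<and> Lset (e 0) = Z) \<and> \<not> (\<exists>w\<in>elts Z. Q (case_nat w (case_nat (e (Suc 0)) (\<lambda>n. e (Suc (Suc (Suc n))))))))"
    apply (rule USig_ex1)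
     apply (rule USig_and [OF USig_Lset USig_Del])
     apply (rule Dfn_neg [OF dc_simps(1)])
     apply (rule D_bex [OF dc_simps(1)])
     apply (rule 2)
    apply (elim conjE)
    apply (simp only:)
    done
  have B: "USig (\<lambda>e. \<forall>\<eta>\<in>elts (e (Suc 0)). \<exists>Z\<in>X. (Ord \<eta> \<and> Lset \<eta> = Z) \<and> \<not> (\<exists>w\<in>elts Z. Q (case_nat w (case_nat (e 0) (\<lambda>n. e (Suc (Suc n)))))))"
    by (rule USig_ball) (rule B')
  let ?ok = "\<lambda>x \<sigma>. \<exists>w\<in>elts (Lset \<sigma>). Q (case_nat w (case_nat x e))"
  have LX: "Ord \<sigma> \<Longrightarrow> \<sigma> \<in> X \<Longrightarrow> Lset \<sigma> \<in> X" for \<sigma> using Lset_X by blast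
  have R: "((\<exists>Z\<in>X. (Ord \<sigma> \<and> Lset \<sigma> = Z) \<and> (\<exists>w\<in>elts Z. Q (case_nat w (case_nat x e)))) \<and>
      (\<forall>\<eta>\<in>elts \<sigma>. \<exists>Z\<in>X. (Ord \<eta> \<and> Lset \<eta> = Z) \<and> \<not> (\<exists>w\<in>elts Z. Q (case_nat w (case_nat x e))))) \<longleftrightarrow>
      Ord \<sigma> \<and> ?ok x \<sigma> \<and> (\<forall>\<eta>\<in>elts \<sigma>. \<not> ?ok x \<eta>)" if \<sigma>: "\<sigma> \<in> X" for \<sigma> x
  proof (cases "Ord \<sigma>")
    case True
    have "Ord \<eta> \<and> Lset \<eta> \<in> X" if "\<eta> \<in> elts \<sigma>" for \<eta>
      using LX Ord_mem [OF True that] trsD [OF \<sigma> that] by blast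
    then show ?thesis using LX [OF True \<sigma>] True by auto
  qed auto
  have "\<exists>!\<sigma>. \<sigma> \<in> X \<and> Ord \<sigma> \<and> ?ok x \<sigma> \<and> (\<forall>\<eta>\<in>elts \<sigma>. \<not> ?ok x \<eta>)" if x: "x \<in> elts a" for x
  proof -
    obtain w where w: "w \<in> X" "Q (case_nat w (case_nat x e))" using ex [OF x] by blast
    obtain \<gamma> where \<gamma>: "\<gamma> \<in> elts \<alpha>" "w \<in> L \<gamma>" using X_dir [of "{w}"] w(1) by auto
    have ok: "?ok x \<gamma>" using elts_Lset [OF alpha_X [OF \<gamma>(1)] Ord_in_alpha [OF \<gamma>(1)]] \<gamma>(2) w(2) by blast
    obtain \<sigma> where \<sigma>: "?ok x \<sigma>" "Ord \<sigma>" "\<And>c. c \<in> elts \<sigma> \<Longrightarrow> \<not> ?ok x c" "\<And>c. ?ok x c \<Longrightarrow> Ord c \<Longrightarrow> elts \<sigma> \<subseteq> elts c"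
      using Ord_least [of "?ok x", OF ok Ord_in_alpha [OF \<gamma>(1)]] by blast
    have "elts \<sigma> \<subseteq> elts \<gamma>" using \<sigma>(4) ok Ord_in_alpha [OF \<gamma>(1)] by blast
    then have "\<sigma> \<in> elts \<alpha>"
      using Ord_subset_iff [OF \<sigma>(2) Ord_in_alpha [OF \<gamma>(1)]] \<gamma>(1) Ord_trans [OF Ord_alpha] by blast
    then have "\<sigma> \<in> X" using alpha_X by blast
    show ?thesis
    proof (rule ex1I [of _ \<sigma>])
      show "\<sigma> \<in> X \<and> Ord \<sigma> \<and> ?ok x \<sigma> \<and> (\<forall>\<eta>\<in>elts \<sigma>. \<not> ?ok x \<eta>)" using \<sigma> \<open>\<sigma> \<in> X\<close> by blast
      fix \<tau> assume \<tau>: "\<tau> \<in> X \<and> Ord \<tau> \<and> ?ok x \<tau> \<and> (\<forall>\<eta>\<in>elts \<tau>. \<not> ?ok x \<eta>)"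
      then show "\<tau> = \<sigma>" using Ord_linear [of \<tau> \<sigma>] \<sigma>(1,2,3) by blast
    qed
  qed
  note ex1 = this
  let ?big = "\<lambda>x \<sigma>. (\<exists>Z\<in>X. (Ord \<sigma> \<and> Lset \<sigma> = Z) \<and> (\<exists>w\<in>elts Z. Q (case_nat w (case_nat x e)))) \<and>
      (\<forall>\<eta>\<in>elts \<sigma>. \<exists>Z\<in>X. (Ord \<eta> \<and> Lset \<eta> = Z) \<and> \<not> (\<exists>w\<in>elts Z. Q (case_nat w (case_nat x e))))"
  have rep: "(\<And>x. x \<in> elts a \<Longrightarrow> \<exists>!\<sigma>. \<sigma> \<in> X \<and> ?big x \<sigma>) \<Longrightarrow> inX {\<sigma> \<in> X. \<exists>x\<in>elts a. ?big x \<sigma>}"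
    using replacement_X [OF USig_Sig [OF USig_and [OF A B]] e a] by simp
  have eqv: "\<sigma> \<in> X \<and> ?big x \<sigma> \<longleftrightarrow> \<sigma> \<in> X \<and> Ord \<sigma> \<and> ?ok x \<sigma> \<and> (\<forall>\<eta>\<in>elts \<sigma>. \<not> ?ok x \<eta>)" for x \<sigma>
    using R by (rule conj_cong [OF refl])
  have "inX {\<sigma> \<in> X. \<exists>x\<in>elts a. ?big x \<sigma>}"
    by (rule rep) (simp only: eqv ex1)
  moreover have "{\<sigma> \<in> X. \<exists>x\<in>elts a. ?big x \<sigma>} = {\<sigma> \<in> X. \<exists>x\<in>elts a. Ord \<sigma> \<and> ?ok x \<sigma> \<and> (\<forall>\<eta>\<in>elts \<sigma>. \<not> ?ok x \<eta>)}"
    by (rule Collect_cong, rule conj_cong [OF refl], rule bex_cong [OF refl]) (rule R)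
  ultimately have "inX {\<sigma> \<in> X. \<exists>x\<in>elts a. Ord \<sigma> \<and> ?ok x \<sigma> \<and> (\<forall>\<eta>\<in>elts \<sigma>. \<not> ?ok x \<eta>)}"
    by (simp only:)
  then obtain b where b: "b \<in> X" "elts b = {\<sigma> \<in> X. \<exists>x\<in>elts a. Ord \<sigma> \<and> ?ok x \<sigma> \<and> (\<forall>\<eta>\<in>elts \<sigma>. \<not> ?ok x \<eta>)}"
    by (rule inXE)
  have Os: "Ord (hUnion b)"
  proof (rule OrdI)
    fix \<beta> assume "\<beta> \<in> elts (hUnion b)"
    then obtain \<sigma> where \<sigma>: "\<sigma> \<in> elts b" "\<beta> \<in> elts \<sigma>" by auto
    then have "Ord \<sigma>" using b(2) by blast
    then show "Ord \<beta>" "elts \<beta> \<subseteq> elts (hUnion b)" using \<sigma> Ord_mem Ord_elts_subset by (blast, fastforce)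
  qed
  then have s: "hUnion b \<in> elts \<alpha>" using hUnion_X [OF b(1)] Ord_X_iff by blast
  show ?thesis
  proof (rule bexI [OF _ s], rule ballI)
    fix x assume x: "x \<in> elts a"
    obtain \<sigma> where \<sigma>: "\<sigma> \<in> elts b" "Ord \<sigma>" "?ok x \<sigma>" "\<sigma> \<in> X"
      using ex1 [OF x] x b(2) by blast
    have "elts \<sigma> \<subseteq> elts (hUnion b)" using \<sigma>(1) by auto
    then have "elts (Lset \<sigma>) \<subseteq> elts (Lset (hUnion b))"
      using L_mono elts_Lset [OF \<sigma>(4,2)] elts_Lset [OF hUnion_X [OF b(1)] Os] by blast
    then show "?ok x (hUnion b)" using \<sigma>(3) by blast
  qed
qed

text \<open>By collection one level contains witnesses for all \<open>x\<close>, and this level is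
  the single witness of the new predicate. The witnesses no longer have to be unique.\<close>

lemma Sig_ball:
  assumes "Sig (\<lambda>e. P (e 0) (\<lambda>n. e (Suc n)))"
  shows "Sig (\<lambda>e. \<forall>x\<in>elts (e i). P x e)"
  using assms
proof (rule SigE)
  fix Q assume Q: "Dfn Delta0 X Q"
    "\<And>e. e \<in> envs X \<Longrightarrow> P (e 0) (\<lambda>n. e (Suc n)) \<longleftrightarrow> (\<exists>w\<in>X. Q (case_nat w e))"
  have Q2: "P x e \<longleftrightarrow> (\<exists>w\<in>X. Q (case_nat w (case_nat x e)))" if "e \<in> envs X" "x \<in> X" for x e
    using Q(2) [of "case_nat x e"] that by simp
  let ?Q = "\<lambda>e. \<forall>x\<in>elts (e (Suc i)). \<exists>w\<in>elts (e 0). Q (case_nat w (case_nat x (\<lambda>n. e (Suc n))))"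
  show ?thesis
  proof (rule SigI)
    have "Dfn Delta0 X (\<lambda>e. Q (case_nat (e 0) (case_nat (e (Suc 0)) (\<lambda>n. e (Suc (Suc (Suc n)))))))"
      by (rule Dfn_sub [OF _ Q(1), of "case_nat 0 (case_nat 1 (\<lambda>n. n + 3))"])
        (auto simp: inj_def fun_eq_iff numeral_eq_Suc split: nat.splits)
    then show "Dfn Delta0 X ?Q" by (intro D_intros)
    show "(\<forall>x\<in>elts (e i). P x e) \<longleftrightarrow> (\<exists>w\<in>X. ?Q (case_nat w e))" if e: "e \<in> envs X" for e
    proof
      assume *: "\<forall>x\<in>elts (e i). P x e"
      have "\<exists>w\<in>X. Q (case_nat w (case_nat x e))" if "x \<in> elts (e i)" for x
        using * that Q2 [OF e trsD [OF envsD [OF e] that]] by blast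
      from collection [OF Q(1) e envsD [OF e] this]
      obtain \<sigma> where "\<sigma> \<in> elts \<alpha>" "\<forall>x\<in>elts (e i). \<exists>w\<in>elts (Lset \<sigma>). Q (case_nat w (case_nat x e))" by blast
      then show "\<exists>w\<in>X. ?Q (case_nat w e)"
        using Lset_X [OF alpha_X Ord_in_alpha] by (intro bexI [of _ "Lset \<sigma>"]) auto
    next
      assume "\<exists>w\<in>X. ?Q (case_nat w e)"
      then obtain b where b: "b \<in> X" "\<forall>x\<in>elts (e i). \<exists>w\<in>elts b. Q (case_nat w (case_nat x e))" by auto
      show "\<forall>x\<in>elts (e i). P x e"
      proof
        fix x assume x: "x \<in> elts (e i)"
        then show "P x e" using b trsD [OF b(1)] Q2 [OF e trsD [OF envsD [OF e] x]] by blast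
      qed
    qed
  qed
qed

section \<open>Condensation\<close>

text \<open>A list has finitely many entries, so \<omega> rounds of closing off suffice, and each
  round keeps the set countable. The index type will consist of formulas and numbers.\<close>

lemma countable_closure:
  fixes F :: "'i :: countable \<Rightarrow> 'b list \<Rightarrow> 'b"
  assumes "countable S"
  shows "\<exists>H. countable H \<and> S \<subseteq> H \<and> (\<forall>i l. set l \<subseteq> H \<longrightarrow> F i l \<in> H)"
proof -
  define h where "h = rec_nat S (\<lambda>_ H. H \<union> (\<Union>i. F i ` lists H))"
  have h: "h 0 = S" "\<And>n. h (Suc n) = h n \<union> (\<Union>i. F i ` lists (h n))" by (simp_all add: h_def)
  have "countable (h n)" for n
    by (induction n) (simp_all add: h assms)
  moreover have mono: "h m \<subseteq> h n" if "m \<le> n" for m n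
    by (rule lift_Suc_mono_le [OF _ that]) (auto simp: h)
  have "\<exists>n. set l \<subseteq> h n" if "set l \<subseteq> (\<Union>n. h n)" for l
    using that
  proof (induction l)
    case (Cons x l)
    then obtain m n where "x \<in> h m" "set l \<subseteq> h n" by auto
    then have "set (x # l) \<subseteq> h (max m n)" using mono [of m "max m n"] mono [of n "max m n"] by auto
    then show ?case by blast
  qed auto
  then have "F i l \<in> (\<Union>n. h n)" if l: "set l \<subseteq> (\<Union>n. h n)" for i l
  proof -
    obtain n where "set l \<subseteq> h n" using l \<open>\<And>l. set l \<subseteq> _ \<Longrightarrow> \<exists>n. set l \<subseteq> h n\<close> by blast
    then have "F i l \<in> h (Suc n)" unfolding h by (intro UnI2 UN_I [of i] imageI) auto
    then show ?thesis by blast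
  qed
  moreover have "S \<subseteq> (\<Union>n. h n)" using h(1) by blast
  ultimately show ?thesis by (intro exI [of _ "\<Union>n. h n"]) simp
qed

lemma sat_iso:
  assumes "inj_on \<pi> K" "\<And>x y. x \<in> K \<Longrightarrow> y \<in> K \<Longrightarrow> \<pi> x \<in> elts (\<pi> y) \<longleftrightarrow> x \<in> elts y"
  shows "\<forall>i\<in>fv \<phi>. e i \<in> K \<Longrightarrow> sat K \<phi> e \<longleftrightarrow> sat (\<pi> ` K) \<phi> (\<lambda>i. \<pi> (e i))"
proof (induction \<phi> arbitrary: e)
  case (Ex i \<phi>)
  have "sat K \<phi> (e(i := x)) \<longleftrightarrow> sat (\<pi> ` K) \<phi> ((\<lambda>i. \<pi> (e i))(i := \<pi> x))" if x: "x \<in> K" for x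
  proof -
    have "sat K \<phi> (e(i := x)) \<longleftrightarrow> sat (\<pi> ` K) \<phi> (\<lambda>j. \<pi> ((e(i := x)) j))"
      by (rule Ex.IH) (use Ex.prems x in auto)
    moreover have "(\<lambda>j. \<pi> ((e(i := x)) j)) = (\<lambda>i. \<pi> (e i))(i := \<pi> x)" by auto
    ultimately show ?thesis by simp
  qed
  then show ?case by simp
next
  case (Mem i j)
  then show ?case using assms(2) by simp
next
  case (Eq i j)
  then show ?case using assms(1) by (simp add: inj_on_eq_iff)
qed auto

text \<open>Only the finitely many free variables of a formula matter, so environments can be given
  by lists, the kind of argument that the operations of \<open>countable_closure\<close> take.
  Beyond the list the value is \<open>zer\<close>.\<close>

definition evl :: "'a hset list \<Rightarrow> nat \<Rightarrow> 'a hset" where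
  "evl p n = (if n < length p then p ! n else zer)"

definition decp :: "'a hset \<Rightarrow> 'a hset \<Rightarrow> 'a hset \<times> fm \<times> 'a hset list \<Rightarrow> bool" where
  "decp x \<gamma> t = (case t of (\<delta>, \<phi>, p) \<Rightarrow> \<delta> \<in> elts \<gamma> \<and>
    elts x = {y \<in> L \<delta>. sat (L \<delta>) \<phi> ((evl p)(0 := y))} \<and> (\<forall>i\<in>fv \<phi> - {0}. evl p i \<in> L \<delta>))"

text \<open>
  Closure under these operations yields a countable \<open>H\<close> such that \<open>H \<inter> L \<delta>\<close> is an elementary
  substructure of \<open>L \<delta>\<close> for all \<open>\<delta> \<in> H\<close>, and such that every \<open>x \<in> H\<close> is defined over some
  \<open>L \<delta>\<close> from parameters that also belong to \<open>H\<close>.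
\<close>

definition op :: "nat \<times> fm \<times> nat \<Rightarrow> 'a hset list \<Rightarrow> 'a hset" where
  "op t l = (case t of (k, \<phi>, i) \<Rightarrow>
    if k = 0 then (SOME x. x \<in> L (hd l) \<and> sat (L (hd l)) \<phi> ((evl (tl l))(i := x)))
    else if k = 1 then mk {y \<in> L (hd l). sat (L (hd l)) \<phi> ((evl (tl l))(0 := y))}
    else if k = 2 then fst (SOME t. decp (l ! 0) (l ! 1) t)
    else evl (snd (snd (SOME t. decp (l ! 0) (l ! 1) t))) i)"

lemma evl_list:
  assumes "finite I" "\<And>i. i \<in> I \<Longrightarrow> e i \<in> H" "zer \<in> H"
  obtains p where "set p \<subseteq> H" "\<And>i. i \<in> I \<Longrightarrow> evl p i = e i"
proof -
  obtain k where k: "\<And>n. n \<in> I \<Longrightarrow> n < k"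
    using assms(1) by (meson finite_nat_bounded lessThan_iff subset_iff)
  show ?thesis
    by (rule that [of "map (\<lambda>i. if i \<in> I then e i else zer) [0..<k]"])
      (use assms k in \<open>auto simp: evl_def\<close>)
qed

text \<open>A countable hull \<open>H\<close> that includes \<open>S\<close> collapses
  \<open>L \<alpha>\<close> to some \<open>L \<beta>\<close>, with \<beta> countable and hence below
  \<alpha>. The same formula, with collapsed parameters, defines the collapse of the given set over
  \<open>L \<beta>\<close>; since \<open>S\<close> is transitive and included in \<open>H\<close>,
  its elements are not moved. No bound on the complexity of the formula is involved.\<close>

lemma condensation:
  assumes S: "countable S" "S \<subseteq> X" "\<And>x. x \<in> S \<Longrightarrow> elts x \<subseteq> S"
    and P: "Dfn (\<lambda>_. True) X P" and e: "e \<in> envs X" and sub: "{x \<in> X. P (case_nat x e)} \<subseteq> S"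
  shows "inX {x \<in> X. P (case_nat x e)}"
proof (rule Dfn_definable [OF rc_dc [OF dc_simps(2)] P e])
  fix \<phi>0 e0 assume \<phi>0: "e0 \<in> envs X" "\<And>x. x \<in> X \<Longrightarrow> P (case_nat x e) = sat X \<phi>0 (e0(0 := x))"
  \<comment> \<open>\<alpha> itself is put into \<open>H\<close>, so that \<open>L \<alpha>\<close>
    is among the levels treated below and the collapse of \<alpha> names the level it is mapped
    to.\<close>
  have "countable (S \<union> {\<alpha>, zer} \<union> e0 ` fv \<phi>0)"
    using S(1) finite_fv [of \<phi>0] by (simp add: countable_finite)
  then obtain H where H: "countable H" "S \<union> {\<alpha>, zer} \<union> e0 ` fv \<phi>0 \<subseteq> H" "\<And>t l. set l \<subseteq> H \<Longrightarrow> op t l \<in> H"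
    using countable_closure [of "S \<union> {\<alpha>, zer} \<union> e0 ` fv \<phi>0" op] by blast
  have zH: "zer \<in> H" and aH: "\<alpha> \<in> H" using H(2) by auto
  define A where "A = H \<inter> insert \<alpha> (elts \<alpha>)"
  have A_sub: "elts \<gamma> \<subseteq> elts \<alpha>" "Ord \<gamma>" "L \<gamma> \<subseteq> X" if "\<gamma> \<in> A" for \<gamma>
    using that Ord_elts_subset [OF Ord_alpha] Ord_alpha Ord_in_alpha L_mono unfolding A_def by (blast, blast, blast)
  have A_down: "\<delta> \<in> A" if "\<gamma> \<in> A" "\<delta> \<in> H" "\<delta> \<in> elts \<gamma>" for \<gamma> \<delta>
    using that A_sub(1) unfolding A_def by blast
  \<comment> \<open>The Tarski-Vaught criterion, with operation 0 as the Skolem function for the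
    formula in question.\<close>
  have TV: "\<forall>i\<in>fv \<phi>. e i \<in> H \<inter> L \<gamma> \<Longrightarrow> sat (L \<gamma>) \<phi> e \<longleftrightarrow> sat (H \<inter> L \<gamma>) \<phi> e" if \<gamma>: "\<gamma> \<in> A" for \<gamma> \<phi> e
  proof (induction \<phi> arbitrary: e)
    case (Ex i \<phi>)
    have IH: "sat (L \<gamma>) \<phi> (e(i := x)) \<longleftrightarrow> sat (H \<inter> L \<gamma>) \<phi> (e(i := x))" if "x \<in> H \<inter> L \<gamma>" for x
      by (rule Ex.IH) (use Ex.prems that in auto)
    have "\<exists>x\<in>H \<inter> L \<gamma>. sat (L \<gamma>) \<phi> (e(i := x))" if ex: "\<exists>x\<in>L \<gamma>. sat (L \<gamma>) \<phi> (e(i := x))"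
    proof -
      obtain p where p: "set p \<subseteq> H" "\<And>j. j \<in> fv \<phi> - {i} \<Longrightarrow> evl p j = e j"
        by (rule evl_list [of "fv \<phi> - {i}" e H]) (use finite_fv Ex.prems zH in auto)
      have eq: "sat (L \<gamma>) \<phi> ((evl p)(i := x)) \<longleftrightarrow> sat (L \<gamma>) \<phi> (e(i := x))" for x
        by (rule sat_cong) (use p(2) in auto)
      let ?x = "op (0, \<phi>, i) (\<gamma> # p)"
      have "?x \<in> L \<gamma> \<and> sat (L \<gamma>) \<phi> ((evl p)(i := ?x))"
        unfolding op_def by simp (rule someI_ex, use ex eq in blast)
      moreover have "?x \<in> H" using \<gamma> p(1) by (intro H(3)) (auto simp: A_def)
      ultimately show ?thesis using eq by blast
    qed
    then show ?case using IH by auto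
  qed auto
  \<comment> \<open>Formulas are not hsets, so only the level and the parameters have to be found in
    \<open>H\<close>. Operations 2 and 3 read them off one and the same chosen decomposition of
    \<open>x\<close>.\<close>
  have dec: "\<exists>\<delta> \<phi> e. \<delta> \<in> H \<and> \<delta> \<in> elts \<gamma> \<and> elts x = {y \<in> L \<delta>. sat (L \<delta>) \<phi> (e(0 := y))} \<and> (\<forall>i\<in>fv \<phi> - {0}. e i \<in> H \<inter> L \<delta>)"
    if \<gamma>: "\<gamma> \<in> A" and x: "x \<in> H \<inter> L \<gamma>" for x \<gamma>
  proof -
    obtain \<beta> \<phi> e where \<beta>: "\<beta> \<in> elts \<gamma>" "\<forall>i\<in>fv \<phi> - {0}. e i \<in> L \<beta>" "elts x = {y \<in> L \<beta>. sat (L \<beta>) \<phi> (e(0 := y))}"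
      using L_memE [of x \<gamma>] x unfolding definable_def by (metis IntD2)
    obtain p where p: "\<And>j. j \<in> fv \<phi> - {0} \<Longrightarrow> evl p j = e j"
      by (rule evl_list [of "fv \<phi> - {0}" e UNIV]) (use finite_fv in auto)
    have eq: "sat (L \<beta>) \<phi> ((evl p)(0 := y)) \<longleftrightarrow> sat (L \<beta>) \<phi> (e(0 := y))" for y
      by (rule sat_cong) (use p in auto)
    have "decp x \<gamma> (\<beta>, \<phi>, p)" unfolding decp_def using \<beta> eq p by simp
    then have d: "decp x \<gamma> (SOME t. decp x \<gamma> t)" by (rule someI)
    obtain \<delta> \<psi> q where t: "(SOME t. decp x \<gamma> t) = (\<delta>, \<psi>, q)" by (metis prod_cases3)
    have \<gamma>H: "\<gamma> \<in> H" using \<gamma> by (simp add: A_def)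
    have "op (2, \<psi>, 0) [x, \<gamma>] \<in> H" using x \<gamma>H by (intro H(3)) auto
    then have "\<delta> \<in> H" by (simp add: op_def t)
    moreover have "evl q i \<in> H" for i
    proof -
      have "op (3, \<psi>, i) [x, \<gamma>] \<in> H" using x \<gamma>H by (intro H(3)) auto
      then show ?thesis by (simp add: op_def t)
    qed
    moreover have "\<delta> \<in> elts \<gamma> \<and> elts x = {y \<in> L \<delta>. sat (L \<delta>) \<psi> ((evl q)(0 := y))} \<and> (\<forall>i\<in>fv \<psi> - {0}. evl q i \<in> L \<delta>)"
      using d unfolding t unfolding decp_def prod.case .
    ultimately show ?thesis by (intro exI [of _ \<delta>] exI [of _ \<psi>] exI [of _ "evl q"]) blast
  qed
  let ?\<pi> = "clps H"
  \<comment> \<open>The formula says that some element distinguishes \<open>x\<close> from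
    \<open>y\<close>. It holds in \<open>L \<alpha>\<close>, so by elementarity a distinguishing
    element already exists in \<open>H\<close>; this extensionality makes the collapse
    injective.\<close>
  have ext: "\<exists>z\<in>H. z \<in> elts x \<longleftrightarrow> z \<notin> elts y" if xy: "x \<in> H \<inter> X" "y \<in> H \<inter> X" "x \<noteq> y" for x y
  proof -
    let ?\<phi> = "Ex 2 (Neg (And (Neg (And (Mem 2 0) (Neg (Mem 2 1)))) (Neg (And (Mem 2 1) (Neg (Mem 2 0))))))"
    let ?e = "(\<lambda>_. x)(1 := y)"
    have "elts x \<noteq> elts y" using xy(3) hset_eqI by blast
    then obtain z where "z \<in> elts x \<longleftrightarrow> z \<notin> elts y" by blast
    moreover from this have "z \<in> X" using xy trsD by blast
    ultimately have "sat X ?\<phi> ?e" by auto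
    moreover have "\<alpha> \<in> A" using aH by (simp add: A_def)
    ultimately have "sat (H \<inter> X) ?\<phi> ?e" using TV [of \<alpha> ?\<phi> ?e] xy by auto
    then show ?thesis by auto
  qed
  have inj': "x \<in> H \<inter> X \<Longrightarrow> y \<in> H \<inter> X \<Longrightarrow> ?\<pi> x = ?\<pi> y \<Longrightarrow> x = y" for x y
  proof (induction x arbitrary: y rule: hset_induct)
    case (1 x)
    show ?case
    proof (rule ccontr)
      assume "x \<noteq> y"
      then obtain z where z: "z \<in> H" "z \<in> elts x \<longleftrightarrow> z \<notin> elts y" using ext 1 by blast
      show False
      proof (cases "z \<in> elts x")
        case True
        then have "?\<pi> z \<in> elts (?\<pi> y)" using clps_mono_mem [OF z(1) True] 1(4) by simp
        then obtain w where w: "w \<in> H" "w \<in> elts y" "?\<pi> z = ?\<pi> w" unfolding elts_clps by blast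
        have "z = w" by (rule 1(1) [OF True _ _ w(3)]) (use z(1) True w 1(2,3) trsD in blast)+
        then show False using z True w by blast
      next
        case False
        then have zy: "z \<in> elts y" using z by blast
        then have "?\<pi> z \<in> elts (?\<pi> x)" using clps_mono_mem [OF z(1) zy] 1(4) by simp
        then obtain w where w: "w \<in> H" "w \<in> elts x" "?\<pi> z = ?\<pi> w" unfolding elts_clps by blast
        have "w = z" by (rule 1(1) [OF w(2) _ _ w(3) [symmetric]]) (use z(1) zy w 1(2,3) trsD in blast)+
        then show False using False w by blast
      qed
    qed
  qed
  have inj: "inj_on ?\<pi> (H \<inter> L \<gamma>)" if "\<gamma> \<in> A" for \<gamma>
    using inj' A_sub(3) [OF that] by (intro inj_onI) blast
  have mem: "?\<pi> x \<in> elts (?\<pi> y) \<longleftrightarrow> x \<in> elts y" if "x \<in> H \<inter> X" "y \<in> H \<inter> X" for x y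
  proof
    assume "?\<pi> x \<in> elts (?\<pi> y)"
    then obtain w where w: "w \<in> H" "w \<in> elts y" "?\<pi> x = ?\<pi> w" unfolding elts_clps by blast
    moreover have "w \<in> X" using w that trsD by blast
    ultimately show "x \<in> elts y" using inj' that by blast
  qed (use that clps_mono_mem in blast)
  have sat_eq: "sat (L \<gamma>) \<phi> e \<longleftrightarrow> sat (?\<pi> ` (H \<inter> L \<gamma>)) \<phi> (\<lambda>i. ?\<pi> (e i))" if "\<gamma> \<in> A" "\<forall>i\<in>fv \<phi>. e i \<in> H \<inter> L \<gamma>" for \<gamma> \<phi> e
    using TV [OF that] sat_iso [OF inj [OF that(1)] mem that(2)] A_sub(3) [OF that(1)] by blast
  have def: "{z \<in> ?\<pi> ` (H \<inter> L \<delta>). sat (?\<pi> ` (H \<inter> L \<delta>)) \<phi> ((\<lambda>i. ?\<pi> (e i))(0 := z))} =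
      ?\<pi> ` {y \<in> H \<inter> L \<delta>. sat (L \<delta>) \<phi> (e(0 := y))}"
    if \<delta>: "\<delta> \<in> A" and e: "\<forall>i\<in>fv \<phi> - {0}. e i \<in> H \<inter> L \<delta>" for \<delta> \<phi> e
  proof -
    have "sat (?\<pi> ` (H \<inter> L \<delta>)) \<phi> ((\<lambda>i. ?\<pi> (e i))(0 := ?\<pi> y)) \<longleftrightarrow> sat (L \<delta>) \<phi> (e(0 := y))" if y: "y \<in> H \<inter> L \<delta>" for y
    proof -
      have "(\<lambda>i. ?\<pi> (e i))(0 := ?\<pi> y) = (\<lambda>i. ?\<pi> ((e(0 := y)) i))" by auto
      then show ?thesis using sat_eq [OF \<delta>, of \<phi> "e(0 := y)"] e y by simp
    qed
    then show ?thesis by blast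
  qed
  \<comment> \<open>Condensation level by level. For one inclusion, a member of \<open>H\<close> has
    a decomposition inside \<open>H\<close>, which is carried along by the collapse. For the other,
    operation 1 puts every set that is definable over a level from parameters in \<open>H\<close>
    into \<open>H\<close>.\<close>
  have main: "\<gamma> \<in> A \<Longrightarrow> ?\<pi> ` (H \<inter> L \<gamma>) = L (?\<pi> \<gamma>)" for \<gamma>
  proof (induction \<gamma> rule: hset_induct)
    case (1 \<gamma>)
    show ?case
    proof
      show "?\<pi> ` (H \<inter> L \<gamma>) \<subseteq> L (?\<pi> \<gamma>)"
      proof
        fix v assume "v \<in> ?\<pi> ` (H \<inter> L \<gamma>)"
        then obtain x where x: "x \<in> H \<inter> L \<gamma>" "v = ?\<pi> x" by blast
        obtain \<delta> \<phi> e where \<delta>: "\<delta> \<in> H" "\<delta> \<in> elts \<gamma>" "elts x = {y \<in> L \<delta>. sat (L \<delta>) \<phi> (e(0 := y))}"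
            "\<forall>i\<in>fv \<phi> - {0}. e i \<in> H \<inter> L \<delta>"
          using dec [OF 1(2) x(1)] by blast
        have \<delta>A: "\<delta> \<in> A" using A_down [OF 1(2) \<delta>(1,2)] .
        have "elts v = ?\<pi> ` {y \<in> H \<inter> L \<delta>. sat (L \<delta>) \<phi> (e(0 := y))}"
          unfolding x(2) elts_clps \<delta>(3) by (rule arg_cong [of _ _ "image ?\<pi>"]) blast
        also have "\<dots> = {z \<in> L (?\<pi> \<delta>). sat (L (?\<pi> \<delta>)) \<phi> ((\<lambda>i. ?\<pi> (e i))(0 := z))}"
          using def [OF \<delta>A \<delta>(4)] 1(1) [OF \<delta>(2) \<delta>A] by simp
        finally have "definable (\<lambda>_. True) (L (?\<pi> \<delta>)) (elts v)"
          unfolding definable_def using \<delta>(4) 1(1) [OF \<delta>(2) \<delta>A]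
          by (intro exI [of _ \<phi>] exI [of _ "\<lambda>i. ?\<pi> (e i)"]) auto
        then show "v \<in> L (?\<pi> \<gamma>)" using L_memI clps_mono_mem [OF \<delta>(1,2)] by blast
      qed
      show "L (?\<pi> \<gamma>) \<subseteq> ?\<pi> ` (H \<inter> L \<gamma>)"
      proof
        fix v assume "v \<in> L (?\<pi> \<gamma>)"
        then obtain \<xi> where \<xi>: "\<xi> \<in> elts (?\<pi> \<gamma>)" "definable (\<lambda>_. True) (L \<xi>) (elts v)" by (rule L_memE)
        then obtain \<delta> where \<delta>: "\<delta> \<in> H" "\<delta> \<in> elts \<gamma>" "\<xi> = ?\<pi> \<delta>" unfolding elts_clps by blast
        have \<delta>A: "\<delta> \<in> A" using A_down [OF 1(2) \<delta>(1,2)] .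
        have L\<xi>: "L \<xi> = ?\<pi> ` (H \<inter> L \<delta>)" using 1(1) [OF \<delta>(2) \<delta>A] \<delta>(3) by simp
        obtain \<phi> e' where \<phi>: "\<forall>i\<in>fv \<phi> - {0}. e' i \<in> L \<xi>" "elts v = {z \<in> L \<xi>. sat (L \<xi>) \<phi> (e'(0 := z))}"
          using \<xi>(2) unfolding definable_def by blast
        have "\<forall>i\<in>fv \<phi> - {0}. \<exists>x. x \<in> H \<inter> L \<delta> \<and> ?\<pi> x = e' i"
        proof
          fix i assume "i \<in> fv \<phi> - {0}"
          then have "e' i \<in> ?\<pi> ` (H \<inter> L \<delta>)" using \<phi>(1) L\<xi> by simp
          then show "\<exists>x. x \<in> H \<inter> L \<delta> \<and> ?\<pi> x = e' i" by (elim imageE) (intro exI conjI, assumption, simp)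
        qed
        from bchoice [OF this]
        obtain e where e: "\<forall>i\<in>fv \<phi> - {0}. e i \<in> H \<inter> L \<delta> \<and> ?\<pi> (e i) = e' i" by (elim exE)
        obtain p where p: "set p \<subseteq> H" "\<And>j. j \<in> fv \<phi> - {0} \<Longrightarrow> evl p j = e j"
          by (rule evl_list [of "fv \<phi> - {0}" e H]) (use finite_fv e zH in auto)
        let ?x = "op (1, \<phi>, 0) (\<delta> # p)"
        have sm: "small {y \<in> L \<delta>. sat (L \<delta>) \<phi> ((evl p)(0 := y))}"
        proof (rule small_subset [OF small_elts [of "Lset \<delta>"]])
          have "\<delta> \<in> elts \<alpha>" using A_sub(1) [OF 1(2)] \<delta>(2) by blast
          then show "{y \<in> L \<delta>. sat (L \<delta>) \<phi> ((evl p)(0 := y))} \<subseteq> elts (Lset \<delta>)"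
            using elts_Lset [OF alpha_X Ord_in_alpha] by blast
        qed
        have xe: "elts ?x = {y \<in> L \<delta>. sat (L \<delta>) \<phi> ((evl p)(0 := y))}"
          unfolding op_def using elts_mk [OF sm] by simp
        have pL: "\<forall>i\<in>fv \<phi> - {0}. evl p i \<in> H \<inter> L \<delta>" using p(2) e by simp
        have xH: "?x \<in> H" using p(1) \<delta>(1) by (intro H(3)) auto
        have "definable (\<lambda>_. True) (L \<delta>) (elts ?x)"
          unfolding definable_def using pL xe by (intro exI [of _ \<phi>] exI [of _ "evl p"]) auto
        then have xL: "?x \<in> L \<gamma>" using L_memI \<delta>(2) by blast
        have "elts (?\<pi> ?x) = ?\<pi> ` {y \<in> H \<inter> L \<delta>. sat (L \<delta>) \<phi> ((evl p)(0 := y))}"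
          unfolding elts_clps xe by (rule arg_cong [of _ _ "image ?\<pi>"]) blast
        also have "\<dots> = {z \<in> L \<xi>. sat (L \<xi>) \<phi> ((\<lambda>i. ?\<pi> (evl p i))(0 := z))}"
          using def [OF \<delta>A pL] unfolding L\<xi> by simp
        also have "\<dots> = {z \<in> L \<xi>. sat (L \<xi>) \<phi> (e'(0 := z))}"
        proof -
          have "sat (L \<xi>) \<phi> ((\<lambda>i. ?\<pi> (evl p i))(0 := z)) \<longleftrightarrow> sat (L \<xi>) \<phi> (e'(0 := z))" for z
            by (rule sat_cong) (use p(2) e in auto)
          then show ?thesis by simp
        qed
        finally have "v = ?\<pi> ?x" using \<phi>(2) by (intro hset_eqI) simp
        then show "v \<in> ?\<pi> ` (H \<inter> L \<gamma>)" using xH xL by blast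
      qed
    qed
  qed
  define \<beta> where "\<beta> = ?\<pi> \<alpha>"
  have aA: "\<alpha> \<in> A" using aH by (simp add: A_def)
  \<comment> \<open>\<beta> is an image of a subset of the countable \<open>H\<close>, so it cannot
    include the uncountable \<alpha>.\<close>
  have c\<beta>: "countable (elts \<beta>)" unfolding \<beta>_def elts_clps using H(1) by simp
  have O\<beta>: "Ord \<beta>" unfolding \<beta>_def by (rule Ord_clps [OF Ord_alpha])
  have \<beta>: "\<beta> \<in> elts \<alpha>"
  proof (rule ccontr)
    assume "\<beta> \<notin> elts \<alpha>"
    then have "elts \<alpha> \<subseteq> elts \<beta>" using Ord_not_mem_iff [OF O\<beta> Ord_alpha] by simp
    then show False using c\<beta> unc countable_subset by metis
  qed
  have L\<beta>: "L \<beta> = ?\<pi> ` (H \<inter> X)" unfolding \<beta>_def using main [OF aA] by simp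
  have fix\<pi>: "?\<pi> x = x" if "x \<in> S" for x
    by (rule clps_fix [of S]) (use S(3) H(2) that in auto)
  have e0: "\<forall>i\<in>fv \<phi>0 - {0}. e0 i \<in> H \<inter> X" using H(2) \<phi>0(1) envsD by blast
  let ?G = "{x \<in> X. P (case_nat x e)}"
  have "{z \<in> L \<beta>. sat (L \<beta>) \<phi>0 ((\<lambda>i. ?\<pi> (e0 i))(0 := z))} = ?\<pi> ` {y \<in> H \<inter> X. sat X \<phi>0 (e0(0 := y))}"
    using def [OF aA e0] unfolding L\<beta> by simp
  also have "{y \<in> H \<inter> X. sat X \<phi>0 (e0(0 := y))} = ?G" using \<phi>0(2) sub H(2) by auto
  also have "?\<pi> ` ?G = ?G"
  proof -
    have "?\<pi> ` ?G = id ` ?G" by (rule image_cong) (use fix\<pi> sub in auto)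
    then show ?thesis by simp
  qed
  finally have G: "{z \<in> L \<beta>. sat (L \<beta>) \<phi>0 ((\<lambda>i. ?\<pi> (e0 i))(0 := z))} = ?G" .
  have "definable (\<lambda>_. True) (L \<beta>) ?G"
    unfolding definable_def
  proof (intro exI conjI)
    show "\<forall>i\<in>fv \<phi>0 - {0}. ?\<pi> (e0 i) \<in> L \<beta>" using e0 L\<beta> by blast
    show "?G = {z \<in> L \<beta>. sat (L \<beta>) \<phi>0 ((\<lambda>i. ?\<pi> (e0 i))(0 := z))}" by (rule G [symmetric])
  qed simp
  moreover have "small ?G" using small_countable countable_subset [OF sub S(1)] by blast
  ultimately show ?thesis using X_definable [OF \<beta>] by blast
qed

section \<open>Positions in the complement\<close>

lemma Sig_Fm: "Sig P \<Longrightarrow> Dfn (\<lambda>_. True) X P"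
  using Sig_Sigma1 unfolding Dfn_def by blast

lemma Fm_all:
  assumes "Dfn (\<lambda>_. True) X (\<lambda>e. P (e 0) (\<lambda>n. e (Suc n)))"
  shows "Dfn (\<lambda>_. True) X (\<lambda>e. \<forall>x\<in>X. P x e)"
proof -
  have "Dfn (\<lambda>_. True) X (\<lambda>e. \<not> (\<exists>x\<in>X. \<not> P x e))"
    by (intro Dfn_neg Fm_ex assms dc_simps)
  then show ?thesis by (rule Dfn_cong) blast
qed

lemma Sigma1_Sig: "Sigma1 \<phi> \<Longrightarrow> Sig (\<lambda>e. sat X \<phi> e)"
proof (induction rule: Sigma1.induct)
  case (1 \<phi>)
  have "lay 0 p e = e" for p e :: "nat \<Rightarrow> 'a hset" by (simp add: lay_def fun_eq_iff)
  then have "Dfn Delta0 X (\<lambda>e. sat X \<phi> e)"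
    unfolding Dfn_def using 1 zer_X by (intro exI [of _ \<phi>] exI [of _ 0] exI [of _ "\<lambda>_. zer"]) (simp add: envs_def)
  then show ?case by (rule Sig_Del)
next
  case (2 \<phi> i)
  have inj: "inj (\<lambda>n. if n = i then 0 else Suc n)" by (auto simp: inj_def)
  have "(\<lambda>n. e (Suc n))(i := e 0) = (\<lambda>n. e (if n = i then 0 else Suc n))" for e :: "nat \<Rightarrow> 'a hset" by auto
  then have "Sig (\<lambda>e. sat X \<phi> ((\<lambda>n. e (Suc n))(i := e 0)))"
    using Sig_ren [OF 2(2) inj] by simp
  then have "Sig (\<lambda>e. \<exists>x\<in>X. sat X \<phi> (e(i := x)))" by (intro Sig_ex)
  then show ?case by simp
qed

text \<open>The block of existential quantifiers is contracted to a single witness, and all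
  variables other than the witness and the argument are frozen at parameters. The two remaining
  variables may then be chosen freely, as long as they differ.\<close>

lemma RE_witness:
  assumes "alpha_RE \<alpha> M"
  obtains R where "\<And>i j. i \<noteq> j \<Longrightarrow> Dfn Delta0 X (\<lambda>e. R (e i) (e j))"
    "\<And>x. x \<in> X \<Longrightarrow> x \<in> M \<longleftrightarrow> (\<exists>w\<in>X. R w x)"
proof -
  obtain \<phi> e0 where \<phi>: "Sigma1 \<phi>" "\<forall>i\<in>fv \<phi> - {0}. e0 i \<in> X" "M = {x \<in> X. sat X \<phi> (e0(0 := x))}"
    using assms unfolding alpha_RE_def definable_def by blast
  \<comment> \<open>\<open>definable\<close> only constrains the free variables, whereas an
    environment has all its values in \<open>L \<alpha>\<close>; hence the default
    \<open>zer\<close>.\<close>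
  define e where "e n = (if n \<in> fv \<phi> - {0} then e0 n else zer)" for n
  have e: "e \<in> envs X" using \<phi>(2) zer_X by (simp add: envs_def e_def)
  have sat_e: "sat X \<phi> (e0(0 := x)) = sat X \<phi> (e(0 := x))" for x
    by (rule sat_cong) (auto simp: e_def)
  show ?thesis using Sigma1_Sig [OF \<phi>(1)]
  proof (rule SigE)
    fix Q assume Q: "Dfn Delta0 X Q" "\<And>e. e \<in> envs X \<Longrightarrow> sat X \<phi> e \<longleftrightarrow> (\<exists>w\<in>X. Q (case_nat w e))"
    show ?thesis using Q(1)
    proof (rule DfnE)
      fix \<psi> k p assume \<psi>: "Delta0 \<psi>" "p \<in> envs X" "\<And>e. e \<in> envs X \<Longrightarrow> Q e = sat X \<psi> (lay k p e)"
      have env: "case_nat w (e(0 := x)) \<in> envs X" if "w \<in> X" "x \<in> X" for w x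
        using that e by (simp add: envs_def split: nat.split)
      let ?p = "\<lambda>n. if n < k then p n else e (n - k - 1)"
      let ?R = "\<lambda>w x. sat X \<psi> (lay k p (case_nat w (e(0 := x))))"
      show ?thesis
      proof (rule that [of ?R])
        fix i j :: nat assume ij: "i \<noteq> j"
        let ?s = "\<lambda>n. if n = k then Some i else if n = Suc k then Some j else None"
        have D: "Dfn Delta0 X (\<lambda>e. sat X \<psi> (\<lambda>n. case ?s n of None \<Rightarrow> ?p n | Some i \<Rightarrow> e i))"
          by (rule Dfn_formula [OF \<psi>(1)]) (use \<psi>(2) e ij in \<open>auto simp: envs_def split: if_splits\<close>)
        have "lay k p (case_nat w (e(0 := x))) n = (if n = k then w else if n = Suc k then x else ?p n)" for w x n
        proof -
          have "\<exists>m. n = k + Suc (Suc m)" if "n > Suc k" using that by presburger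
          then consider "n < k" | "n = k" | "n = Suc k" | m where "n = k + Suc (Suc m)"
            by (metis linorder_neqE_nat not_less_less_Suc_eq)
          then show ?thesis by cases (auto simp: lay_def)
        qed
        then have eq: "(\<lambda>n. case ?s n of None \<Rightarrow> ?p n | Some i \<Rightarrow> e' i) = lay k p (case_nat (e' i) (e(0 := e' j)))" for e'
          by (auto simp: fun_eq_iff)
        show "Dfn Delta0 X (\<lambda>e'. ?R (e' i) (e' j))" using D unfolding eq .
      next
        fix x assume x: "x \<in> X"
        then have "e(0 := x) \<in> envs X" using e by (simp add: envs_def)
        then have "sat X \<phi> (e(0 := x)) \<longleftrightarrow> (\<exists>w\<in>X. Q (case_nat w (e(0 := x))))" by (rule Q(2))
        also have "\<dots> \<longleftrightarrow> (\<exists>w\<in>X. ?R w x)" using \<psi>(3) [OF env [OF _ x]] by (intro bex_cong refl)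
        finally show "x \<in> M \<longleftrightarrow> (\<exists>w\<in>X. ?R w x)" using x \<phi>(3) sat_e by simp
      qed
    qed
  qed
qed

lemma alpha_REI:
  assumes "Sig (\<lambda>e. P (e 0))" "\<And>x. P x \<Longrightarrow> Ord x"
  shows "alpha_RE \<alpha> {x \<in> X. P x}"
proof -
  have "(\<lambda>_. zer) \<in> envs X" using zer_X by (simp add: envs_def)
  from Dfn_definableI [OF rc_Sigma1 Sig_Sigma1 [OF assms(1)] this]
  have "definable Sigma1 X {x \<in> X. P x}" by simp
  then show ?thesis unfolding alpha_RE_def using assms(2) Ord_X_iff by blast
qed

lemma alpha_finite_bounded:
  assumes "alpha_finite \<alpha> K" shows "\<exists>\<beta>\<in>elts \<alpha>. K \<subseteq> elts \<beta>"
proof -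
  obtain k where k: "k \<in> X" "elts k = K" "K \<subseteq> elts \<alpha>" using assms unfolding alpha_finite_def by blast
  obtain \<gamma> where \<gamma>: "\<gamma> \<in> elts \<alpha>" "k \<in> L \<gamma>" using X_dir [of "{k}"] k by auto
  have "x \<in> elts \<gamma>" if "x \<in> K" for x
    using L_Ord_imp [OF Ord_in_alpha [OF \<gamma>(1)] Ord_in_alpha] L_trans [OF Ord_in_alpha [OF \<gamma>(1)] \<gamma>(2)] k that by blast
  then show ?thesis using \<gamma>(1) by blast
qed

lemma alpha_max:
  assumes "\<beta> \<in> elts \<alpha>" "\<gamma> \<in> elts \<alpha>"
  obtains \<delta> where "\<delta> \<in> elts \<alpha>" "elts \<beta> \<subseteq> elts \<delta>" "elts \<gamma> \<subseteq> elts \<delta>"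
  using Ord_linear [OF Ord_in_alpha [OF assms(1)] Ord_in_alpha [OF assms(2)]] assms
    Ord_elts_subset [OF Ord_in_alpha] by blast

lemma alpha_fin_bound: "finite F \<Longrightarrow> F \<subseteq> elts \<alpha> \<Longrightarrow> \<exists>\<sigma>\<in>elts \<alpha>. \<forall>x\<in>F. elts x \<subseteq> elts \<sigma>"
proof (induction rule: finite_induct)
  case empty
  then show ?case using alpha_ne by blast
next
  case (insert x F)
  then obtain \<sigma> where \<sigma>: "\<sigma> \<in> elts \<alpha>" "\<forall>x\<in>F. elts x \<subseteq> elts \<sigma>" by blast
  obtain \<delta> where "\<delta> \<in> elts \<alpha>" "elts x \<subseteq> elts \<delta>" "elts \<sigma> \<subseteq> elts \<delta>"
    using alpha_max [of x \<sigma>] insert.prems \<sigma>(1) by blast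
  then show ?case using \<sigma>(2) by (intro bexI [of _ \<delta>]) auto
qed

lemma finite_subset_X: "finite S \<Longrightarrow> S \<subseteq> X \<Longrightarrow> inX S"
proof (induction rule: finite_induct)
  case empty
  show ?case using inX_elts [OF zer_X] by simp
next
  case (insert x S)
  then obtain s where "s \<in> X" "elts s = S" using inXE by blast
  then show ?case using inX_elts [OF hinsert_X [of x s]] insert.prems by simp
qed

definition injr :: "'a hset \<Rightarrow> bool" where
  "injr u \<longleftrightarrow> (\<forall>a b. pair a b \<in> elts u \<longrightarrow> (\<forall>c d. pair c d \<in> elts u \<longrightarrow> b = d \<longrightarrow> a = c))"

lemma D_injr: "dc \<Gamma> \<Longrightarrow> Dfn \<Gamma> X (\<lambda>e. injr (e i))"
  unfolding injr_def by (intro D_sets)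

text \<open>Expresses a lower bound on a cardinality by the existence of a set. \<open>u\<close> may
  relate several values to one number; choosing one of them for each number gives an injection.
  Conversely, an injection into \<open>V\<close> has a finite graph, which is an element of
  \<open>L \<alpha>\<close>.\<close>

lemma card_injr:
  assumes V: "finite V" "V \<subseteq> X"
  shows "(\<exists>u\<in>X. injr u \<and> (\<forall>l\<in>elts (ordn n). \<exists>v\<in>X. pair l v \<in> elts u \<and> v \<in> V)) \<longleftrightarrow> n \<le> card V"
proof
  assume "\<exists>u\<in>X. injr u \<and> (\<forall>l\<in>elts (ordn n). \<exists>v\<in>X. pair l v \<in> elts u \<and> v \<in> V)"
  then obtain u where u: "injr u" "\<And>l. l \<in> elts (ordn n) \<Longrightarrow> \<exists>v. pair l v \<in> elts u \<and> v \<in> V" by blast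
  have "\<forall>m\<in>{..<n}. \<exists>v. pair (ordn m) v \<in> elts u \<and> v \<in> V" using u(2) by (simp add: elts_ordn)
  then obtain f where f: "\<forall>m\<in>{..<n}. pair (ordn m) (f m) \<in> elts u \<and> f m \<in> V" by (rule bchoice [THEN exE])
  have "inj_on f {..<n}"
  proof (rule inj_onI)
    fix k m assume "k \<in> {..<n}" "m \<in> {..<n}" "f k = f m"
    then have "ordn k = (ordn m :: 'a hset)" using f u(1) unfolding injr_def by blast
    then show "k = m" by (simp add: ordn_inj)
  qed
  then have "card {..<n} \<le> card V" by (rule card_inj_on_le) (use f V in auto)
  then show "n \<le> card V" by simp
next
  assume n: "n \<le> card V"
  obtain W where W: "W \<subseteq> V" "card W = n" "finite W" using obtain_subset_with_card_n [OF n] .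
  obtain f where f: "bij_betw f {..<n} W" using ex_bij_betw_nat_finite [OF W(3)] W(2) by (auto simp: atLeast0LessThan)
  let ?U = "(\<lambda>m. pair (ordn m) (f m)) ` {..<n}"
  have fV: "f m \<in> V" if "m < n" for m using f W(1) that unfolding bij_betw_def by auto
  have "inX ?U" using V(2) fV by (intro finite_subset_X) (auto intro!: pair_X ordn_X)
  then obtain u where u: "u \<in> X" "elts u = ?U" by (rule inXE)
  have "injr u"
    unfolding injr_def u(2) using f unfolding bij_betw_def by (auto dest: inj_onD)
  moreover have "\<exists>v\<in>X. pair l v \<in> elts u \<and> v \<in> V" if l: "l \<in> elts (ordn n)" for l
  proof -
    obtain m where "m < n" "l = ordn m" using l by (auto simp: elts_ordn)
    then show ?thesis using fV V(2) u(2) by (intro bexI [of _ "f m"]) auto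
  qed
  ultimately show "\<exists>u\<in>X. injr u \<and> (\<forall>l\<in>elts (ordn n). \<exists>v\<in>X. pair l v \<in> elts u \<and> v \<in> V)" using u(1) by blast
qed

end

text \<open>
  \<open>C\<close> is the complement of the maximal set, and \<open>R w x\<close> is a \<open>\<Delta>\<^sub>0\<close> relation saying that \<open>w\<close>
  witnesses \<open>x \<in> M\<close>.
\<close>

locale maximal = adm +
  fixes M :: "'a hset set" and R :: "'a hset \<Rightarrow> 'a hset \<Rightarrow> bool"
  assumes max: "maximal_alpha_RE \<alpha> M"
    and D_R: "\<And>i j. i \<noteq> j \<Longrightarrow> Dfn Delta0 X (\<lambda>e. R (e i) (e j))"
    and R: "\<And>x. x \<in> X \<Longrightarrow> x \<in> M \<longleftrightarrow> (\<exists>w\<in>X. R w x)"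
begin

definition "C = elts \<alpha> - M"

lemma C_alpha: "x \<in> C \<Longrightarrow> x \<in> elts \<alpha>"
  by (simp add: C_def)

lemma C_iff: "x \<in> elts \<alpha> \<Longrightarrow> x \<in> C \<longleftrightarrow> \<not> (\<exists>w\<in>X. R w x)"
  using R [OF alpha_X] by (simp add: C_def)

lemma unb: "\<beta> \<in> elts \<alpha> \<Longrightarrow> \<exists>\<gamma>\<in>C. elts \<beta> \<subseteq> elts \<gamma>"
  using max unfolding maximal_alpha_RE_def unbounded_in_def C_def
  by (metis DiffD1 Ord_elts_subset Ord_in_alpha order_refl)

lemma cohesive0:
  assumes "alpha_RE \<alpha> W" "\<And>\<beta>. \<beta> \<in> elts \<alpha> \<Longrightarrow> \<exists>\<gamma>\<in>C \<inter> W. elts \<beta> \<subseteq> elts \<gamma>"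
  shows "alpha_finite \<alpha> (C - W)"
proof -
  have "\<not> alpha_finite \<alpha> (C \<inter> W)"
  proof
    assume "alpha_finite \<alpha> (C \<inter> W)"
    then obtain \<beta> where \<beta>: "\<beta> \<in> elts \<alpha>" "C \<inter> W \<subseteq> elts \<beta>" using alpha_finite_bounded by blast
    obtain \<gamma> where "\<gamma> \<in> C \<inter> W" "elts \<beta> \<subseteq> elts \<gamma>" using assms(2) [OF \<beta>(1)] by blast
    then have "\<gamma> \<in> elts \<gamma>" using \<beta>(2) by blast
    then show False by simp
  qed
  then show ?thesis using max assms(1) unfolding maximal_alpha_RE_def C_def by blast
qed

lemma cohesive:
  assumes "alpha_RE \<alpha> W" "\<And>\<beta>. \<beta> \<in> elts \<alpha> \<Longrightarrow> \<exists>\<gamma>\<in>C \<inter> W. elts \<beta> \<subseteq> elts \<gamma>"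
  shows "\<exists>\<beta>\<in>elts \<alpha>. \<forall>\<gamma>\<in>C. elts \<beta> \<subseteq> elts \<gamma> \<longrightarrow> \<gamma> \<in> W"
proof -
  obtain \<beta> where \<beta>: "\<beta> \<in> elts \<alpha>" "C - W \<subseteq> elts \<beta>"
    using alpha_finite_bounded [OF cohesive0 [OF assms]] by blast
  have "\<gamma> \<in> W" if "\<gamma> \<in> C" "elts \<beta> \<subseteq> elts \<gamma>" for \<gamma>
  proof (rule ccontr)
    assume "\<gamma> \<notin> W"
    then have "\<gamma> \<in> elts \<gamma>" using \<beta>(2) that by blast
    then show False by simp
  qed
  then show ?thesis using \<beta>(1) by blast
qed

text \<open>Maximality is applied to the \<alpha>-RE set \<open>elts \<beta>\<close>: the part of
  \<open>C\<close> outside is unbounded, so it is the part inside that must be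
  \<alpha>-finite.\<close>

lemma C_below_X:
  assumes \<beta>: "\<beta> \<in> elts \<alpha>" shows "inX (C \<inter> elts \<beta>)"
proof -
  have "Sig (\<lambda>e. e (Suc 0) \<in> elts (e 0) \<and> Ord (e (Suc 0)))" by (intro Sig_Del D_sets)
  from Sig_const [where P = "\<lambda>c e. e 0 \<in> elts c \<and> Ord (e 0)", OF this alpha_X [OF \<beta>]]
  have "alpha_RE \<alpha> {x \<in> X. x \<in> elts \<beta> \<and> Ord x}" by (rule alpha_REI) simp
  moreover have "{x \<in> X. x \<in> elts \<beta> \<and> Ord x} = elts \<beta>"
    using trsD [OF alpha_X [OF \<beta>]] Ord_mem [OF Ord_in_alpha [OF \<beta>]] by blast
  ultimately have RE: "alpha_RE \<alpha> (elts \<beta>)" by simp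
  have "\<not> alpha_finite \<alpha> (C - elts \<beta>)"
  proof
    assume "alpha_finite \<alpha> (C - elts \<beta>)"
    then obtain \<delta> where \<delta>: "\<delta> \<in> elts \<alpha>" "C - elts \<beta> \<subseteq> elts \<delta>" using alpha_finite_bounded by blast
    obtain \<epsilon> where \<epsilon>: "\<epsilon> \<in> elts \<alpha>" "elts \<beta> \<subseteq> elts \<epsilon>" "elts \<delta> \<subseteq> elts \<epsilon>" by (rule alpha_max [OF \<beta> \<delta>(1)])
    obtain \<gamma> where \<gamma>: "\<gamma> \<in> C" "elts \<epsilon> \<subseteq> elts \<gamma>" using unb [OF \<epsilon>(1)] by blast
    have "\<gamma> \<in> elts \<gamma>" using \<delta>(2) \<epsilon>(2,3) \<gamma> by blast
    then show False by simp
  qed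
  then have "alpha_finite \<alpha> (C \<inter> elts \<beta>)"
    using max RE unfolding maximal_alpha_RE_def C_def by blast
  then show ?thesis unfolding alpha_finite_def inX_iff by blast
qed

text \<open>As \<open>C \<inter> elts \<beta>\<close> is an element of \<open>L \<alpha>\<close>, so
  is its complement in \<beta>, and collection bounds the witnesses for all its members at
  once.\<close>

lemma stage:
  assumes \<beta>: "\<beta> \<in> elts \<alpha>"
  shows "\<exists>\<sigma>\<in>elts \<alpha>. \<forall>y\<in>elts \<beta> - C. \<exists>w\<in>elts (Lset \<sigma>). R w y"
proof -
  obtain k where k: "k \<in> X" "elts k = C \<inter> elts \<beta>" using C_below_X [OF \<beta>] by (rule inXE)
  have "Dfn Delta0 X (\<lambda>e. e 0 \<notin> elts (e (Suc 0)))" by (intro D_sets)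
  from sep_X [where P = "\<lambda>x e. x \<notin> elts (e 0)", OF this, of "\<lambda>_. k" \<beta>]
  have "inX {x \<in> elts \<beta>. x \<notin> elts k}" using k(1) alpha_X [OF \<beta>] by (simp add: envs_def)
  then obtain a where a: "a \<in> X" "elts a = {x \<in> elts \<beta>. x \<notin> elts k}" by (rule inXE)
  have ae: "elts a = elts \<beta> - C" unfolding a(2) k(2) by blast
  have env: "(\<lambda>_. zer) \<in> envs X" using zer_X by (simp add: envs_def)
  have ex: "\<exists>w\<in>X. R w x" if "x \<in> elts a" for x
    using that C_iff [of x] Ord_trans [OF Ord_alpha _ \<beta>] unfolding ae by blast
  have "Dfn Delta0 X (\<lambda>e. R (e 0) (e (Suc 0)))" by (rule D_R) simp
  from collection [OF this env a(1)] ex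
  show ?thesis unfolding ae by simp
qed

text \<open>For \<open>Z = Lset \<sigma>\<close>, the approximation at stage \<sigma> to the tail of
  \<open>C\<close> that starts at \<beta>: members of \<open>M\<close> still count as long as
  \<open>Z\<close> contains no witness for them.\<close>

definition CC :: "'a hset \<Rightarrow> 'a hset \<Rightarrow> 'a hset set" where
  "CC \<beta> Z = {y. elts \<beta> \<subseteq> elts y \<and> (\<forall>w\<in>elts Z. \<not> R w y)}"

definition cG :: "'a hset \<Rightarrow> 'a hset \<Rightarrow> 'a hset \<Rightarrow> 'a hset" where
  "cG \<beta> Z f = mk {q. \<exists>y b. pair y b \<in> elts f \<and> b = q \<and> y \<in> CC \<beta> Z}"

lemma inX_cG:
  assumes "\<beta> \<in> X" "Z \<in> X" "f \<in> X"
  shows "inX {q. \<exists>y b. pair y b \<in> elts f \<and> b = q \<and> y \<in> CC \<beta> Z}"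
proof -
  have "Dfn Delta0 X (\<lambda>e. \<exists>y b. pair y b \<in> elts (e (Suc 0)) \<and> b = e 0 \<and>
      elts (e (Suc (Suc 0))) \<subseteq> elts y \<and> (\<forall>w\<in>elts (e (Suc (Suc (Suc 0)))). \<not> R w y))"
    by (intro D_sets D_R) simp
  from sep_X [where P = "\<lambda>q e. \<exists>y b. pair y b \<in> elts (e 0) \<and> b = q \<and>
      elts (e (Suc 0)) \<subseteq> elts y \<and> (\<forall>w\<in>elts (e (Suc (Suc 0))). \<not> R w y)", OF this,
      of "case_nat f (case_nat \<beta> (\<lambda>_. Z))" "rs f"]
  have "inX {q \<in> elts (rs f). \<exists>y b. pair y b \<in> elts f \<and> b = q \<and> y \<in> CC \<beta> Z}"
    using assms rs_X by (simp add: CC_def envs_def split: nat.splits)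
  moreover have "{q \<in> elts (rs f). \<exists>y b. pair y b \<in> elts f \<and> b = q \<and> y \<in> CC \<beta> Z} =
      {q. \<exists>y b. pair y b \<in> elts f \<and> b = q \<and> y \<in> CC \<beta> Z}"
    unfolding elts_rs_X [OF assms(3)] by blast
  ultimately show ?thesis by simp
qed

lemma USig_cG: "USig (\<lambda>e. cG (e i) (e j) (e k) = e l)"
proof (rule USig_Del)
  have "Dfn Delta0 X (\<lambda>e. (\<forall>q\<in>elts (e l). \<exists>y b. pair y b \<in> elts (e k) \<and> b = q \<and>
      elts (e i) \<subseteq> elts y \<and> (\<forall>w\<in>elts (e j). \<not> R w y)) \<and>
    (\<forall>y b. pair y b \<in> elts (e k) \<longrightarrow> elts (e i) \<subseteq> elts y \<and> (\<forall>w\<in>elts (e j). \<not> R w y) \<longrightarrow> b \<in> elts (e l)))"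
    by (intro D_sets D_R) simp_all
  then show "Dfn Delta0 X (\<lambda>e. cG (e i) (e j) (e k) = e l)"
  proof (rule Dfn_cong)
    fix e assume e: "e \<in> envs X"
    have "elts (cG (e i) (e j) (e k)) = {q. \<exists>y b. pair y b \<in> elts (e k) \<and> b = q \<and> y \<in> CC (e i) (e j)}"
      unfolding cG_def by (rule elts_mk_X [OF inX_cG [OF envsD [OF e] envsD [OF e] envsD [OF e]]])
    moreover have "cG (e i) (e j) (e k) = e l \<longleftrightarrow> elts (cG (e i) (e j) (e k)) = elts (e l)" by (metis elts_inject)
    ultimately show "((\<forall>q\<in>elts (e l). \<exists>y b. pair y b \<in> elts (e k) \<and> b = q \<and>
      elts (e i) \<subseteq> elts y \<and> (\<forall>w\<in>elts (e j). \<not> R w y)) \<and>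
    (\<forall>y b. pair y b \<in> elts (e k) \<longrightarrow> elts (e i) \<subseteq> elts y \<and> (\<forall>w\<in>elts (e j). \<not> R w y) \<longrightarrow> b \<in> elts (e l))) =
      (cG (e i) (e j) (e k) = e l)"
      unfolding CC_def by auto
  qed
qed

lemma cG_X: "\<beta> \<in> X \<Longrightarrow> Z \<in> X \<Longrightarrow> f \<in> X \<Longrightarrow> cG \<beta> Z f \<in> X"
  unfolding cG_def by (intro inX_mk inX_cG)

text \<open>Brings the collapse into the form to which the recursion theorem applies. The step
  \<open>cG\<close> is \<Delta>0 because the stage enters only through the set \<open>Z\<close>,
  which bounds the witnesses.\<close>

lemma clps_hrec: "clps (CC \<beta> Z) x = hrec (cG \<beta> Z) x"
proof (induction x rule: hset_induct)
  case (1 x)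
  have "{q. \<exists>y b. pair y b \<in> elts (lam x (hrec (cG \<beta> Z))) \<and> b = q \<and> y \<in> CC \<beta> Z} = elts (clps (CC \<beta> Z) x)"
    unfolding elts_lam elts_clps using 1 by auto
  then have "cG \<beta> Z (lam x (hrec (cG \<beta> Z))) = clps (CC \<beta> Z) x" unfolding cG_def by simp
  then show ?case by (subst hrec_eq) simp
qed

lemma USig_clps: "USig (\<lambda>e. Ord (e g) \<and> clps (CC (e b) (e s)) (e g) = e p)"
  unfolding clps_hrec
  by (rule USig_hrec [of "\<lambda>e. cG (e b) (e s)"]) (rule USig_cG, rule cG_X [OF envsD envsD])

lemma clps_X: "\<beta> \<in> X \<Longrightarrow> Z \<in> X \<Longrightarrow> Ord \<gamma> \<Longrightarrow> \<gamma> \<in> X \<Longrightarrow> clps (CC \<beta> Z) \<gamma> \<in> X"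
  unfolding clps_hrec
proof -
  assume "\<beta> \<in> X" "Z \<in> X" "Ord \<gamma>" "\<gamma> \<in> X"
  have 1: "USig (\<lambda>e. cG (e (Suc (Suc 0))) (e (Suc (Suc (Suc 0)))) (e (Suc 0)) = e 0)" by (rule USig_cG)
  have 2: "cG (e 0) (e (Suc 0)) x \<in> X" if "e \<in> envs X" "x \<in> X" for e x
    by (rule cG_X [OF envsD [OF that(1)] envsD [OF that(1)] that(2)])
  have "case_nat \<beta> (\<lambda>_. Z) \<in> envs X" using \<open>\<beta> \<in> X\<close> \<open>Z \<in> X\<close> by (simp add: envs_def split: nat.splits)
  from hrec_X [of "\<lambda>e. cG (e 0) (e (Suc 0))", OF 1 2 this \<open>\<gamma> \<in> X\<close> \<open>Ord \<gamma>\<close>]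
  show "hrec (cG \<beta> Z) \<gamma> \<in> X" by simp
qed

definition pos :: "'a hset \<Rightarrow> 'a hset \<Rightarrow> 'a hset \<Rightarrow> 'a hset" where
  "pos \<beta> \<sigma> \<gamma> = clps (CC \<beta> (Lset \<sigma>)) \<gamma>"

definition isPos :: "'a hset \<Rightarrow> 'a hset \<Rightarrow> 'a hset \<Rightarrow> 'a hset \<Rightarrow> bool" where
  "isPos \<beta> \<sigma> \<gamma> v \<longleftrightarrow> Ord \<sigma> \<and> Ord \<gamma> \<and> pos \<beta> \<sigma> \<gamma> = v"

lemma Sig_isPos: "Sig (\<lambda>e. isPos (e b) (e s) (e g) (e p))"
proof -
  have "Sig (\<lambda>e. \<exists>Z\<in>X. (Ord (e s) \<and> Lset (e s) = Z) \<and> (Ord (e g) \<and> clps (CC (e b) Z) (e g) = e p))"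
    by (rule Sig_ex, rule Sig_and) (rule USig_Sig, rule USig_Lset, rule USig_Sig, rule USig_clps)
  then show ?thesis
    by (rule Sig_cong) (auto simp: isPos_def pos_def intro: Lset_X envsD)
qed

lemma pos_X: "\<beta> \<in> X \<Longrightarrow> \<sigma> \<in> elts \<alpha> \<Longrightarrow> \<gamma> \<in> elts \<alpha> \<Longrightarrow> pos \<beta> \<sigma> \<gamma> \<in> X"
  unfolding pos_def by (rule clps_X [OF _ Lset_X [OF alpha_X Ord_in_alpha] Ord_in_alpha alpha_X])

lemma Ord_pos: "\<gamma> \<in> elts \<alpha> \<Longrightarrow> Ord (pos \<beta> \<sigma> \<gamma>)"
  unfolding pos_def by (intro Ord_clps Ord_in_alpha)

lemma Lset_mono: "\<sigma> \<in> elts \<alpha> \<Longrightarrow> \<tau> \<in> elts \<alpha> \<Longrightarrow> elts \<sigma> \<subseteq> elts \<tau> \<Longrightarrow> elts (Lset \<sigma>) \<subseteq> elts (Lset \<tau>)"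
  using elts_Lset alpha_X Ord_in_alpha L_mono by metis

lemma pos_anti:
  assumes "\<sigma> \<in> elts \<alpha>" "\<tau> \<in> elts \<alpha>" "\<gamma> \<in> elts \<alpha>" "elts \<beta> \<subseteq> elts \<beta>'" "elts \<sigma> \<subseteq> elts \<tau>"
  shows "elts (pos \<beta>' \<tau> \<gamma>) \<subseteq> elts (pos \<beta> \<sigma> \<gamma>)"
  unfolding pos_def
  by (rule clps_anti) (use assms Lset_mono [OF assms(1,2,5)] Ord_in_alpha in \<open>auto simp: CC_def\<close>)

definition T :: "'a hset \<Rightarrow> 'a hset set" where
  "T \<beta> = {y \<in> C. elts \<beta> \<subseteq> elts y}"

lemma T_alpha: "x \<in> T \<beta> \<Longrightarrow> x \<in> elts \<alpha>"
  by (simp add: T_def C_alpha)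

text \<open>Once every member of \<open>M\<close> below \<gamma> has a witness, the approximation
  agrees with the tail below \<gamma>. This stage does not depend on where the tail starts.\<close>

lemma pos_final:
  assumes \<gamma>: "\<gamma> \<in> elts \<alpha>"
  shows "\<exists>\<sigma>\<in>elts \<alpha>. \<forall>\<tau>\<in>elts \<alpha>. elts \<sigma> \<subseteq> elts \<tau> \<longrightarrow> (\<forall>\<beta>. pos \<beta> \<tau> \<gamma> = clps (T \<beta>) \<gamma>)"
proof -
  obtain \<sigma> where \<sigma>: "\<sigma> \<in> elts \<alpha>" "\<forall>y\<in>elts \<gamma> - C. \<exists>w\<in>elts (Lset \<sigma>). R w y" using stage [OF \<gamma>] by blast
  have "pos \<beta> \<tau> \<gamma> = clps (T \<beta>) \<gamma>" if \<tau>: "\<tau> \<in> elts \<alpha>" "elts \<sigma> \<subseteq> elts \<tau>" for \<tau> \<beta>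
    unfolding pos_def
  proof (rule clps_cong [OF _ Ord_in_alpha [OF \<gamma>]])
    have sub: "elts (Lset \<sigma>) \<subseteq> elts (Lset \<tau>)" by (rule Lset_mono [OF \<sigma>(1) \<tau>])
    have LX: "elts (Lset \<tau>) \<subseteq> X" using Lset_X [OF alpha_X Ord_in_alpha] \<tau>(1) trs by blast
    have "y \<in> C \<longleftrightarrow> (\<forall>w\<in>elts (Lset \<tau>). \<not> R w y)" if y: "y \<in> elts \<gamma>" for y
    proof -
      have "y \<in> elts \<alpha>" using Ord_trans [OF Ord_alpha y \<gamma>] .
      then show ?thesis using C_iff [of y] \<sigma>(2) y sub LX by blast
    qed
    then show "CC \<beta> (Lset \<tau>) \<inter> elts \<gamma> = T \<beta> \<inter> elts \<gamma>" unfolding CC_def T_def by blast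
  qed
  then show ?thesis using \<sigma>(1) by blast
qed

text \<open>Start and stage vary together, since the sets \<open>WW \<nu>\<close> quantify over
  both.\<close>

lemma finite_pos: "\<gamma> \<in> elts \<alpha> \<Longrightarrow> finite {pos \<beta> \<sigma> \<gamma> | \<beta> \<sigma>. \<beta> \<in> elts \<alpha> \<and> \<sigma> \<in> elts \<alpha>}"
  by (rule finite_antitone_range [of "elts \<alpha>" "elts \<alpha>" "\<lambda>\<beta> \<sigma>. pos \<beta> \<sigma> \<gamma>"])
    (auto intro: Ord_in_alpha Ord_pos pos_anti [THEN subsetD])

section \<open>Uncountable tails\<close>

lemma clps_T_inj: "inj_on (clps (T \<beta>)) (T \<beta>)"
proof (rule inj_onI, rule ccontr)
  fix x y assume xy: "x \<in> T \<beta>" "y \<in> T \<beta>" "clps (T \<beta>) x = clps (T \<beta>) y" "x \<noteq> y"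
  then have "x \<in> elts y \<or> y \<in> elts x" using Ord_linear [of x y] T_alpha Ord_in_alpha by blast
  then have "clps (T \<beta>) x \<in> elts (clps (T \<beta>) y) \<or> clps (T \<beta>) y \<in> elts (clps (T \<beta>) x)"
    using clps_mono_mem xy(1,2) by blast
  then show False using xy(3) by simp
qed

text \<open>The positions of a tail form an initial segment of the ordinals. If \<nu> were missing,
  all of them would be below the countable \<nu>, although they are distinct for the uncountably
  many members.\<close>

lemma tail_type:
  assumes "uncountable (T \<beta>)" "Ord \<nu>" "countable (elts \<nu>)"
  shows "\<exists>\<gamma>\<in>T \<beta>. clps (T \<beta>) \<gamma> = \<nu>"
proof (rule ccontr)
  assume n: "\<not> ?thesis"
  have "clps (T \<beta>) \<gamma> \<in> elts \<nu>" if \<gamma>: "\<gamma> \<in> T \<beta>" for \<gamma>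
  proof -
    have "\<nu> \<notin> elts (clps (T \<beta>) \<gamma>)" using n unfolding elts_clps by blast
    moreover have "clps (T \<beta>) \<gamma> \<noteq> \<nu>" using n \<gamma> by blast
    ultimately show ?thesis
      using Ord_linear [OF Ord_clps [OF Ord_in_alpha [OF T_alpha [OF \<gamma>]]] assms(2)] by blast
  qed
  then have "clps (T \<beta>) ` T \<beta> \<subseteq> elts \<nu>" by blast
  then have "countable (clps (T \<beta>) ` T \<beta>)" using assms(3) countable_subset by blast
  then show False using assms(1) countable_image_inj_on [OF _ clps_T_inj] by blast
qed

text \<open>These ordinals fill the least uncountable ordinal below \<alpha>, or \<alpha> itself if
  there is none.\<close>

lemma uncountable_countable_ordinals: "uncountable {\<nu> \<in> elts \<alpha>. countable (elts \<nu>)}"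
proof (cases "\<exists>\<mu>\<in>elts \<alpha>. uncountable (elts \<mu>)")
  case True
  then obtain \<mu>0 where \<mu>0: "\<mu>0 \<in> elts \<alpha>" "uncountable (elts \<mu>0)" by blast
  show ?thesis
  proof (rule Ord_least [of "\<lambda>\<mu>. \<mu> \<in> elts \<alpha> \<and> uncountable (elts \<mu>)" \<mu>0])
    fix \<mu> assume \<mu>: "\<mu> \<in> elts \<alpha> \<and> uncountable (elts \<mu>)"
      "\<And>c. c \<in> elts \<mu> \<Longrightarrow> \<not> (c \<in> elts \<alpha> \<and> uncountable (elts c))"
    have "elts \<mu> \<subseteq> {\<nu> \<in> elts \<alpha>. countable (elts \<nu>)}"
      using \<mu> Ord_elts_subset [OF Ord_alpha, of \<mu>] by blast
    then show "uncountable {\<nu> \<in> elts \<alpha>. countable (elts \<nu>)}" using \<mu>(1) countable_subset by blast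
  qed (use \<mu>0 Ord_in_alpha in auto)
next
  case False
  then have "{\<nu> \<in> elts \<alpha>. countable (elts \<nu>)} = elts \<alpha>" by blast
  then show ?thesis using unc by simp
qed

text \<open>The start \<beta> is quantified as well: one tail has at most one member with final
  position \<nu>, but if every tail has such a member, then \<open>WW \<nu>\<close> meets
  \<open>C\<close> unboundedly.\<close>

definition WW :: "'a hset \<Rightarrow> 'a hset set" where
  "WW \<nu> = {\<gamma> \<in> X. Ord \<gamma> \<and> (\<exists>\<beta>\<in>X. Ord \<beta> \<and> (\<exists>\<sigma>\<in>X. isPos \<beta> \<sigma> \<gamma> \<nu>))}"

lemma WW_RE: "\<nu> \<in> X \<Longrightarrow> alpha_RE \<alpha> (WW \<nu>)"
  unfolding WW_def
proof (rule alpha_REI)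
  assume \<nu>: "\<nu> \<in> X"
  have "Sig (\<lambda>e. Ord (e (Suc 0)) \<and> (\<exists>\<beta>\<in>X. Ord \<beta> \<and> (\<exists>\<sigma>\<in>X. isPos \<beta> \<sigma> (e (Suc 0)) (e 0))))"
    by (intro Sig_and Sig_ex Sig_isPos) (intro Sig_Del D_Ord dc_simps)+
  from Sig_const [where P = "\<lambda>\<nu> e. Ord (e 0) \<and> (\<exists>\<beta>\<in>X. Ord \<beta> \<and> (\<exists>\<sigma>\<in>X. isPos \<beta> \<sigma> (e 0) \<nu>))", OF this \<nu>]
  show "Sig (\<lambda>e. Ord (e 0) \<and> (\<exists>\<beta>\<in>X. Ord \<beta> \<and> (\<exists>\<sigma>\<in>X. isPos \<beta> \<sigma> (e 0) \<nu>)))" .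
qed blast

lemma mem_WW: "\<gamma> \<in> WW \<nu> \<longleftrightarrow> \<gamma> \<in> elts \<alpha> \<and> (\<exists>\<beta>\<in>elts \<alpha>. \<exists>\<sigma>\<in>elts \<alpha>. pos \<beta> \<sigma> \<gamma> = \<nu>)"
proof
  assume "\<gamma> \<in> WW \<nu>"
  then obtain \<beta> \<sigma> where "\<gamma> \<in> X" "Ord \<gamma>" "\<beta> \<in> X" "Ord \<beta>" "\<sigma> \<in> X" "isPos \<beta> \<sigma> \<gamma> \<nu>" unfolding WW_def by blast
  then show "\<gamma> \<in> elts \<alpha> \<and> (\<exists>\<beta>\<in>elts \<alpha>. \<exists>\<sigma>\<in>elts \<alpha>. pos \<beta> \<sigma> \<gamma> = \<nu>)"
    using Ord_X_iff unfolding isPos_def by blast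
next
  assume "\<gamma> \<in> elts \<alpha> \<and> (\<exists>\<beta>\<in>elts \<alpha>. \<exists>\<sigma>\<in>elts \<alpha>. pos \<beta> \<sigma> \<gamma> = \<nu>)"
  then show "\<gamma> \<in> WW \<nu>" unfolding WW_def isPos_def using alpha_X Ord_in_alpha by blast
qed

lemma countable_tail: "\<exists>\<beta>\<in>elts \<alpha>. countable (T \<beta>)"
proof (rule ccontr)
  assume "\<not> ?thesis"
  then have unc_T: "\<And>\<beta>. \<beta> \<in> elts \<alpha> \<Longrightarrow> uncountable (T \<beta>)" by blast
  define Om where "Om = {\<nu> \<in> elts \<alpha>. countable (elts \<nu>)}"
  have Om: "uncountable Om" unfolding Om_def by (rule uncountable_countable_ordinals)
  have "\<exists>\<beta>\<in>elts \<alpha>. \<forall>\<gamma>\<in>C. elts \<beta> \<subseteq> elts \<gamma> \<longrightarrow> \<gamma> \<in> WW \<nu>" if \<nu>: "\<nu> \<in> Om" for \<nu>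
  proof (rule cohesive)
    have \<nu>': "\<nu> \<in> elts \<alpha>" "countable (elts \<nu>)" using \<nu> by (auto simp: Om_def)
    show "alpha_RE \<alpha> (WW \<nu>)" by (rule WW_RE [OF alpha_X [OF \<nu>'(1)]])
    fix \<beta> assume \<beta>: "\<beta> \<in> elts \<alpha>"
    \<comment> \<open>The tail that starts at the given bound is uncountable, so one of its members
      has final position \<nu> in it, and by \<open>pos_final\<close> that position is attained at
      some stage.\<close>
    obtain \<gamma> where \<gamma>: "\<gamma> \<in> T \<beta>" "clps (T \<beta>) \<gamma> = \<nu>"
      using tail_type [OF unc_T [OF \<beta>] Ord_in_alpha [OF \<nu>'(1)] \<nu>'(2)] by blast
    have "\<gamma> \<in> WW \<nu>"
      unfolding mem_WW using pos_final [OF T_alpha [OF \<gamma>(1)]] \<gamma> \<beta> T_alpha by blast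
    then show "\<exists>\<gamma>\<in>C \<inter> WW \<nu>. elts \<beta> \<subseteq> elts \<gamma>" using \<gamma>(1) unfolding T_def by blast
  qed
  then obtain b where b: "\<And>\<nu>. \<nu> \<in> Om \<Longrightarrow> b \<nu> \<in> elts \<alpha> \<and> (\<forall>\<gamma>\<in>C. elts (b \<nu>) \<subseteq> elts \<gamma> \<longrightarrow> \<gamma> \<in> WW \<nu>)"
    by metis
  have "\<exists>N c. N \<subseteq> Om \<and> infinite N \<and> c \<in> elts \<alpha> \<and> (\<forall>\<nu>\<in>N. elts (b \<nu>) \<subseteq> elts c)"
  \<comment> \<open>A common bound is found in two ways. Given a countable cofinal set, uncountably
    many \<nu> are distributed over countably many bounds. If there is none, the bounds of any
    countably infinite set of \<nu> fail to be cofinal.\<close>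
  proof (cases "\<exists>B. countable B \<and> B \<subseteq> elts \<alpha> \<and> (\<forall>\<beta>\<in>elts \<alpha>. \<exists>c\<in>B. elts \<beta> \<subseteq> elts c)")
    case True
    then obtain B where B: "countable B" "B \<subseteq> elts \<alpha>" "\<forall>\<beta>\<in>elts \<alpha>. \<exists>c\<in>B. elts \<beta> \<subseteq> elts c" by blast
    have "Om \<subseteq> (\<Union>c\<in>B. {\<nu> \<in> Om. elts (b \<nu>) \<subseteq> elts c})" using B(3) b by blast
    then have "\<exists>c\<in>B. uncountable {\<nu> \<in> Om. elts (b \<nu>) \<subseteq> elts c}"
    proof (rule contrapos_pp)
      assume "\<not> (\<exists>c\<in>B. uncountable {\<nu> \<in> Om. elts (b \<nu>) \<subseteq> elts c})"
      then have "countable (\<Union>c\<in>B. {\<nu> \<in> Om. elts (b \<nu>) \<subseteq> elts c})" using B(1) by (intro countable_UN) auto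
      then show "\<not> Om \<subseteq> (\<Union>c\<in>B. {\<nu> \<in> Om. elts (b \<nu>) \<subseteq> elts c})" using Om countable_subset by blast
    qed
    then obtain c where "c \<in> B" "uncountable {\<nu> \<in> Om. elts (b \<nu>) \<subseteq> elts c}" by blast
    then show ?thesis using B(2) uncountable_infinite
      by (intro exI [of _ "{\<nu> \<in> Om. elts (b \<nu>) \<subseteq> elts c}"] exI [of _ c]) auto
  next
    case False
    obtain N where N: "N \<subseteq> Om" "infinite N" "countable N"
      using infinite_countable_subset' [OF uncountable_infinite [OF Om]] by blast
    have bN: "countable (b ` N)" by (rule countable_image [OF N(3)])
    have bN': "b ` N \<subseteq> elts \<alpha>"
    proof (rule image_subsetI)
      fix \<nu> assume "\<nu> \<in> N"
      then show "b \<nu> \<in> elts \<alpha>" using conjunct1 [OF b] N(1) by blast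
    qed
    have "\<not> (\<forall>\<beta>\<in>elts \<alpha>. \<exists>x\<in>b ` N. elts \<beta> \<subseteq> elts x)"
    proof
      assume a: "\<forall>\<beta>\<in>elts \<alpha>. \<exists>x\<in>b ` N. elts \<beta> \<subseteq> elts x"
      show False by (rule notE [OF False exI [of _ "b ` N"]]) (intro conjI bN bN' a)
    qed
    then obtain c where c: "c \<in> elts \<alpha>" "\<forall>\<nu>\<in>N. \<not> elts c \<subseteq> elts (b \<nu>)" by blast
    have "elts (b \<nu>) \<subseteq> elts c" if "\<nu> \<in> N" for \<nu>
    proof -
      have "b \<nu> \<in> elts \<alpha>" using that bN' by blast
      then show ?thesis
        using Ord_linear [of c "b \<nu>"] Ord_in_alpha [of c] Ord_in_alpha [of "b \<nu>"] c(1) bspec [OF c(2) that]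
          Ord_elts_subset [of c] Ord_elts_subset [of "b \<nu>"] by blast
    qed
    then show ?thesis using N(1,2) c(1) by (intro exI [of _ N] exI [of _ c]) blast
  qed
  then obtain N c where N: "N \<subseteq> Om" "infinite N" "c \<in> elts \<alpha>" "\<And>\<nu>. \<nu> \<in> N \<Longrightarrow> elts (b \<nu>) \<subseteq> elts c" by blast
  obtain \<gamma> where \<gamma>: "\<gamma> \<in> C" "elts c \<subseteq> elts \<gamma>" using unb [OF N(3)] by blast
  have "\<gamma> \<in> WW \<nu>" if "\<nu> \<in> N" for \<nu> using b N(1,4) \<gamma> that by blast
  then have "N \<subseteq> {pos \<beta> \<sigma> \<gamma> | \<beta> \<sigma>. \<beta> \<in> elts \<alpha> \<and> \<sigma> \<in> elts \<alpha>}" unfolding mem_WW by blast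
  then show False using finite_pos [OF C_alpha [OF \<gamma>(1)]] N(2) finite_subset by blast
qed

subsection \<open>A countable tail\<close>

text \<open>
  \<open>NV \<beta> n \<sigma> \<gamma>\<close> says that the position of \<open>\<gamma>\<close> has taken at least \<open>n\<close> values up to stage \<open>\<sigma>\<close>.
\<close>

definition NV :: "'a hset \<Rightarrow> 'a hset \<Rightarrow> 'a hset \<Rightarrow> 'a hset \<Rightarrow> bool" where
  "NV \<beta> n \<sigma> \<gamma> \<longleftrightarrow> (\<exists>u\<in>X. injr u \<and> (\<forall>l\<in>elts n. \<exists>v\<in>X. pair l v \<in> elts u \<and>
    (\<exists>\<tau>\<in>X. elts \<tau> \<subseteq> elts \<sigma> \<and> isPos \<beta> \<tau> \<gamma> v)))"

lemma Sig_NV: "Sig (\<lambda>e. NV (e b) (e n) (e s) (e g))"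
  unfolding NV_def
  by (intro Sig_ex Sig_and Sig_ball Sig_isPos; intro Sig_Del D_injr D_pair_mem D_subset dc_simps)

definition Vs :: "'a hset \<Rightarrow> 'a hset \<Rightarrow> 'a hset \<Rightarrow> 'a hset set" where
  "Vs \<beta> \<sigma> \<gamma> = {pos \<beta> \<tau> \<gamma> | \<tau>. \<tau> \<in> elts \<alpha> \<and> elts \<tau> \<subseteq> elts \<sigma>}"

definition V :: "'a hset \<Rightarrow> 'a hset \<Rightarrow> 'a hset set" where
  "V \<beta> \<gamma> = {pos \<beta> \<tau> \<gamma> | \<tau>. \<tau> \<in> elts \<alpha>}"

lemma finite_V: "\<beta> \<in> elts \<alpha> \<Longrightarrow> \<gamma> \<in> elts \<alpha> \<Longrightarrow> finite (V \<beta> \<gamma>)"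
  by (rule finite_subset [OF _ finite_pos [of \<gamma>]]) (auto simp: V_def)

lemma Vs_V: "Vs \<beta> \<sigma> \<gamma> \<subseteq> V \<beta> \<gamma>"
  unfolding Vs_def V_def by blast

lemma V_X: "\<beta> \<in> elts \<alpha> \<Longrightarrow> \<gamma> \<in> elts \<alpha> \<Longrightarrow> V \<beta> \<gamma> \<subseteq> X"
  unfolding V_def using pos_X alpha_X by blast

lemma NV_iff:
  assumes "\<beta> \<in> elts \<alpha>" "\<gamma> \<in> elts \<alpha>"
  shows "NV \<beta> (ordn n) \<sigma> \<gamma> \<longleftrightarrow> n \<le> card (Vs \<beta> \<sigma> \<gamma>)"
proof -
  have "(\<exists>\<tau>\<in>X. elts \<tau> \<subseteq> elts \<sigma> \<and> isPos \<beta> \<tau> \<gamma> v) \<longleftrightarrow> v \<in> Vs \<beta> \<sigma> \<gamma>" for v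
    unfolding Vs_def isPos_def using Ord_X_iff Ord_in_alpha alpha_X assms by blast
  then show ?thesis
    unfolding NV_def
    using card_injr [of "Vs \<beta> \<sigma> \<gamma>" n, OF finite_subset [OF Vs_V finite_V [OF assms]] subset_trans [OF Vs_V V_X [OF assms]]]
    by simp
qed

text \<open>There are finitely many values, each taken at some stage, and finitely many stages have
  a bound below \<alpha>.\<close>

lemma Vs_final:
  assumes "\<beta> \<in> elts \<alpha>" "\<gamma> \<in> elts \<alpha>"
  shows "\<exists>\<sigma>\<in>elts \<alpha>. \<forall>\<tau>\<in>elts \<alpha>. elts \<sigma> \<subseteq> elts \<tau> \<longrightarrow> Vs \<beta> \<tau> \<gamma> = V \<beta> \<gamma>"
proof -
  have "\<forall>v\<in>V \<beta> \<gamma>. \<exists>\<tau>. \<tau> \<in> elts \<alpha> \<and> v = pos \<beta> \<tau> \<gamma>" unfolding V_def by blast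
  from bchoice [OF this] obtain s where s: "\<forall>v\<in>V \<beta> \<gamma>. s v \<in> elts \<alpha> \<and> v = pos \<beta> (s v) \<gamma>" by blast
  have "finite (s ` V \<beta> \<gamma>)" "s ` V \<beta> \<gamma> \<subseteq> elts \<alpha>" using finite_V [OF assms] s by auto
  then obtain \<sigma> where \<sigma>: "\<sigma> \<in> elts \<alpha>" "\<forall>x\<in>s ` V \<beta> \<gamma>. elts x \<subseteq> elts \<sigma>" using alpha_fin_bound by blast
  have "Vs \<beta> \<tau> \<gamma> = V \<beta> \<gamma>" if \<tau>: "elts \<sigma> \<subseteq> elts \<tau>" for \<tau>
  proof
    show "V \<beta> \<gamma> \<subseteq> Vs \<beta> \<tau> \<gamma>"
    proof
      fix v assume v: "v \<in> V \<beta> \<gamma>"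
      then have "s v \<in> elts \<alpha>" "v = pos \<beta> (s v) \<gamma>" "elts (s v) \<subseteq> elts \<tau>" using s \<sigma>(2) \<tau> by blast+
      then show "v \<in> Vs \<beta> \<tau> \<gamma>" unfolding Vs_def by blast
    qed
  qed (rule Vs_V)
  then show ?thesis using \<sigma>(1) by blast
qed

lemma stable:
  assumes "\<beta> \<in> elts \<alpha>" "\<gamma> \<in> elts \<alpha>"
  obtains \<sigma> where "\<sigma> \<in> elts \<alpha>" "Vs \<beta> \<sigma> \<gamma> = V \<beta> \<gamma>" "pos \<beta> \<sigma> \<gamma> = clps (T \<beta>) \<gamma>"
proof -
  obtain \<sigma> where \<sigma>: "\<sigma> \<in> elts \<alpha>" "\<forall>\<tau>\<in>elts \<alpha>. elts \<sigma> \<subseteq> elts \<tau> \<longrightarrow> Vs \<beta> \<tau> \<gamma> = V \<beta> \<gamma>"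
    using Vs_final [OF assms] by blast
  obtain \<sigma>' where \<sigma>': "\<sigma>' \<in> elts \<alpha>" "\<forall>\<tau>\<in>elts \<alpha>. elts \<sigma>' \<subseteq> elts \<tau> \<longrightarrow> (\<forall>\<beta>. pos \<beta> \<tau> \<gamma> = clps (T \<beta>) \<gamma>)"
    using pos_final [OF assms(2)] by blast
  obtain \<delta> where "\<delta> \<in> elts \<alpha>" "elts \<sigma> \<subseteq> elts \<delta>" "elts \<sigma>' \<subseteq> elts \<delta>" by (rule alpha_max [OF \<sigma>(1) \<sigma>'(1)])
  then show ?thesis using \<sigma>(2) \<sigma>'(2) that by blast
qed

lemma final_in_V: "\<beta> \<in> elts \<alpha> \<Longrightarrow> \<gamma> \<in> elts \<alpha> \<Longrightarrow> clps (T \<beta>) \<gamma> \<in> V \<beta> \<gamma>"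
  by (rule stable, assumption, assumption) (auto simp: V_def)

text \<open>Positions only descend and end at the final one. This identifies the final position as
  the least value, without reference to a final stage.\<close>

lemma final_least:
  assumes "\<beta> \<in> elts \<alpha>" "\<gamma> \<in> elts \<alpha>" "v \<in> V \<beta> \<gamma>"
  shows "elts (clps (T \<beta>) \<gamma>) \<subseteq> elts v"
proof -
  obtain \<tau> where \<tau>: "\<tau> \<in> elts \<alpha>" "v = pos \<beta> \<tau> \<gamma>" using assms(3) unfolding V_def by blast
  obtain \<sigma>' where \<sigma>': "\<sigma>' \<in> elts \<alpha>" "\<forall>\<tau>\<in>elts \<alpha>. elts \<sigma>' \<subseteq> elts \<tau> \<longrightarrow> (\<forall>\<beta>. pos \<beta> \<tau> \<gamma> = clps (T \<beta>) \<gamma>)"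
    using pos_final [OF assms(2)] by blast
  obtain \<delta> where \<delta>: "\<delta> \<in> elts \<alpha>" "elts \<tau> \<subseteq> elts \<delta>" "elts \<sigma>' \<subseteq> elts \<delta>" by (rule alpha_max [OF \<tau>(1) \<sigma>'(1)])
  have "elts (pos \<beta> \<delta> \<gamma>) \<subseteq> elts (pos \<beta> \<tau> \<gamma>)" by (rule pos_anti [OF \<tau>(1) \<delta>(1) assms(2) subset_refl \<delta>(2)])
  then show ?thesis using \<sigma>'(2) \<delta> \<tau>(2) by simp
qed

text \<open>\<open>f\<close> is the function tabulated so far, \<open>z\<close> and \<open>u\<close>
  stand for the values \<open>zer\<close> and \<open>one\<close>, and \<open>y\<close> is the
  largest element of \<open>E\<close> in the domain of \<open>f\<close>. If there is no largest one,
  the value is \<open>u\<close>.\<close>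

definition altG :: "'a hset \<Rightarrow> 'a hset \<Rightarrow> 'a hset \<Rightarrow> 'a hset \<Rightarrow> 'a hset" where
  "altG E z u f = (if \<exists>y\<in>elts E. pair y u \<in> elts f \<and> (\<forall>a b. pair a b \<in> elts f \<longrightarrow> a \<in> elts E \<longrightarrow> a \<in> elts y \<or> a = y)
    then z else u)"

lemma USig_altG: "USig (\<lambda>e. altG (e i) (e j) (e m) (e k) = e l)"
proof (rule USig_Del)
  have C: "Dfn Delta0 X (\<lambda>e. \<exists>y\<in>elts (e i). pair y (e m) \<in> elts (e k) \<and>
      (\<forall>a b. pair a b \<in> elts (e k) \<longrightarrow> a \<in> elts (e i) \<longrightarrow> a \<in> elts y \<or> a = y))"
    by (intro D_sets)
  have if_eq: "((if P then z else u) = x) = ((P \<longrightarrow> z = x) \<and> (\<not> P \<longrightarrow> u = x))" for P and z u x :: "'a hset"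
    by simp
  show "Dfn Delta0 X (\<lambda>e. altG (e i) (e j) (e m) (e k) = e l)"
    unfolding altG_def if_eq by (intro Dfn_and Dfn_imp Dfn_neg C D_eq dc_simps)
qed

text \<open>
  \<open>alt E\<close> is the characteristic function of the alternating subset of \<open>E\<close>: a successor in \<open>E\<close>
  belongs to it iff its predecessor in \<open>E\<close> does not.
\<close>

definition alt :: "'a hset \<Rightarrow> 'a hset \<Rightarrow> 'a hset" where
  "alt E = hrec (altG E zer one)"

lemma one_not_zer: "one \<noteq> (zer :: 'a hset)"
  using ordn_inj [of "Suc 0" 0] by simp

lemma alt_iff: "alt E x = one \<longleftrightarrow> \<not> (\<exists>y\<in>elts E \<inter> elts x. alt E y = one \<and> (\<forall>a\<in>elts E \<inter> elts x. a \<in> elts y \<or> a = y))"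
proof -
  let ?f = "lam x (alt E)"
  have 1: "pair y u \<in> elts ?f \<longleftrightarrow> y \<in> elts x \<and> u = alt E y" for y u
    unfolding elts_lam by auto
  have "alt E x = altG E zer one ?f" unfolding alt_def by (rule hrec_eq)
  then show ?thesis unfolding altG_def 1 using one_not_zer by auto
qed

lemma Sig_alt: "E \<in> X \<Longrightarrow> Sig (\<lambda>e. Ord (e i) \<and> alt E (e i) = one)"
proof -
  assume E: "E \<in> X"
  have aX: "altG a b c f \<in> X" if "b \<in> X" "c \<in> X" for a b c f using that by (simp add: altG_def)
  have "USig (\<lambda>e. Ord (e (Suc (Suc (Suc i)))) \<and> hrec (altG (e 0) (e (Suc 0)) (e (Suc (Suc 0)))) (e (Suc (Suc (Suc i)))) = e (Suc (Suc 0)))"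
    by (rule USig_hrec [of "\<lambda>e. altG (e 0) (e (Suc 0)) (e (Suc (Suc 0)))"]) (rule USig_altG, rule aX [OF envsD envsD])
  then have 0: "Sig (\<lambda>e. Ord (e (Suc (Suc (Suc i)))) \<and> hrec (altG (e 0) (e (Suc 0)) (e (Suc (Suc 0)))) (e (Suc (Suc (Suc i)))) = e (Suc (Suc 0)))"
    by (rule USig_Sig)
  have 1: "Sig (\<lambda>e. Ord (e (Suc (Suc i))) \<and> hrec (altG E (e 0) (e (Suc 0))) (e (Suc (Suc i))) = e (Suc 0))"
    by (rule Sig_const [where P = "\<lambda>c e. Ord (e (Suc (Suc i))) \<and> hrec (altG c (e 0) (e (Suc 0))) (e (Suc (Suc i))) = e (Suc 0)", OF 0 E])
  have 2: "Sig (\<lambda>e. Ord (e (Suc i)) \<and> hrec (altG E zer (e 0)) (e (Suc i)) = e 0)"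
    by (rule Sig_const [where P = "\<lambda>c e. Ord (e (Suc i)) \<and> hrec (altG E c (e 0)) (e (Suc i)) = e 0", OF 1 zer_X])
  show ?thesis
    unfolding alt_def
    by (rule Sig_const [where P = "\<lambda>c e. Ord (e i) \<and> hrec (altG E zer c) (e i) = c", OF 2 ordn_X])
qed

lemma contradiction: False
proof -
  obtain \<beta>0 where \<beta>0: "\<beta>0 \<in> elts \<alpha>" "countable (T \<beta>0)" using countable_tail by blast
  define f where "f = clps (T \<beta>0)"
  define \<kappa> where "\<kappa> \<gamma> = card (V \<beta>0 \<gamma>)" for \<gamma>
  define I where "I = f ` T \<beta>0"
  have env: "(\<lambda>_. zer) \<in> envs X" using zer_X by (simp add: envs_def)
  have T_unb: "\<exists>\<gamma>\<in>T \<beta>0. elts \<beta> \<subseteq> elts \<gamma>" if \<beta>: "\<beta> \<in> elts \<alpha>" for \<beta>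
  proof -
    obtain \<delta> where \<delta>: "\<delta> \<in> elts \<alpha>" "elts \<beta> \<subseteq> elts \<delta>" "elts \<beta>0 \<subseteq> elts \<delta>" by (rule alpha_max [OF \<beta> \<beta>0(1)])
    obtain \<gamma> where "\<gamma> \<in> C" "elts \<delta> \<subseteq> elts \<gamma>" using unb [OF \<delta>(1)] by blast
    then show ?thesis using \<delta> unfolding T_def by blast
  qed
  have f_mono: "f \<gamma> \<in> elts (f \<gamma>') \<longleftrightarrow> \<gamma> \<in> elts \<gamma>'" if "\<gamma> \<in> T \<beta>0" "\<gamma>' \<in> T \<beta>0" for \<gamma> \<gamma>'
  proof
    show "f \<gamma> \<in> elts (f \<gamma>')" if "\<gamma> \<in> elts \<gamma>'" using clps_mono_mem [OF \<open>\<gamma> \<in> T \<beta>0\<close> that] by (simp add: f_def)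
    assume a: "f \<gamma> \<in> elts (f \<gamma>')"
    then have "\<gamma> \<noteq> \<gamma>'" by auto
    moreover have "\<gamma>' \<notin> elts \<gamma>" using clps_mono_mem [OF \<open>\<gamma>' \<in> T \<beta>0\<close>, of \<gamma>] a mem_asym unfolding f_def by blast
    ultimately show "\<gamma> \<in> elts \<gamma>'"
      using Ord_linear [of \<gamma> \<gamma>'] Ord_in_alpha [OF T_alpha] that by blast
  qed
  have f_inj: "f \<gamma> = f \<gamma>' \<longleftrightarrow> \<gamma> = \<gamma>'" if "\<gamma> \<in> T \<beta>0" "\<gamma>' \<in> T \<beta>0" for \<gamma> \<gamma>'
    using inj_on_eq_iff [OF clps_T_inj that] unfolding f_def .
  have f_X: "f \<gamma> \<in> X" if "\<gamma> \<in> T \<beta>0" for \<gamma>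
    using final_in_V [OF \<beta>0(1) T_alpha [OF that]] V_X [OF \<beta>0(1) T_alpha [OF that]] unfolding f_def by blast
  have f_Ord: "Ord (f \<gamma>)" if "\<gamma> \<in> T \<beta>0" for \<gamma>
    unfolding f_def by (rule Ord_clps [OF Ord_in_alpha [OF T_alpha [OF that]]])

  \<comment> \<open>A countable transitive set is needed that contains the positions and the pairs
    of a position and a number. Unordered pairs are added because ordered pairs consist of
    them.\<close>
  define J where "J = I \<union> range ordn"
  define S where "S = J \<union> (\<lambda>(a, b). up a b) ` (J \<times> J) \<union> (\<lambda>(a, b). pair a b) ` (J \<times> J)"
  have J_trans: "elts x \<subseteq> J" if "x \<in> J" for x
  proof -
    have "elts (f \<gamma>) \<subseteq> I" for \<gamma> unfolding f_def I_def elts_clps by blast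
    moreover have "elts (ordn n :: 'a hset) \<subseteq> range ordn" for n by (auto simp: elts_ordn)
    ultimately show ?thesis using that unfolding J_def I_def by blast
  qed
  have J_X: "J \<subseteq> X" unfolding J_def I_def using f_X ordn_X by blast
  have J_c: "countable J" unfolding J_def I_def
    by (intro countable_Un countable_image \<beta>0(2)) simp_all
  have S_trans: "elts x \<subseteq> S" if x: "x \<in> S" for x
  proof -
    have JS: "J \<subseteq> S" unfolding S_def Un_assoc by (rule Un_upper1)
    have up_S: "up a b \<in> S" if "a \<in> J" "b \<in> J" for a b
      unfolding S_def using imageI [of "(a, b)" "J \<times> J" "\<lambda>(a, b). up a b"] that by simp
    from x show ?thesis unfolding S_def
    proof (elim UnE imageE SigmaE)
      assume "x \<in> J"
      from order_trans [OF J_trans [OF this] JS] show "elts x \<subseteq> J \<union> (\<lambda>(a, b). up a b) ` (J \<times> J) \<union> (\<lambda>(a, b). pair a b) ` (J \<times> J)"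
        unfolding S_def .
    next
      fix p a b assume p: "x = (case p of (a, b) \<Rightarrow> up a b)" "a \<in> J" "b \<in> J" "p = (a, b)"
      have "elts x \<subseteq> S" using p JS by (simp add: subset_iff)
      then show "elts x \<subseteq> J \<union> (\<lambda>(a, b). up a b) ` (J \<times> J) \<union> (\<lambda>(a, b). pair a b) ` (J \<times> J)"
        unfolding S_def .
    next
      fix p a b assume p: "x = (case p of (a, b) \<Rightarrow> pair a b)" "a \<in> J" "b \<in> J" "p = (a, b)"
      have "elts x \<subseteq> S" using p up_S by (simp add: pair_def)
      then show "elts x \<subseteq> J \<union> (\<lambda>(a, b). up a b) ` (J \<times> J) \<union> (\<lambda>(a, b). pair a b) ` (J \<times> J)"
        unfolding S_def .
    qed
  qed
  have S_X: "S \<subseteq> X"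
    unfolding S_def using J_X by (intro Un_least image_subsetI) (auto intro: up_X pair_X)
  have S_c: "countable S" unfolding S_def by (intro countable_Un countable_image countable_SIGMA J_c)
  have cond: "inX {x \<in> X. Q x}" if Q: "Dfn (\<lambda>_. True) X (\<lambda>e. Q (e 0))" "\<And>x. x \<in> X \<Longrightarrow> Q x \<Longrightarrow> x \<in> S" for Q
  proof -
    have "{x \<in> X. Q (case_nat x (\<lambda>_. zer :: 'a hset) 0)} \<subseteq> S" using Q(2) by auto
    with condensation [where P = "\<lambda>e. Q (e 0)" and e = "\<lambda>_. zer", OF S_c S_X _ Q(1) env] S_trans
    have "inX {x \<in> X. Q (case_nat x (\<lambda>_. zer) 0)}" by blast
    then show ?thesis by simp
  qed

  \<comment> \<open>This defines the pairs of a final position \<open>f \<gamma>\<close> and a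
    number n \<le> \<kappa> \<gamma>. So a comparison of values of \<kappa> becomes an inclusion,
    and as n = 0 always occurs, a pair with \<open>zer\<close> marks a position. Membership in
    \<open>C\<close> and leastness of \<open>i\<close> are expressed by unbounded universal
    quantifiers, which condensation allows.\<close>
  let ?G = "\<lambda>\<beta> w z. \<exists>i n. z = pair i n \<and> (n \<in> elts w \<and> (\<exists>\<gamma>\<in>X. (Ord \<gamma> \<and> \<not> (\<exists>w\<in>X. R w \<gamma>)) \<and> elts \<beta> \<subseteq> elts \<gamma> \<and>
      (\<exists>\<sigma>\<in>X. isPos \<beta> \<sigma> \<gamma> i) \<and> (\<forall>\<sigma>\<in>X. \<forall>v\<in>X. isPos \<beta> \<sigma> \<gamma> v \<longrightarrow> elts i \<subseteq> elts v) \<and>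
      (\<exists>\<sigma>\<in>X. Ord \<sigma> \<and> NV \<beta> n \<sigma> \<gamma>)))"
  have G_iff: "?G \<beta>0 omega z \<longleftrightarrow> (\<exists>\<gamma>\<in>T \<beta>0. \<exists>n\<le>\<kappa> \<gamma>. z = pair (f \<gamma>) (ordn n))" for z
  proof
    assume "?G \<beta>0 omega z"
    then obtain i n \<gamma> \<sigma> \<sigma>' where z: "z = pair i n" "n \<in> elts omega" "\<gamma> \<in> X" "Ord \<gamma>" "\<not> (\<exists>w\<in>X. R w \<gamma>)" "elts \<beta>0 \<subseteq> elts \<gamma>"
      "\<sigma> \<in> X" "isPos \<beta>0 \<sigma> \<gamma> i" "\<And>\<sigma> v. \<sigma> \<in> X \<Longrightarrow> v \<in> X \<Longrightarrow> isPos \<beta>0 \<sigma> \<gamma> v \<Longrightarrow> elts i \<subseteq> elts v"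
      "\<sigma>' \<in> X" "Ord \<sigma>'" "NV \<beta>0 n \<sigma>' \<gamma>" by blast
    have \<gamma>: "\<gamma> \<in> elts \<alpha>" using z(3,4) Ord_X_iff by blast
    have \<gamma>T: "\<gamma> \<in> T \<beta>0" using C_iff [OF \<gamma>] z(5,6) unfolding T_def by blast
    have \<sigma>: "\<sigma> \<in> elts \<alpha>" "\<sigma>' \<in> elts \<alpha>" using z(7,8,10,11) Ord_X_iff unfolding isPos_def by blast+
    have iV: "i \<in> V \<beta>0 \<gamma>" using z(8) \<sigma>(1) unfolding V_def isPos_def by blast
    obtain m where m: "n = ordn m" using z(2) unfolding elts_omega by blast
    obtain \<tau> where \<tau>: "\<tau> \<in> elts \<alpha>" "pos \<beta>0 \<tau> \<gamma> = f \<gamma>" using stable [OF \<beta>0(1) \<gamma>] unfolding f_def by blast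
    have "isPos \<beta>0 \<tau> \<gamma> (f \<gamma>)" using \<tau> z(4) Ord_in_alpha unfolding isPos_def by blast
    then have "elts i \<subseteq> elts (f \<gamma>)" using z(9) alpha_X [OF \<tau>(1)] f_X [OF \<gamma>T] by blast
    moreover have "elts (f \<gamma>) \<subseteq> elts i" using final_least [OF \<beta>0(1) \<gamma> iV] unfolding f_def .
    ultimately have "i = f \<gamma>" by (intro hset_eqI) blast
    moreover have "m \<le> \<kappa> \<gamma>"
      using z(12) card_mono [OF finite_V [OF \<beta>0(1) \<gamma>] Vs_V [of \<beta>0 \<sigma>' \<gamma>]]
      unfolding m NV_iff [OF \<beta>0(1) \<gamma>] \<kappa>_def by linarith
    ultimately show "\<exists>\<gamma>\<in>T \<beta>0. \<exists>n\<le>\<kappa> \<gamma>. z = pair (f \<gamma>) (ordn n)" using \<gamma>T z(1) m by blast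
  next
    assume "\<exists>\<gamma>\<in>T \<beta>0. \<exists>n\<le>\<kappa> \<gamma>. z = pair (f \<gamma>) (ordn n)"
    then obtain \<gamma> n where z: "\<gamma> \<in> T \<beta>0" "n \<le> \<kappa> \<gamma>" "z = pair (f \<gamma>) (ordn n)" by blast
    have \<gamma>: "\<gamma> \<in> elts \<alpha>" using T_alpha [OF z(1)] .
    obtain \<tau> where \<tau>: "\<tau> \<in> elts \<alpha>" "Vs \<beta>0 \<tau> \<gamma> = V \<beta>0 \<gamma>" "pos \<beta>0 \<tau> \<gamma> = f \<gamma>"
      using stable [OF \<beta>0(1) \<gamma>] unfolding f_def by blast
    have 1: "Ord \<gamma> \<and> \<not> (\<exists>w\<in>X. R w \<gamma>)" "elts \<beta>0 \<subseteq> elts \<gamma>"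
      using C_iff [OF \<gamma>] z(1) Ord_in_alpha [OF \<gamma>] unfolding T_def by blast+
    have 2: "\<exists>\<sigma>\<in>X. isPos \<beta>0 \<sigma> \<gamma> (f \<gamma>)"
      using \<tau>(1,3) alpha_X Ord_in_alpha \<gamma> unfolding isPos_def by blast
    have 3: "\<forall>\<sigma>\<in>X. \<forall>v\<in>X. isPos \<beta>0 \<sigma> \<gamma> v \<longrightarrow> elts (f \<gamma>) \<subseteq> elts v"
    proof (intro ballI impI)
      fix \<sigma> v assume "\<sigma> \<in> X" "isPos \<beta>0 \<sigma> \<gamma> v"
      then have "v \<in> V \<beta>0 \<gamma>" using Ord_X_iff unfolding isPos_def V_def by blast
      then show "elts (f \<gamma>) \<subseteq> elts v" using final_least [OF \<beta>0(1) \<gamma>] unfolding f_def by blast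
    qed
    have 4: "\<exists>\<sigma>\<in>X. Ord \<sigma> \<and> NV \<beta>0 (ordn n) \<sigma> \<gamma>"
      using \<tau>(1,2) z(2) alpha_X Ord_in_alpha unfolding NV_iff [OF \<beta>0(1) \<gamma>] \<kappa>_def by metis
    have "ordn n \<in> elts (omega :: 'a hset)" by (simp add: elts_omega)
    then show "?G \<beta>0 omega z" using z(3) 1 2 3 4 alpha_X [OF \<gamma>] by blast
  qed
  have "Dfn (\<lambda>_. True) X (\<lambda>e. ?G (e (Suc 0)) (e 0) (e (Suc (Suc 0))))"
    by (intro D_ex_eq_pair Dfn_and Dfn_imp Dfn_neg Fm_ex Fm_all D_mem D_subset D_Ord dc_simps Del_imp_Fm [OF D_R]
        Sig_Fm [OF Sig_isPos] Sig_Fm [OF Sig_NV]) simp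
  from Dfn_const [where P = "\<lambda>w e. ?G (e 0) w (e (Suc 0))", OF this omega_X]
  have "Dfn (\<lambda>_. True) X (\<lambda>e. ?G (e 0) omega (e (Suc 0)))" .
  from Dfn_const [where P = "\<lambda>b e. ?G b omega (e 0)", OF this alpha_X [OF \<beta>0(1)]]
  have DG: "Dfn (\<lambda>_. True) X (\<lambda>e. ?G \<beta>0 omega (e 0))" .
  have G_S: "z \<in> S" if z: "?G \<beta>0 omega z" for z
  proof -
    obtain \<gamma> n where "\<gamma> \<in> T \<beta>0" "z = pair (f \<gamma>) (ordn n)" using z unfolding G_iff by blast
    then show ?thesis unfolding S_def J_def I_def by auto
  qed
  have "inX {z \<in> X. ?G \<beta>0 omega z}"
    by (rule cond [where Q = "\<lambda>z. ?G \<beta>0 omega z", OF DG G_S])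
  then obtain g where g: "g \<in> X" "elts g = {z \<in> X. ?G \<beta>0 omega z}" by (rule inXE)
  have g_iff: "pair i n \<in> elts g \<longleftrightarrow> (\<exists>\<gamma>\<in>T \<beta>0. i = f \<gamma> \<and> (\<exists>m\<le>\<kappa> \<gamma>. n = ordn m))" for i n
  proof -
    have "pair i n \<in> elts g \<longleftrightarrow> ?G \<beta>0 omega (pair i n)" using G_S S_X unfolding g(2) by blast
    then show ?thesis unfolding G_iff by auto
  qed
  have g_iff2: "pair (f \<gamma>) (ordn m) \<in> elts g \<longleftrightarrow> m \<le> \<kappa> \<gamma>" if "\<gamma> \<in> T \<beta>0" for \<gamma> m
    unfolding g_iff using f_inj that by (auto simp: ordn_inj)

  \<comment> \<open>The inner quantifier over n says that \<kappa> of the owner of \<open>i\<close>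
    is at most \<kappa> of the owner of the later position \<open>j\<close>.\<close>
  let ?E = "\<lambda>g w z i. pair i z \<in> elts g \<and> (\<forall>j\<in>X. pair j z \<in> elts g \<longrightarrow> i \<in> elts j \<longrightarrow>
      (\<forall>n\<in>elts w. pair i n \<in> elts g \<longrightarrow> pair j n \<in> elts g))"
  have "Dfn (\<lambda>_. True) X (\<lambda>e. ?E (e (Suc (Suc 0))) (e (Suc 0)) (e 0) (e (Suc (Suc (Suc 0)))))"
    by (intro Dfn_and Dfn_imp Fm_all D_ball D_mem D_pair_mem dc_simps)
  from Dfn_const [where P = "\<lambda>z e. ?E (e (Suc 0)) (e 0) z (e (Suc (Suc 0)))", OF this zer_X]
  have "Dfn (\<lambda>_. True) X (\<lambda>e. ?E (e (Suc 0)) (e 0) zer (e (Suc (Suc 0))))" .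
  from Dfn_const [where P = "\<lambda>w e. ?E (e 0) w zer (e (Suc 0))", OF this omega_X]
  have "Dfn (\<lambda>_. True) X (\<lambda>e. ?E (e 0) omega zer (e (Suc 0)))" .
  from Dfn_const [where P = "\<lambda>g e. ?E g omega zer (e 0)", OF this g(1)]
  have DE: "Dfn (\<lambda>_. True) X (\<lambda>e. ?E g omega zer (e 0))" .
  have E_I: "i \<in> I" if "?E g omega zer i" for i
    using that unfolding g_iff I_def by blast
  have I_S: "I \<subseteq> S" unfolding S_def J_def by blast
  have "inX {i \<in> X. ?E g omega zer i}"
    by (rule cond [where Q = "\<lambda>i. ?E g omega zer i", OF DE subsetD [OF I_S E_I]])
  then obtain E where E: "E \<in> X" "elts E = {i \<in> X. ?E g omega zer i}" by (rule inXE)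
  have E_sub: "i \<in> I" if "i \<in> elts E" for i using that E_I unfolding E(2) by blast
  have E_iff: "f \<gamma> \<in> elts E \<longleftrightarrow> (\<forall>\<gamma>'\<in>T \<beta>0. \<gamma> \<in> elts \<gamma>' \<longrightarrow> \<kappa> \<gamma> \<le> \<kappa> \<gamma>')" if \<gamma>: "\<gamma> \<in> T \<beta>0" for \<gamma>
  proof
    assume e: "f \<gamma> \<in> elts E"
    show "\<forall>\<gamma>'\<in>T \<beta>0. \<gamma> \<in> elts \<gamma>' \<longrightarrow> \<kappa> \<gamma> \<le> \<kappa> \<gamma>'"
    proof (intro ballI impI)
      fix \<gamma>' assume \<gamma>': "\<gamma>' \<in> T \<beta>0" "\<gamma> \<in> elts \<gamma>'"
      have "pair (f \<gamma>') zer \<in> elts g" using g_iff2 [OF \<gamma>'(1), of 0] by simp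
      moreover have "f \<gamma> \<in> elts (f \<gamma>')" using f_mono [OF \<gamma> \<gamma>'(1)] \<gamma>'(2) by blast
      moreover have "ordn (\<kappa> \<gamma>) \<in> elts (omega :: 'a hset)" by (simp add: elts_omega)
      moreover have "pair (f \<gamma>) (ordn (\<kappa> \<gamma>)) \<in> elts g" using g_iff2 [OF \<gamma>] by simp
      ultimately have "pair (f \<gamma>') (ordn (\<kappa> \<gamma>)) \<in> elts g" using e f_X [OF \<gamma>'(1)] unfolding E(2) by blast
      then show "\<kappa> \<gamma> \<le> \<kappa> \<gamma>'" using g_iff2 [OF \<gamma>'(1)] by simp
    qed
  next
    assume k: "\<forall>\<gamma>'\<in>T \<beta>0. \<gamma> \<in> elts \<gamma>' \<longrightarrow> \<kappa> \<gamma> \<le> \<kappa> \<gamma>'"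
    have "pair j n \<in> elts g" if j: "pair j zer \<in> elts g" "f \<gamma> \<in> elts j" and n: "pair (f \<gamma>) n \<in> elts g" for j n
    proof -
      obtain \<gamma>' where \<gamma>': "\<gamma>' \<in> T \<beta>0" "j = f \<gamma>'" using j(1) unfolding g_iff by blast
      have "\<kappa> \<gamma> \<le> \<kappa> \<gamma>'" using k \<gamma>' j(2) f_mono [OF \<gamma> \<gamma>'(1)] by blast
      moreover obtain m where m: "n = ordn m" using n unfolding g_iff by blast
      moreover have "m \<le> \<kappa> \<gamma>" using n g_iff2 [OF \<gamma>] m by simp
      ultimately show ?thesis using g_iff2 [OF \<gamma>'(1), of m] \<gamma>'(2) by simp
    qed
    moreover have "pair (f \<gamma>) zer \<in> elts g" using g_iff2 [OF \<gamma>, of 0] by simp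
    ultimately show "f \<gamma> \<in> elts E" unfolding E(2) using f_X [OF \<gamma>] by blast
  qed
  have E_unb: "\<exists>\<gamma>\<in>T \<beta>0. elts \<beta> \<subseteq> elts \<gamma> \<and> f \<gamma> \<in> elts E" if \<beta>: "\<beta> \<in> elts \<alpha>" for \<beta>
  proof -
    obtain \<gamma>0 where \<gamma>0: "\<gamma>0 \<in> T \<beta>0 \<and> elts \<beta> \<subseteq> elts \<gamma>0" using T_unb [OF \<beta>] by blast
    \<comment> \<open>A member beyond \<beta> with the least \<kappa> among all those members is not
      undercut later, so its position is in \<open>E\<close>.\<close>
    obtain \<gamma> where \<gamma>: "\<gamma> \<in> T \<beta>0 \<and> elts \<beta> \<subseteq> elts \<gamma>" "\<And>\<gamma>'. \<gamma>' \<in> T \<beta>0 \<and> elts \<beta> \<subseteq> elts \<gamma>' \<Longrightarrow> \<kappa> \<gamma> \<le> \<kappa> \<gamma>'"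
      using ex_has_least_nat [of "\<lambda>\<gamma>. \<gamma> \<in> T \<beta>0 \<and> elts \<beta> \<subseteq> elts \<gamma>", OF \<gamma>0, of \<kappa>] by blast
    have "\<kappa> \<gamma> \<le> \<kappa> \<gamma>'" if "\<gamma>' \<in> T \<beta>0" "\<gamma> \<in> elts \<gamma>'" for \<gamma>'
      using \<gamma> that Ord_elts_subset [OF Ord_in_alpha [OF T_alpha [OF that(1)]] that(2)] by blast
    then have "f \<gamma> \<in> elts E" using E_iff \<gamma>(1) by blast
    then show ?thesis using \<gamma>(1) by blast
  qed

  let ?A = "\<lambda>E x. x \<in> elts E \<and> (Ord x \<and> alt E x = one)"
  have "Dfn (\<lambda>_. True) X (\<lambda>e. e (Suc 0) \<in> elts (e 0))" by (intro D_mem dc_simps)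
  from Dfn_const [where P = "\<lambda>c e. e 0 \<in> elts c", OF this E(1)]
  have DA: "Dfn (\<lambda>_. True) X (\<lambda>e. ?A E (e 0))"
    by (intro Dfn_and Sig_Fm [OF Sig_alt [OF E(1)]] dc_simps)
  have "inX {x \<in> X. ?A E x}"
    by (rule cond [where Q = "\<lambda>x. ?A E x", OF DA]) (use E_sub I_S in blast)
  then obtain A where A: "A \<in> X" "elts A = {x \<in> X. ?A E x}" by (rule inXE)
  have A_iff: "f \<gamma> \<in> elts A \<longleftrightarrow> f \<gamma> \<in> elts E \<and> alt E (f \<gamma>) = one" if "\<gamma> \<in> T \<beta>0" for \<gamma>
    unfolding A(2) using f_X [OF that] f_Ord [OF that] by blast
  have flip: "\<exists>\<gamma>\<in>T \<beta>0. \<exists>\<gamma>'\<in>T \<beta>0. elts \<beta> \<subseteq> elts \<gamma> \<and> elts \<beta> \<subseteq> elts \<gamma>' \<and> f \<gamma> \<in> elts E \<and> f \<gamma>' \<in> elts E \<and>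
      (alt E (f \<gamma>') = one \<longleftrightarrow> alt E (f \<gamma>) \<noteq> one)" if \<beta>: "\<beta> \<in> elts \<alpha>" for \<beta>
  proof -
    obtain \<gamma>1 where \<gamma>1: "\<gamma>1 \<in> T \<beta>0" "elts \<beta> \<subseteq> elts \<gamma>1" "f \<gamma>1 \<in> elts E" using E_unb [OF \<beta>] by blast
    \<comment> \<open>Passing to the successor of \<open>\<gamma>1\<close> puts
      \<open>\<gamma>2\<close> strictly above it.\<close>
    obtain \<gamma>2 where \<gamma>2: "\<gamma>2 \<in> T \<beta>0" "elts (hinsert \<gamma>1 \<gamma>1) \<subseteq> elts \<gamma>2" "f \<gamma>2 \<in> elts E"
      using E_unb [OF osuc_alpha [OF T_alpha [OF \<gamma>1(1)]]] by blast
    have "\<gamma>1 \<in> elts \<gamma>2" using \<gamma>2(2) by simp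
    then have lt: "f \<gamma>2 \<in> elts E \<and> f \<gamma>1 \<in> elts (f \<gamma>2)" using f_mono [OF \<gamma>1(1) \<gamma>2(1)] \<gamma>2(3) by blast
    \<comment> \<open>The least element of \<open>E\<close> above \<open>f \<gamma>1\<close> has
      \<open>f \<gamma>1\<close> as its predecessor in \<open>E\<close>, so \<open>alt\<close> takes
      opposite values at the two.\<close>
    show ?thesis
    proof (rule Ord_least [of "\<lambda>x. x \<in> elts E \<and> f \<gamma>1 \<in> elts x", OF lt f_Ord [OF \<gamma>2(1)]])
      fix x assume x: "x \<in> elts E \<and> f \<gamma>1 \<in> elts x" "Ord x" "\<And>c. c \<in> elts x \<Longrightarrow> \<not> (c \<in> elts E \<and> f \<gamma>1 \<in> elts c)"
      obtain \<gamma>3 where \<gamma>3: "\<gamma>3 \<in> T \<beta>0" "x = f \<gamma>3" using E_sub x(1) unfolding I_def by blast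
      have mx: "a \<in> elts (f \<gamma>1) \<or> a = f \<gamma>1" if a: "a \<in> elts E \<inter> elts x" for a
        using x(3) [of a] a Ord_linear [OF f_Ord [OF \<gamma>1(1)] Ord_mem [OF x(2)], of a] by blast
      have "alt E x = one \<longleftrightarrow> alt E (f \<gamma>1) \<noteq> one"
      proof
        assume "alt E x = one"
        then show "alt E (f \<gamma>1) \<noteq> one" using alt_iff [of E x] mx x(1) \<gamma>1(3) by blast
      next
        assume ne1: "alt E (f \<gamma>1) \<noteq> one"
        have "\<not> (alt E y = one \<and> (\<forall>a\<in>elts E \<inter> elts x. a \<in> elts y \<or> a = y))" if y: "y \<in> elts E \<inter> elts x" for y
        proof
          assume *: "alt E y = one \<and> (\<forall>a\<in>elts E \<inter> elts x. a \<in> elts y \<or> a = y)"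
          then have "f \<gamma>1 \<in> elts y \<or> f \<gamma>1 = y" using x(1) \<gamma>1(3) by blast
          then show False using mx [OF y] mem_asym ne1 * mem_irrefl by metis
        qed
        then show "alt E x = one" using alt_iff [of E x] by blast
      qed
      moreover have "\<gamma>1 \<in> elts \<gamma>3" using f_mono [OF \<gamma>1(1) \<gamma>3(1)] x(1) \<gamma>3(2) by blast
      then have "elts \<beta> \<subseteq> elts \<gamma>3"
        using \<gamma>1(2) Ord_elts_subset [OF Ord_in_alpha [OF T_alpha [OF \<gamma>3(1)]]] by blast
      ultimately show ?thesis using \<gamma>1 \<gamma>3 x(1) by blast
    qed
  qed

  \<comment> \<open>The last clause demands as many values by stage \<sigma> as the final owner of
    \<open>j\<close> takes in total. It is written as a disjunction because Sigma_1 predicates are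
    not closed under negation, while the negated part is \<Delta>0.\<close>
  let ?W = "\<lambda>\<beta> A g w \<gamma>. Ord \<gamma> \<and> (\<exists>\<sigma>\<in>X. \<exists>j\<in>X. isPos \<beta> \<sigma> \<gamma> j \<and> j \<in> elts A \<and>
      (\<forall>n\<in>elts w. \<not> pair j n \<in> elts g \<or> NV \<beta> n \<sigma> \<gamma>))"
  have "Sig (\<lambda>e. ?W (e (Suc (Suc (Suc 0)))) (e (Suc (Suc 0))) (e (Suc 0)) (e 0) (e (Suc (Suc (Suc (Suc 0))))))"
    by (intro Sig_and Sig_ex Sig_ball Sig_or Sig_isPos Sig_NV; intro Sig_Del D_Ord D_mem Dfn_neg D_pair_mem dc_simps)
  from Sig_const [where P = "\<lambda>w e. ?W (e (Suc (Suc 0))) (e (Suc 0)) (e 0) w (e (Suc (Suc (Suc 0))))", OF this omega_X]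
  have "Sig (\<lambda>e. ?W (e (Suc (Suc 0))) (e (Suc 0)) (e 0) omega (e (Suc (Suc (Suc 0)))))" .
  from Sig_const [where P = "\<lambda>g e. ?W (e (Suc 0)) (e 0) g omega (e (Suc (Suc 0)))", OF this g(1)]
  have "Sig (\<lambda>e. ?W (e (Suc 0)) (e 0) g omega (e (Suc (Suc 0))))" .
  from Sig_const [where P = "\<lambda>A e. ?W (e 0) A g omega (e (Suc 0))", OF this A(1)]
  have "Sig (\<lambda>e. ?W (e 0) A g omega (e (Suc 0)))" .
  from Sig_const [where P = "\<lambda>b e. ?W b A g omega (e 0)", OF this alpha_X [OF \<beta>0(1)]]
  have SW: "Sig (\<lambda>e. ?W \<beta>0 A g omega (e 0))" .
  define W where "W = {\<gamma> \<in> X. ?W \<beta>0 A g omega \<gamma>}"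
  have W_RE: "alpha_RE \<alpha> W" unfolding W_def by (rule alpha_REI [OF SW]) blast
  \<comment> \<open>At a stable stage \<gamma> is at its final position and has taken all its
    values, which is just what is demanded of the owner of that position.\<close>
  have in_W: "\<gamma> \<in> W" if \<gamma>: "\<gamma> \<in> T \<beta>0" "f \<gamma> \<in> elts A" for \<gamma>
  proof -
    have \<gamma>': "\<gamma> \<in> elts \<alpha>" using T_alpha [OF \<gamma>(1)] .
    obtain \<tau> where \<tau>: "\<tau> \<in> elts \<alpha>" "Vs \<beta>0 \<tau> \<gamma> = V \<beta>0 \<gamma>" "pos \<beta>0 \<tau> \<gamma> = f \<gamma>"
      using stable [OF \<beta>0(1) \<gamma>'] unfolding f_def by blast
    have "NV \<beta>0 n \<tau> \<gamma>" if n: "pair (f \<gamma>) n \<in> elts g" for n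
    proof -
      obtain m where m: "n = ordn m" using n unfolding g_iff by blast
      then have "m \<le> \<kappa> \<gamma>" using g_iff2 [OF \<gamma>(1)] n by simp
      then show ?thesis unfolding m NV_iff [OF \<beta>0(1) \<gamma>'] \<tau>(2) \<kappa>_def .
    qed
    moreover have "isPos \<beta>0 \<tau> \<gamma> (f \<gamma>)" using \<tau> Ord_in_alpha \<gamma>' unfolding isPos_def by blast
    ultimately show ?thesis
      unfolding W_def using \<gamma>(2) alpha_X [OF \<gamma>'] Ord_in_alpha [OF \<gamma>'] alpha_X [OF \<tau>(1)] f_X [OF \<gamma>(1)] by blast
  qed
  \<comment> \<open>If \<gamma> were in \<open>W\<close> by way of a position \<open>j\<close>, then
    \<open>j\<close> would lie strictly above its final position. So a value is still to come, and
    fewer than \<kappa> \<gamma> have been taken. The owner of \<open>j\<close> comes after \<gamma>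
    and has at least \<kappa> \<gamma> values, as \<open>f \<gamma>\<close> is in
    \<open>E\<close>.\<close>
  have not_W: "\<gamma> \<notin> W" if \<gamma>: "\<gamma> \<in> T \<beta>0" "f \<gamma> \<in> elts E" "f \<gamma> \<notin> elts A" for \<gamma>
  proof
    assume "\<gamma> \<in> W"
    then obtain \<sigma> j where W: "\<sigma> \<in> X" "isPos \<beta>0 \<sigma> \<gamma> j" "j \<in> elts A"
      "\<And>n. n \<in> elts omega \<Longrightarrow> pair j n \<in> elts g \<Longrightarrow> NV \<beta>0 n \<sigma> \<gamma>" unfolding W_def by blast
    have \<gamma>': "\<gamma> \<in> elts \<alpha>" using T_alpha [OF \<gamma>(1)] .
    have \<sigma>: "\<sigma> \<in> elts \<alpha>" "pos \<beta>0 \<sigma> \<gamma> = j" using W(1,2) Ord_X_iff unfolding isPos_def by blast+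
    obtain \<gamma>2 where \<gamma>2: "\<gamma>2 \<in> T \<beta>0" "j = f \<gamma>2" using W(3) E_sub unfolding A(2) I_def by blast
    have jV: "j \<in> V \<beta>0 \<gamma>" using \<sigma> unfolding V_def by blast
    have le: "elts (f \<gamma>) \<subseteq> elts j" using final_least [OF \<beta>0(1) \<gamma>' jV] unfolding f_def .
    have "f \<gamma> \<noteq> j" using \<gamma>(3) W(3) by blast
    then have lt: "f \<gamma> \<in> elts j" using le Ord_subset_iff [OF f_Ord [OF \<gamma>(1)] f_Ord [OF \<gamma>2(1)]] \<gamma>2(2) by blast
    then have "\<gamma> \<in> elts \<gamma>2" using f_mono [OF \<gamma>(1) \<gamma>2(1)] \<gamma>2(2) by blast
    then have k: "\<kappa> \<gamma> \<le> \<kappa> \<gamma>2" using E_iff [OF \<gamma>(1)] \<gamma>(2) \<gamma>2(1) by blast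
    have "pair j (ordn (\<kappa> \<gamma>2)) \<in> elts g" using g_iff2 [OF \<gamma>2(1)] \<gamma>2(2) by simp
    moreover have "ordn (\<kappa> \<gamma>2) \<in> elts (omega :: 'a hset)" by (simp add: elts_omega)
    ultimately have "NV \<beta>0 (ordn (\<kappa> \<gamma>2)) \<sigma> \<gamma>" using W(4) by blast
    then have "\<kappa> \<gamma>2 \<le> card (Vs \<beta>0 \<sigma> \<gamma>)" unfolding NV_iff [OF \<beta>0(1) \<gamma>'] .
    \<comment> \<open>Positions never rise again: had the final value been taken by stage \<sigma>,
      the position at \<sigma> could not be \<open>j\<close>.\<close>
    moreover have "f \<gamma> \<notin> Vs \<beta>0 \<sigma> \<gamma>"
    proof
      assume "f \<gamma> \<in> Vs \<beta>0 \<sigma> \<gamma>"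
      then obtain \<tau> where \<tau>: "\<tau> \<in> elts \<alpha>" "elts \<tau> \<subseteq> elts \<sigma>" "f \<gamma> = pos \<beta>0 \<tau> \<gamma>" unfolding Vs_def by blast
      have "elts j \<subseteq> elts (f \<gamma>)"
        using pos_anti [where \<beta> = \<beta>0, OF \<tau>(1) \<sigma>(1) \<gamma>' subset_refl \<tau>(2)] unfolding \<tau>(3) \<sigma>(2) .
      then have "f \<gamma> \<in> elts (f \<gamma>)" using lt by blast
      then show False by simp
    qed
    moreover have "insert (f \<gamma>) (Vs \<beta>0 \<sigma> \<gamma>) \<subseteq> V \<beta>0 \<gamma>"
      using final_in_V [OF \<beta>0(1) \<gamma>'] Vs_V unfolding f_def by blast
    then have "card (insert (f \<gamma>) (Vs \<beta>0 \<sigma> \<gamma>)) \<le> \<kappa> \<gamma>"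
      unfolding \<kappa>_def by (rule card_mono [OF finite_V [OF \<beta>0(1) \<gamma>']])
    moreover have "finite (Vs \<beta>0 \<sigma> \<gamma>)" using finite_subset [OF Vs_V finite_V [OF \<beta>0(1) \<gamma>']] .
    ultimately show False using k by simp
  qed
  have both: "(\<exists>\<gamma>\<in>C \<inter> W. elts \<beta> \<subseteq> elts \<gamma>) \<and> (\<exists>\<gamma>\<in>C - W. elts \<beta> \<subseteq> elts \<gamma>)" if \<beta>: "\<beta> \<in> elts \<alpha>" for \<beta>
  proof -
    obtain \<gamma> \<gamma>' where \<gamma>: "\<gamma> \<in> T \<beta>0" "\<gamma>' \<in> T \<beta>0" "elts \<beta> \<subseteq> elts \<gamma>" "elts \<beta> \<subseteq> elts \<gamma>'" "f \<gamma> \<in> elts E" "f \<gamma>' \<in> elts E"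
      "alt E (f \<gamma>') = one \<longleftrightarrow> alt E (f \<gamma>) \<noteq> one" using flip [OF \<beta>] by blast
    have "\<gamma> \<in> C" "\<gamma>' \<in> C" using \<gamma>(1,2) unfolding T_def by blast+
    then show ?thesis using \<gamma> in_W not_W A_iff by blast
  qed
  \<comment> \<open>By cohesiveness, \<open>W\<close> contains all members of \<open>C\<close> from
    some point on, against the second half of \<open>both\<close>.\<close>
  obtain \<delta> where \<delta>: "\<delta> \<in> elts \<alpha>" "\<forall>\<gamma>\<in>C. elts \<delta> \<subseteq> elts \<gamma> \<longrightarrow> \<gamma> \<in> W"
    using cohesive [OF W_RE] both by blast
  then show False using both by blast
qed

end

theorem theorem5:
  fixes \<alpha> :: "'a hset"
  assumes "Sigma1_admissible \<alpha>"
    and "\<exists>M. maximal_alpha_RE \<alpha> M"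
  shows "countable (elts \<alpha>)"
proof (rule ccontr)
  assume "uncountable (elts \<alpha>)"
  then interpret adm \<alpha> by unfold_locales (rule assms(1))
  obtain M where M: "maximal_alpha_RE \<alpha> M" using assms(2) by blast
  then have "alpha_RE \<alpha> M" by (simp add: maximal_alpha_RE_def)
  then show False
  proof (rule RE_witness)
    fix R assume R: "\<And>i j :: nat. i \<noteq> j \<Longrightarrow> Dfn Delta0 X (\<lambda>e. R (e i) (e j))"
      "\<And>x. x \<in> X \<Longrightarrow> x \<in> M \<longleftrightarrow> (\<exists>w\<in>X. R w x)"
    interpret maximal \<alpha> M R by unfold_locales (use M R in auto)
    show False by (rule contradiction)
  qed
qed

end
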